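(* Let $l>0$ and $k\in[l-2,l-1)$ be two constants and set $$\omega_k=\frac{\sqrt{-1}}{2}(1+|z|^2)^{k}dz\wedge d\bar z\quad\text{on }\mathbb{C}.$$ Let $f,h$ be smooth real functions on $\mathbb{C}$, neither identically zero, satisfying $$\int_{\mathbb{C}}f\omega_k<0,\qquad |f|\leq\Lambda(1+|z|^2)^{-l},\qquad -\Lambda(1+|z|^2)^{-l}\leq h\leq0,$$ for a constant $\Lambda$. Then the equation $$\sqrt{-1}\Lambda_{\omega_k}\partial\bar\partial u+he^u=f$$ admits a bounded smooth solution $u$ on $\mathbb{C}$.
   Context: $\Lambda_{\omega_k}$ is the adjoint of wedging with $\omega_k$; explicitly, for a function $u$, $\sqrt{-1}\Lambda_{\omega_k}\partial\bar\partial u=2(1+|z|^2)^{-k}\,\partial^2u/\partial z\partial\bar z=\frac12(1+|z|^2)^{-k}(\partial_x^2+\partial_y^2)u$, $z=x+\sqrt{-1}y$. *)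

theory Defs
  imports "HOL-Analysis.Analysis"
begin

text \<open>Continuous differentiability of order n and smoothness on the whole space, with all derivatives
  taken in the Frechet sense.\<close>

primrec C_order :: "nat \<Rightarrow> ('a::real_normed_vector \<Rightarrow> 'b::real_normed_vector) \<Rightarrow> bool" where
  "C_order 0 f \<longleftrightarrow> continuous_on UNIV f"
| "C_order (Suc n) f \<longleftrightarrow> (\<forall>x. f differentiable at x) \<and>
     (\<forall>v. C_order n (\<lambda>x. frechet_derivative f (at x) v))"

definition smooth :: "('a::real_normed_vector \<Rightarrow> 'b::real_normed_vector) \<Rightarrow> bool" where
  "smooth f \<longleftrightarrow> (\<forall>n. C_order n f)"

text \<open>Wirtinger derivatives: the directions 1 and i are the x and y directions.\<close>

definition d_z :: "(complex \<Rightarrow> complex) \<Rightarrow> complex \<Rightarrow> complex" where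
  "d_z g z = (frechet_derivative g (at z) 1 - \<i> * frechet_derivative g (at z) \<i>) / 2"

definition d_zbar :: "(complex \<Rightarrow> complex) \<Rightarrow> complex \<Rightarrow> complex" where
  "d_zbar g z = (frechet_derivative g (at z) 1 + \<i> * frechet_derivative g (at z) \<i>) / 2"

text \<open>A complex-valued 2-form on the plane, evaluated at a point on two tangent vectors.\<close>

type_synonym covector2 = "complex \<Rightarrow> complex \<Rightarrow> complex"
type_synonym form2 = "complex \<Rightarrow> covector2"

definition dz_wedge_dzbar :: covector2 where
  "dz_wedge_dzbar v w = v * cnj w - w * cnj v"

definition omega :: "real \<Rightarrow> form2" where
  "omega k z v w = \<i> / 2 * of_real ((1 + (cmod z)\<^sup>2) powr k) * dz_wedge_dzbar v w"

definition del_delbar :: "(complex \<Rightarrow> complex) \<Rightarrow> form2" where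
  "del_delbar g z v w = d_z (d_zbar g) z * dz_wedge_dzbar v w"

text \<open>Integration uses the standard orientation, for which (1, i) is an oriented basis.\<close>

definition form2_integral :: "form2 \<Rightarrow> complex" where
  "form2_integral \<alpha> = (LINT z|lborel. \<alpha> z 1 \<i>)"

text \<open>Hermitian inner product on 2-covectors induced by the metric whose fundamental form is the
  positive (1,1)-covector \<open>\<omega>\<close>: for \<open>r = \<omega> 1 \<i>\<close> the vectors \<open>1 / sqrt r\<close> and \<open>\<i> / sqrt r\<close>
  are an orthonormal basis, and \<open>\<alpha>\<close>, \<open>\<beta>\<close> are evaluated on it.\<close>

definition covector2_inner :: "covector2 \<Rightarrow> covector2 \<Rightarrow> covector2 \<Rightarrow> complex" where
  "covector2_inner \<omega> \<alpha> \<beta> = (\<alpha> 1 \<i> / \<omega> 1 \<i>) * cnj (\<beta> 1 \<i> / \<omega> 1 \<i>)"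

text \<open>The operator \<open>\<Lambda>\<^sub>\<omega>\<close> on 2-forms: the pointwise adjoint of \<open>a \<mapsto> a \<omega>\<close> on functions.\<close>

definition Lambda_op :: "form2 \<Rightarrow> form2 \<Rightarrow> complex \<Rightarrow> complex" where
  "Lambda_op \<omega> \<alpha> z =
     (THE c. \<forall>a. c * cnj a = covector2_inner (\<omega> z) (\<alpha> z) (\<lambda>v w. a * \<omega> z v w))"

lemma omega_basis: "omega k z 1 \<i> = of_real ((1 + (cmod z)\<^sup>2) powr k)"
proof -
  have "\<i> / 2 * a * (1 * cnj \<i> - \<i> * cnj 1) = a" for a
    by (simp add: complex_eq_iff)
  then show ?thesis
    unfolding omega_def dz_wedge_dzbar_def .
qed

lemma omega_basis_nonzero: "omega k z 1 \<i> \<noteq> 0"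
proof -
  have "1 + (cmod z)\<^sup>2 > 0" by (simp add: add_pos_nonneg)
  then show ?thesis by (simp add: omega_basis)
qed

lemma Lambda_op_omega: "Lambda_op (omega k) \<alpha> z = \<alpha> z 1 \<i> / omega k z 1 \<i>"
  unfolding Lambda_op_def
proof (rule the_equality)
  show "\<forall>a. \<alpha> z 1 \<i> / omega k z 1 \<i> * cnj a =
      covector2_inner (omega k z) (\<alpha> z) (\<lambda>v w. a * omega k z v w)"
    using omega_basis_nonzero[of k z] by (simp add: covector2_inner_def)
next
  fix c assume "\<forall>a. c * cnj a =
      covector2_inner (omega k z) (\<alpha> z) (\<lambda>v w. a * omega k z v w)"
  from this[rule_format, of 1] show "c = \<alpha> z 1 \<i> / omega k z 1 \<i>"
    using omega_basis_nonzero[of k z] by (simp add: covector2_inner_def)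
qed

lemma i_Lambda_op_del_delbar:
  "\<i> * Lambda_op (omega k) (del_delbar g) z =
     2 * of_real ((1 + (cmod z)\<^sup>2) powr (- k)) * d_z (d_zbar g) z"
proof -
  define r where "r = (1 + (cmod z)\<^sup>2) powr k"
  define d where "d = d_z (d_zbar g) z"
  have "1 * cnj \<i> - \<i> * cnj 1 = - (2 * \<i>)" by simp
  then have "\<i> * (d * (1 * cnj \<i> - \<i> * cnj 1) / complex_of_real r) =
      2 * complex_of_real (inverse r) * d"
    by (simp add: divide_inverse)
  then show ?thesis
    unfolding Lambda_op_omega omega_basis del_delbar_def dz_wedge_dzbar_def powr_minus r_def d_def .
qed

lemma form2_integral_omega:
  "form2_integral (\<lambda>z v w. of_real (f z) * omega k z v w) =
     of_real (LINT z|lborel. f z * (1 + (cmod z)\<^sup>2) powr k)"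
proof -
  have "form2_integral (\<lambda>z v w. of_real (f z) * omega k z v w) =
      (LINT z|lborel. of_real (f z * (1 + (cmod z)\<^sup>2) powr k))"
    by (simp add: form2_integral_def omega_basis)
  then show ?thesis by (simp only: integral_complex_of_real)
qed

end

(*
  With rho = 1 + |z|^2 the equation is Laplace u = F + H e^u, where F = 2 rho^k f has negative
  integral, H = -2 rho^k h >= 0, and both decay like rho^(-1-b) with 0 < b = l - 1 - k <= 1.
  Choose mu > 0 such that G = F + mu H has mean zero, and let v be a bounded solution of
  Laplace v = G; then v + c and v - c are barriers for a large constant c, and a solution is found
  between them by monotone iteration.

  Green functions are avoided as follows. Let A_t u and B_t u be the integrals of
  (1 - |y|^2)_+^2 u(z + t y) and of (1 - |y|^2)_+^3 u(z + t y) over y. Then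
  d/dt A_t u = (t/6) B_t (Laplace u), and integrating this against exp (- K t^2) over [0,1] writes u
  as an average of u minus an average of Laplace u, both local. With Laplace u replaced by F + H e^u
  the right-hand side is monotone in u when K is large, and it gains one derivative, so its bounded
  fixed points are smooth. If q = Laplace u - (F + H e^u) for a fixed point u, the average of q
  vanishes everywhere; hence q is an average of itself of mass less than one, and q, which is
  bounded after an integration by parts, is zero. For mean zero G the integral of (t/6) B_t G over
  t > 0 converges uniformly and gives v.
*)
theory Submission imports Defs begin


text \<open>The constants come from the gradient of (1 - |y|^2)^3, which is -6 y (1 - |y|^2)^2 on
  the disc: the scale derivative of A_t u pairs y (1 - |y|^2)^2 with the gradient of u, and
  integration by parts turns this into the cube against Laplace u with the factor t/6. The cube lies
  below the square and the two weights in t have ratio 12 K, so 12 K >= H e^u suffices for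
  monotonicity.

  The obstacle on the whole plane is the way back from averages to the pointwise equation: a fixed
  point controls only averages of q, and q involves second derivatives of u, for which no global
  bound is at hand. Averages commute with Laplace, so those of Laplace q vanish too, and in what
  remains of the formula for q one derivative of u can be moved to the kernel.

  The range of k is used as 0 < b <= 1. Positivity gives F and H finite moments of order b, and b <=
  1 lets the Lipschitz kernel act as a Hoelder one. With mean zero this yields |B_t G| <= const
  t^(-2-b), so t B_t G is integrable at infinity; for nonzero mean it would decay like 1/t only,
  which is the logarithm of the Green function.\<close>

section \<open>Dominated convergence and differentiation under the integral sign\<close>

lemma abs_integral_le:
  fixes f g :: "'b \<Rightarrow> real"
  assumes "f \<in> borel_measurable M" "integrable M g" "\<And>x. x \<in> space M \<Longrightarrow> \<bar>f x\<bar> \<le> g x"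
  shows "\<bar>LINT x|M. f x\<bar> \<le> (LINT x|M. g x)"
proof -
  have "integrable M f"
    by (rule Bochner_Integration.integrable_bound[OF assms(2,1)])
       (use assms(3) in \<open>auto intro!: AE_I2 intro: order_trans[OF _ abs_ge_self]\<close>)
  then show ?thesis
    by (intro order_trans[OF integral_abs_bound] integral_mono) (use assms in auto)
qed

text \<open>Dominated convergence speaks of sequences, so the limit at \<open>z0\<close> is tested
  on sequences, whose tails lie in the ball. Domination is asked only on a ball because averages of
  functions without growth conditions have only local majorants.\<close>

lemma tendsto_integral_dominated:
  fixes f :: "'a::metric_space \<Rightarrow> 'b \<Rightarrow> real"
  assumes meas: "\<And>z. z \<in> ball z0 r \<Longrightarrow> f z \<in> borel_measurable M" "L \<in> borel_measurable M" and r: "r > 0"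
    and lim: "\<And>x. x \<in> space M \<Longrightarrow> ((\<lambda>z. f z x) \<longlongrightarrow> L x) (at z0)"
    and w: "integrable M w" "\<And>z x. z \<in> ball z0 r \<Longrightarrow> x \<in> space M \<Longrightarrow> \<bar>f z x\<bar> \<le> w x"
  shows "((\<lambda>z. LINT x|M. f z x) \<longlongrightarrow> (LINT x|M. L x)) (at z0)"
  unfolding tendsto_at_iff_sequentially comp_def
proof (intro allI impI)
  fix X assume X: "\<forall>i::nat. X i \<in> UNIV - {z0}" "X \<longlonglongrightarrow> z0"
  from X(2) r obtain N where N: "\<And>n. n \<ge> N \<Longrightarrow> X n \<in> ball z0 r"
    unfolding LIMSEQ_def by (auto simp: dist_commute)
  show "(\<lambda>n. LINT x|M. f (X n) x) \<longlonglongrightarrow> (LINT x|M. L x)"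
  proof (rule LIMSEQ_offset[of _ N], rule integral_dominated_convergence[where w=w])
    show "AE x in M. (\<lambda>i. f (X (i + N)) x) \<longlonglongrightarrow> L x"
    proof (rule AE_I2)
      fix x assume "x \<in> space M"
      from lim[OF this] X have "(\<lambda>i. f (X i) x) \<longlonglongrightarrow> L x"
        unfolding tendsto_at_iff_sequentially comp_def by auto
      then show "(\<lambda>i. f (X (i + N)) x) \<longlonglongrightarrow> L x" by (rule LIMSEQ_ignore_initial_segment)
    qed
  qed (use assms N in auto)
qed

text \<open>The Frechet remainder quotient tends to zero pointwise and is dominated by
  \<open>2 * \<bar>w x\<bar>\<close>, so \<open>tendsto_integral_dominated\<close> applies to it.
  The bound by \<open>w\<close> holds in every direction, which also makes the integrated derivative
  a bounded linear map.\<close>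

lemma has_derivative_integral_dominated:
  fixes f :: "'a::real_normed_vector \<Rightarrow> 'b \<Rightarrow> real"
  assumes int: "\<And>z. z \<in> ball z0 r \<Longrightarrow> integrable M (f z)" and r: "r > 0"
    and der: "\<And>x z. x \<in> space M \<Longrightarrow> z \<in> ball z0 r \<Longrightarrow> ((\<lambda>z. f z x) has_derivative f' z x) (at z)"
    and bound: "\<And>x z v. x \<in> space M \<Longrightarrow> z \<in> ball z0 r \<Longrightarrow> \<bar>f' z x v\<bar> \<le> w x * norm v"
    and w: "integrable M w"
    and meas: "\<And>v. (\<lambda>x. f' z0 x v) \<in> borel_measurable M"
  shows "((\<lambda>z. LINT x|M. f z x) has_derivative (\<lambda>v. LINT x|M. f' z0 x v)) (at z0)"
proof -
  have z0: "z0 \<in> ball z0 r" using r by simp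
  have bl: "bounded_linear (f' z0 x)" if "x \<in> space M" for x
    using der[OF that z0] by (rule has_derivative_bounded_linear)
  have intf': "integrable M (\<lambda>x. f' z0 x v)" for v
    by (rule Bochner_Integration.integrable_bound[of _ "\<lambda>x. w x * norm v"])
       (use w meas bound[OF _ z0] in \<open>auto intro!: AE_I2 intro: order_trans[OF _ abs_ge_self]\<close>)
  have lin: "bounded_linear (\<lambda>v. LINT x|M. f' z0 x v)"
  proof (rule bounded_linear_intro[where K="LINT x|M. \<bar>w x\<bar>"])
    fix u v
    have "(LINT x|M. f' z0 x (u + v)) = (LINT x|M. f' z0 x u + f' z0 x v)"
      by (rule Bochner_Integration.integral_cong) (auto simp: bl linear_add[OF bounded_linear.linear])
    then show "(LINT x|M. f' z0 x (u + v)) = (LINT x|M. f' z0 x u) + (LINT x|M. f' z0 x v)"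
      using intf' by simp
  next
    fix c v
    have "(LINT x|M. f' z0 x (c *\<^sub>R v)) = (LINT x|M. c * f' z0 x v)"
      by (rule Bochner_Integration.integral_cong) (auto simp: bl linear_cmul[OF bounded_linear.linear])
    then show "(LINT x|M. f' z0 x (c *\<^sub>R v)) = c *\<^sub>R (LINT x|M. f' z0 x v)"
      by simp
  next
    fix v
    have "\<bar>LINT x|M. f' z0 x v\<bar> \<le> (LINT x|M. \<bar>w x\<bar> * norm v)"
    proof (rule abs_integral_le)
      show "\<bar>f' z0 x v\<bar> \<le> \<bar>w x\<bar> * norm v" if "x \<in> space M" for x
        using bound[OF that z0, of v] mult_right_mono[OF abs_ge_self[of "w x"] norm_ge_zero[of v]] by simp
    qed (use intf' w in auto)
    also have "\<dots> = norm v * (LINT x|M. \<bar>w x\<bar>)" by (simp add: mult.commute)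
    finally show "norm (LINT x|M. f' z0 x v) \<le> norm v * (LINT x|M. \<bar>w x\<bar>)" by simp
  qed
  define s where "s h x = (f (z0 + h) x - f z0 x - f' z0 x h) / norm h" for h x
  have inb: "z0 + h \<in> ball z0 r" if "h \<in> ball 0 r" for h using that by (simp add: dist_norm)
  have sb: "\<bar>s h x\<bar> \<le> 2 * \<bar>w x\<bar>" if h: "h \<in> ball 0 r" and x: "x \<in> space M" for h x
  proof (cases "h = 0")
    case False
    \<comment> \<open>The mean value inequality on the convex ball gives the increment the same
      majorant as the derivative; together with the linear term this accounts for the factor
      2.\<close>
    have *: "norm (f (z0 + h) x - f z0 x) \<le> \<bar>w x\<bar> * norm (z0 + h - z0)"
    proof (rule differentiable_bound[where S="ball z0 r" and f'="\<lambda>z. f' z x"])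
      show "onorm (f' z x) \<le> \<bar>w x\<bar>" if "z \<in> ball z0 r" for z
        by (rule onorm_bound)
           (use bound[OF x that] in \<open>auto intro: order_trans mult_right_mono[OF abs_ge_self norm_ge_zero]\<close>)
    qed (use h x inb z0 der in \<open>auto intro: has_derivative_at_withinI\<close>)
    have "\<bar>f (z0 + h) x - f z0 x - f' z0 x h\<bar> \<le> 2 * \<bar>w x\<bar> * norm h"
      using * bound[OF x z0, of h] mult_right_mono[OF abs_ge_self[of "w x"] norm_ge_zero[of h]] by simp
    then show ?thesis using False by (simp add: s_def abs_divide divide_le_eq)
  qed (simp add: s_def)
  have "((\<lambda>h. LINT x|M. s h x) \<longlongrightarrow> (LINT x|M. 0)) (at 0)"
  proof (rule tendsto_integral_dominated[where r=r and w="\<lambda>x. 2 * \<bar>w x\<bar>"])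
    show "s h \<in> borel_measurable M" if "h \<in> ball 0 r" for h
      using int[OF inb[OF that]] int[OF z0] meas unfolding s_def by measurable
    show "((\<lambda>h. s h x) \<longlongrightarrow> 0) (at 0)" if "x \<in> space M" for x
    proof -
      have "((\<lambda>h. norm (f (z0 + h) x - f z0 x - f' z0 x h) / norm h) \<longlongrightarrow> 0) (at 0)"
        using der[OF that z0] by (simp add: has_derivative_at)
      then show ?thesis unfolding s_def
        by (subst tendsto_norm_zero_iff[symmetric]) (simp add: norm_divide)
    qed
  qed (use w r sb in auto)
  then have "((\<lambda>h. norm (LINT x|M. s h x)) \<longlongrightarrow> 0) (at 0)"
    using tendsto_norm_zero by fastforce
  moreover have "norm (LINT x|M. s h x) = norm ((LINT x|M. f (z0 + h) x) - (LINT x|M. f z0 x) - (LINT x|M. f' z0 x h)) / norm h"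
    if "h \<in> ball 0 r" for h
    using int[OF inb[OF that]] int[OF z0] intf' unfolding s_def
    by (simp add: norm_divide)
  ultimately have "((\<lambda>h. norm ((LINT x|M. f (z0 + h) x) - (LINT x|M. f z0 x) - (LINT x|M. f' z0 x h)) / norm h) \<longlongrightarrow> 0) (at 0)"
    using r by (elim Lim_transform_eventually) (auto simp: eventually_at intro!: exI[of _ r])
  with lin show ?thesis by (simp add: has_derivative_at)
qed

section \<open>Averages over translates\<close>

text \<open>The regularity at which averages start to make sense. Continuity would be too much,
  since the limit of the monotone iteration is at first only known to be measurable and
  bounded.\<close>

definition locally_bounded :: "(complex \<Rightarrow> real) \<Rightarrow> bool" where
  "locally_bounded g \<longleftrightarrow> g \<in> borel_measurable borel \<and> (\<forall>R. \<exists>B. \<forall>z. norm z \<le> R \<longrightarrow> \<bar>g z\<bar> \<le> B)"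

lemma locally_boundedE:
  assumes "locally_bounded g"
  obtains B where "B \<ge> 0" "\<And>z. norm z \<le> R \<Longrightarrow> \<bar>g z\<bar> \<le> B"
proof -
  from assms obtain B where B: "\<And>z. norm z \<le> R \<Longrightarrow> \<bar>g z\<bar> \<le> B"
    unfolding locally_bounded_def by blast
  show ?thesis by (rule that[of "max 0 B"]) (auto intro: order_trans[OF B])
qed

lemma locally_bounded_measurable[measurable_dest]:
  "locally_bounded g \<Longrightarrow> g \<in> borel_measurable borel"
  by (simp add: locally_bounded_def)

lemma locally_bounded_cts:
  assumes "continuous_on UNIV g" shows "locally_bounded g"
  unfolding locally_bounded_def
proof safe
  show "g \<in> borel_measurable borel" using assms by (rule borel_measurable_continuous_onI)
  fix R
  have "compact (g ` cball 0 R)"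
    by (rule compact_continuous_image) (auto intro: continuous_on_subset[OF assms])
  then have "bounded (g ` cball 0 R)" by (rule compact_imp_bounded)
  then show "\<exists>B. \<forall>z. norm z \<le> R \<longrightarrow> \<bar>g z\<bar> \<le> B"
    unfolding bounded_iff by (metis imageI mem_cball_0 real_norm_def)
qed

lemma locally_bounded_bdd:
  assumes "g \<in> borel_measurable borel" "\<And>z. \<bar>g z\<bar> \<le> B" shows "locally_bounded g"
  using assms unfolding locally_bounded_def by auto

text \<open>The weight \<open>\<kappa>\<close> may be signed; \<open>\<phi>\<close> is bounded where \<open>\<kappa>\<close> does not vanish, so that averages
  are local and make sense for functions without any growth condition.\<close>

definition admissible :: "'b measure \<Rightarrow> ('b \<Rightarrow> real) \<Rightarrow> ('b \<Rightarrow> complex) \<Rightarrow> bool" where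
  "admissible M \<kappa> \<phi> \<longleftrightarrow> integrable M \<kappa> \<and> \<phi> \<in> borel_measurable M \<and> (\<exists>R. \<forall>x. \<kappa> x \<noteq> 0 \<longrightarrow> norm (\<phi> x) \<le> R)"

text \<open>The measure space and the displacement are left open so that a disc at one scale and a
  superposition over all scales are both instances and share one calculus.\<close>

definition average :: "'b measure \<Rightarrow> ('b \<Rightarrow> real) \<Rightarrow> ('b \<Rightarrow> complex) \<Rightarrow> (complex \<Rightarrow> real) \<Rightarrow> complex \<Rightarrow> real" where
  "average M \<kappa> \<phi> g z = (LINT x|M. \<kappa> x * g (z + \<phi> x))"

lemma admissibleE:
  assumes "admissible M \<kappa> \<phi>"
  obtains R where "R \<ge> 0" "\<And>x. \<kappa> x \<noteq> 0 \<Longrightarrow> norm (\<phi> x) \<le> R"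
proof -
  from assms obtain R where R: "\<And>x. \<kappa> x \<noteq> 0 \<Longrightarrow> norm (\<phi> x) \<le> R"
    unfolding admissible_def by blast
  show ?thesis by (rule that[of "max 0 R"]) (auto intro: order_trans[OF R])
qed

lemma admissible_dests[measurable_dest]:
  "admissible M \<kappa> \<phi> \<Longrightarrow> \<kappa> \<in> borel_measurable M"
  "admissible M \<kappa> \<phi> \<Longrightarrow> \<phi> \<in> borel_measurable M"
  by (auto simp: admissible_def)

lemma average_dominate:
  assumes a: "admissible M \<kappa> \<phi>" and g: "\<And>x. \<kappa> x \<noteq> 0 \<Longrightarrow> \<bar>g (z + \<phi> x)\<bar> \<le> B"
  shows "\<bar>\<kappa> x * g (z + \<phi> x)\<bar> \<le> \<bar>\<kappa> x\<bar> * B"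
  using g[of x] by (cases "\<kappa> x = 0") (auto simp: abs_mult intro!: mult_left_mono)

text \<open>Displacements are bounded where the weight lives, so points of one ball are moved into a
  larger ball, whose bound on \<open>g\<close> yields a majorant independent of
  \<open>z\<close>.\<close>

lemma average_local_bound:
  assumes a: "admissible M \<kappa> \<phi>" and g: "locally_bounded g"
  obtains B where "B \<ge> 0" "\<And>x (z::complex). norm z \<le> R \<Longrightarrow> \<bar>\<kappa> x * g (z + \<phi> x)\<bar> \<le> \<bar>\<kappa> x\<bar> * B"
proof -
  obtain R' where R': "R' \<ge> 0" "\<And>x. \<kappa> x \<noteq> 0 \<Longrightarrow> norm (\<phi> x) \<le> R'" using a by (rule admissibleE) blast
  obtain B where B: "B \<ge> 0" "\<And>z. norm z \<le> R + R' \<Longrightarrow> \<bar>g z\<bar> \<le> B" using g by (rule locally_boundedE) blast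
  show ?thesis
  proof (rule that[OF B(1)], rule average_dominate[OF a])
    fix x and z :: complex assume "norm z \<le> R" "\<kappa> x \<noteq> 0"
    then show "\<bar>g (z + \<phi> x)\<bar> \<le> B"
      using R'(2)[of x] norm_triangle_ineq[of z "\<phi> x"] by (intro B(2)) linarith
  qed
qed

lemma average_integrable:
  assumes a: "admissible M \<kappa> \<phi>" and g: "locally_bounded g"
  shows "integrable M (\<lambda>x. \<kappa> x * g (z + \<phi> x))"
proof -
  obtain B where B: "B \<ge> 0" "\<And>x w. norm w \<le> norm z \<Longrightarrow> \<bar>\<kappa> x * g (w + \<phi> x)\<bar> \<le> \<bar>\<kappa> x\<bar> * B"
    using average_local_bound[OF a g] by blast
  have m: "(\<lambda>x. \<kappa> x * g (z + \<phi> x)) \<in> borel_measurable M"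
    using admissible_dests[OF a] locally_bounded_measurable[OF g] by measurable
  show ?thesis
  proof (rule Bochner_Integration.integrable_bound[OF _ m])
    show "integrable M (\<lambda>x. \<bar>\<kappa> x\<bar> * B)" using a by (auto simp: admissible_def)
  qed (use B in auto)
qed

lemma average_add:
  assumes "admissible M \<kappa> \<phi>" "locally_bounded f" "locally_bounded g"
  shows "average M \<kappa> \<phi> (\<lambda>z. f z + g z) z = average M \<kappa> \<phi> f z + average M \<kappa> \<phi> g z"
  using average_integrable[OF assms(1,2), of z] average_integrable[OF assms(1,3), of z]
  by (simp add: average_def algebra_simps)

lemma average_cmult: "average M \<kappa> \<phi> (\<lambda>z. c * g z) z = c * average M \<kappa> \<phi> g z"
  by (simp add: average_def mult.left_commute[of _ c])

lemma average_diff: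
  assumes "admissible M \<kappa> \<phi>" "locally_bounded f" "locally_bounded g"
  shows "average M \<kappa> \<phi> (\<lambda>z. f z - g z) z = average M \<kappa> \<phi> f z - average M \<kappa> \<phi> g z"
  using average_integrable[OF assms(1,2), of z] average_integrable[OF assms(1,3), of z]
  by (simp add: average_def algebra_simps)

lemma average_mono:
  assumes "admissible M \<kappa> \<phi>" "locally_bounded f" "locally_bounded g"
    and "\<And>x. \<kappa> x \<ge> 0" "\<And>z. f z \<le> g z"
  shows "average M \<kappa> \<phi> f z \<le> average M \<kappa> \<phi> g z"
  unfolding average_def
  by (intro integral_mono average_integrable assms mult_left_mono)

lemma average_bound:
  assumes a: "admissible M \<kappa> \<phi>" and g: "locally_bounded g" and B: "\<And>z. \<bar>g z\<bar> \<le> B"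
  shows "\<bar>average M \<kappa> \<phi> g z\<bar> \<le> B * (LINT x|M. \<bar>\<kappa> x\<bar>)"
proof -
  have "\<bar>average M \<kappa> \<phi> g z\<bar> \<le> (LINT x|M. \<bar>\<kappa> x\<bar> * B)"
    unfolding average_def
    by (rule abs_integral_le)
       (use average_integrable[OF a g] a average_dominate[OF a B] in \<open>auto simp: admissible_def\<close>)
  then show ?thesis by (simp add: mult.commute)
qed

lemma average_tendsto:
  assumes a: "admissible M \<kappa> \<phi>"
    and g: "\<And>n. locally_bounded (g n)" "\<And>n z. \<bar>g n z\<bar> \<le> B" "\<And>z. (\<lambda>n. g n z) \<longlonglongrightarrow> G z"
  shows "(\<lambda>n. average M \<kappa> \<phi> (g n) z) \<longlonglongrightarrow> average M \<kappa> \<phi> G z"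
proof -
  have [measurable]: "G \<in> borel_measurable borel"
    by (rule borel_measurable_LIMSEQ_real[of borel g]) (use g in \<open>auto simp: locally_bounded_def\<close>)
  show ?thesis
    unfolding average_def
  proof (rule integral_dominated_convergence[where w="\<lambda>x. \<bar>\<kappa> x\<bar> * B"])
    show "AE x in M. (\<lambda>i. \<kappa> x * g i (z + \<phi> x)) \<longlonglongrightarrow> \<kappa> x * G (z + \<phi> x)"
      by (intro AE_I2 tendsto_mult tendsto_const g)
    show "integrable M (\<lambda>x. \<bar>\<kappa> x\<bar> * B)" using a by (auto simp: admissible_def)
    show "(\<lambda>x. \<kappa> x * G (z + \<phi> x)) \<in> borel_measurable M" using admissible_dests[OF a] by measurable
    show "AE x in M. norm (\<kappa> x * g i (z + \<phi> x)) \<le> \<bar>\<kappa> x\<bar> * B" for i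
      by (intro AE_I2) (simp only: real_norm_def, rule average_dominate[OF a g(2)])
  qed (use average_integrable[OF a g(1)] in auto)
qed

lemma continuous_on_average:
  assumes a: "admissible M \<kappa> \<phi>" and g: "continuous_on UNIV g"
  shows "continuous_on UNIV (average M \<kappa> \<phi> g)"
proof -
  note lg = locally_bounded_cts[OF g]
  have "(average M \<kappa> \<phi> g \<longlongrightarrow> average M \<kappa> \<phi> g z0) (at z0)" for z0
  proof -
    obtain B where B: "B \<ge> 0" "\<And>x z. norm z \<le> norm z0 + 1 \<Longrightarrow> \<bar>\<kappa> x * g (z + \<phi> x)\<bar> \<le> \<bar>\<kappa> x\<bar> * B"
      using average_local_bound[OF a lg] by blast
    have nb: "norm z \<le> norm z0 + 1" if "z \<in> ball z0 1" for z
      using that norm_triangle_ineq2[of z z0] by (simp add: dist_norm norm_minus_commute)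
    have "((\<lambda>z. average M \<kappa> \<phi> g z) \<longlongrightarrow> average M \<kappa> \<phi> g z0) (at z0)"
      unfolding average_def
    proof (rule tendsto_integral_dominated[where r=1 and w="\<lambda>x. \<bar>\<kappa> x\<bar> * B"])
      fix x
      have "isCont g y" for y using g by (simp add: continuous_on_eq_continuous_at)
      then have "isCont (\<lambda>z. g (z + \<phi> x)) z0" by (intro isCont_o2[where g=g and f="\<lambda>z. z + \<phi> x"] continuous_intros)
      then show "((\<lambda>z. \<kappa> x * g (z + \<phi> x)) \<longlongrightarrow> \<kappa> x * g (z0 + \<phi> x)) (at z0)"
        by (intro tendsto_intros) (simp add: isCont_def)
    qed (use a B nb average_integrable[OF a lg] in \<open>auto simp: admissible_def\<close>)
    then show ?thesis by simp
  qed
  then show ?thesis by (simp add: continuous_on_eq_continuous_at isCont_def)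
qed

section \<open>Directional derivatives and averages of differentiable functions\<close>

abbreviation deriv_along :: "('a::real_normed_vector) \<Rightarrow> ('a \<Rightarrow> 'b::real_normed_vector) \<Rightarrow> 'a \<Rightarrow> 'b" where
  "deriv_along v g \<equiv> (\<lambda>x. frechet_derivative g (at x) v)"

lemma has_derivative_deriv_along:
  assumes "C_order (Suc n) g"
  shows "(g has_derivative (\<lambda>v. deriv_along v g x)) (at x)"
  using assms frechet_derivative_works by fastforce

lemma C_order_SucI:
  assumes "\<And>x. (f has_derivative f' x) (at x)" "\<And>v. C_order n (\<lambda>x. f' x v)"
  shows "C_order (Suc n) f"
proof -
  have "f' x = frechet_derivative f (at x)" for x
    using frechet_derivative_at[OF assms(1)] .
  with assms show ?thesis by (auto simp: differentiable_def)
qed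

lemma deriv_along_eq: "(f has_derivative f') (at x) \<Longrightarrow> deriv_along v f x = f' v"
  using frechet_derivative_at by metis

lemma C_order_imp_continuous:
  assumes "C_order n f" shows "continuous_on UNIV f"
proof (cases n)
  case (Suc m)
  with assms have "f differentiable at x" for x by simp
  then show ?thesis by (intro continuous_at_imp_continuous_on ballI differentiable_imp_continuous_within)
qed (use assms in simp)

lemma C_order_SucD: "C_order (Suc n) f \<Longrightarrow> C_order n f"
proof (induction n arbitrary: f)
  case 0
  then show ?case using C_order_imp_continuous by (metis C_order.simps(1))
next
  case (Suc n)
  then show ?case unfolding C_order.simps(2)[of "Suc n"] C_order.simps(2)[of n] by blast
qed

lemma C_order_le: "C_order n f \<Longrightarrow> m \<le> n \<Longrightarrow> C_order m f"
  by (induction n) (auto simp: le_Suc_eq dest: C_order_SucD simp del: C_order.simps(2))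

text \<open>Allows the direction to depend on the integration variable: measurability and bounds are
  then read off from the two partial derivatives.\<close>

lemma deriv_along_complex:
  fixes g :: "complex \<Rightarrow> real"
  assumes "C_order 1 g"
  shows "deriv_along v g x = Re v * deriv_along 1 g x + Im v * deriv_along \<i> g x"
proof -
  have "bounded_linear (\<lambda>v. deriv_along v g x)"
    using has_derivative_deriv_along[of 0] assms has_derivative_bounded_linear by auto
  then interpret bounded_linear "\<lambda>v. deriv_along v g x" .
  have "v = Re v *\<^sub>R 1 + Im v *\<^sub>R \<i>" by (simp add: complex_eq_iff)
  then show ?thesis by (metis add scaleR real_scaleR_def)
qed

lemma deriv_along_bound:
  fixes g :: "complex \<Rightarrow> real"
  assumes "C_order 1 g"
  shows "\<bar>deriv_along v g x\<bar> \<le> norm v * (\<bar>deriv_along 1 g x\<bar> + \<bar>deriv_along \<i> g x\<bar>)"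
proof -
  have "\<bar>deriv_along v g x\<bar> \<le> \<bar>Re v\<bar> * \<bar>deriv_along 1 g x\<bar> + \<bar>Im v\<bar> * \<bar>deriv_along \<i> g x\<bar>"
    unfolding deriv_along_complex[OF assms, where v=v] abs_mult[symmetric] by (rule abs_triangle_ineq)
  also have "\<dots> \<le> norm v * \<bar>deriv_along 1 g x\<bar> + norm v * \<bar>deriv_along \<i> g x\<bar>"
    by (intro add_mono mult_right_mono) (auto simp: abs_Re_le_cmod abs_Im_le_cmod)
  finally show ?thesis by (simp add: algebra_simps)
qed

lemma has_derivative_average:
  assumes a: "admissible M \<kappa> \<phi>" and g: "C_order 1 g"
  shows "(average M \<kappa> \<phi> g has_derivative (\<lambda>v. average M \<kappa> \<phi> (deriv_along v g) z0)) (at z0)"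
proof -
  have cd: "continuous_on UNIV (deriv_along v g)" for v using g by simp
  have lg: "locally_bounded g" using C_order_imp_continuous[OF g] by (rule locally_bounded_cts)
  have ld: "locally_bounded (\<lambda>x. \<bar>deriv_along 1 g x\<bar> + \<bar>deriv_along \<i> g x\<bar>)"
    by (intro locally_bounded_cts continuous_intros cd)
  obtain B where B: "B \<ge> 0" "\<And>x z. norm z \<le> norm z0 + 1 \<Longrightarrow>
      \<bar>\<kappa> x * (\<bar>deriv_along 1 g (z + \<phi> x)\<bar> + \<bar>deriv_along \<i> g (z + \<phi> x)\<bar>)\<bar> \<le> \<bar>\<kappa> x\<bar> * B"
    using average_local_bound[OF a ld] by blast
  have nb: "norm z \<le> norm z0 + 1" if "z \<in> ball z0 1" for z
    using that norm_triangle_ineq2[of z z0] by (simp add: dist_norm norm_minus_commute)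
  have "((\<lambda>z. LINT x|M. \<kappa> x * g (z + \<phi> x)) has_derivative (\<lambda>v. LINT x|M. \<kappa> x * deriv_along v g (z0 + \<phi> x))) (at z0)"
  proof (rule has_derivative_integral_dominated[where r=1 and w="\<lambda>x. \<bar>\<kappa> x\<bar> * B" and f'="\<lambda>z x v. \<kappa> x * deriv_along v g (z + \<phi> x)"])
    fix x z
    have "((\<lambda>z. g (z + \<phi> x)) has_derivative (\<lambda>v. deriv_along v g (z + \<phi> x))) (at z)"
    proof (rule has_derivative_compose[where f="\<lambda>z. z + \<phi> x" and g=g])
      show "((\<lambda>z. z + \<phi> x) has_derivative (\<lambda>v. v)) (at z)" by (auto intro!: derivative_eq_intros)
      show "(g has_derivative (\<lambda>v. deriv_along v g (z + \<phi> x))) (at (z + \<phi> x))"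
        using has_derivative_deriv_along[of 0 g] g by simp
    qed
    then show "((\<lambda>z. \<kappa> x * g (z + \<phi> x)) has_derivative (\<lambda>v. \<kappa> x * deriv_along v g (z + \<phi> x))) (at z)"
      by (rule has_derivative_mult_right)
    fix v assume z: "z \<in> ball z0 1"
    have "\<bar>\<kappa> x * deriv_along v g (z + \<phi> x)\<bar> \<le> norm v * \<bar>\<kappa> x * (\<bar>deriv_along 1 g (z + \<phi> x)\<bar> + \<bar>deriv_along \<i> g (z + \<phi> x)\<bar>)\<bar>"
      using mult_left_mono[OF deriv_along_bound[OF g, where v=v and x="z + \<phi> x"], of "\<bar>\<kappa> x\<bar>"]
      by (simp add: abs_mult mult_ac)
    also have "\<dots> \<le> norm v * (\<bar>\<kappa> x\<bar> * B)" by (intro mult_left_mono B nb z) auto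
    finally show "\<bar>\<kappa> x * deriv_along v g (z + \<phi> x)\<bar> \<le> \<bar>\<kappa> x\<bar> * B * norm v" by (simp add: mult_ac)
  next
    show "(\<lambda>x. \<kappa> x * deriv_along v g (z0 + \<phi> x)) \<in> borel_measurable M" for v
      using average_integrable[OF a locally_bounded_cts[OF cd]] by auto
  qed (use a average_integrable[OF a lg] in \<open>auto simp: admissible_def\<close>)
  then show ?thesis unfolding average_def[abs_def] .
qed

lemma C_order_average:
  assumes a: "admissible M \<kappa> \<phi>" and g: "C_order n g"
  shows "C_order n (average M \<kappa> \<phi> g)"
  using g
proof (induction n arbitrary: g)
  case 0
  then show ?case using continuous_on_average[OF a] by simp
next
  case (Suc n)
  have "C_order 1 g" using Suc(2) by (rule C_order_le) simp
  note d = has_derivative_average[OF a this]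
  show ?case
  proof (rule C_order_SucI[OF d])
    show "C_order n (\<lambda>x. average M \<kappa> \<phi> (deriv_along v g) x)" for v
      using Suc.IH[of "deriv_along v g"] Suc.prems by simp
  qed
qed

lemma deriv_along_average:
  assumes "admissible M \<kappa> \<phi>" "C_order 1 g"
  shows "deriv_along v (average M \<kappa> \<phi> g) = average M \<kappa> \<phi> (deriv_along v g)"
  using deriv_along_eq[OF has_derivative_average[OF assms]] by (intro ext) simp


section \<open>Kernels at a fixed scale and superpositions over scales\<close>

lemma integrable_bounded_support:
  fixes f :: "'a::euclidean_space \<Rightarrow> real"
  assumes "f \<in> borel_measurable borel" "\<And>x. \<bar>f x\<bar> \<le> B * indicator S x" "S \<in> sets borel" "bounded S"
  shows "integrable lborel f" "\<bar>LINT x|lborel. f x\<bar> \<le> B * measure lborel S"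
proof -
  have i: "integrable lborel (\<lambda>x. B * indicator S x :: real)"
    using emeasure_bounded_finite[OF assms(4)] assms(3) by simp
  show "integrable lborel f"
    by (rule Bochner_Integration.integrable_bound[OF i])
       (use assms in \<open>auto intro!: AE_I2 intro: order_trans[OF _ abs_ge_self]\<close>)
  have "\<bar>LINT x|lborel. f x\<bar> \<le> (LINT x|lborel. B * indicator S x)"
    using i assms by (intro abs_integral_le) auto
  then show "\<bar>LINT x|lborel. f x\<bar> \<le> B * measure lborel S"
    using assms by simp
qed

definition kernel :: "(complex \<Rightarrow> real) \<Rightarrow> bool" where
  "kernel K \<longleftrightarrow> K \<in> borel_measurable borel \<and> (\<exists>B. \<forall>y. \<bar>K y\<bar> \<le> B * indicator (cball 0 1) y)"

definition scale_weight :: "(real \<Rightarrow> real) \<Rightarrow> bool" where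
  "scale_weight b \<longleftrightarrow> b \<in> borel_measurable borel \<and> (\<exists>B T. \<forall>t. \<bar>b t\<bar> \<le> B * indicator {0..T} t)"

text \<open>An explicit derivative is carried along because the concrete kernels come with formulas
  for it; the bound makes every directional derivative a kernel again.\<close>

definition kernel_derivative :: "(complex \<Rightarrow> real) \<Rightarrow> (complex \<Rightarrow> complex \<Rightarrow> real) \<Rightarrow> bool" where
  "kernel_derivative K K' \<longleftrightarrow> (\<forall>y. (K has_derivative K' y) (at y)) \<and>
     (\<forall>v. (\<lambda>y. K' y v) \<in> borel_measurable borel) \<and>
     (\<exists>B. \<forall>y v. \<bar>K' y v\<bar> \<le> B * norm v * indicator (cball 0 1) y)"

abbreviation smear :: "(complex \<Rightarrow> real) \<Rightarrow> real \<Rightarrow> (complex \<Rightarrow> real) \<Rightarrow> complex \<Rightarrow> real" where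
  "smear K t \<equiv> average lborel K (\<lambda>y. t *\<^sub>R y)"

text \<open>The integral over t of \<open>b t\<close> times the average at scale t, written as one
  average over pairs (t, y), so that all lemmas on averages apply without interchanging
  integrals.\<close>

abbreviation multismear :: "(real \<Rightarrow> real) \<Rightarrow> (complex \<Rightarrow> real) \<Rightarrow> (complex \<Rightarrow> real) \<Rightarrow> complex \<Rightarrow> real" where
  "multismear b K \<equiv> average lborel (\<lambda>p. b (fst p) * K (snd p)) (\<lambda>p. fst p *\<^sub>R snd p)"

lemma kernelE:
  assumes "kernel K"
  obtains B where "B \<ge> 0" "\<And>y. \<bar>K y\<bar> \<le> B * indicator (cball 0 1) y" "K \<in> borel_measurable borel"
proof -
  from assms obtain B where B: "\<And>y. \<bar>K y\<bar> \<le> B * indicator (cball 0 1) y" "K \<in> borel_measurable borel"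
    unfolding kernel_def by blast
  then have "B \<ge> 0" using order_trans[OF abs_ge_zero B(1)[of 0]] by simp
  with B show ?thesis using that by blast
qed

lemma scale_weightE:
  assumes "scale_weight b"
  obtains B T where "B \<ge> 0" "T \<ge> 0" "\<And>t. \<bar>b t\<bar> \<le> B * indicator {0..T} t" "b \<in> borel_measurable borel"
proof -
  from assms obtain B T where B: "\<And>t. \<bar>b t\<bar> \<le> B * indicator {0..T} t" "b \<in> borel_measurable borel"
    unfolding scale_weight_def by blast
  have "\<bar>b t\<bar> \<le> max 0 B * indicator {0..max 0 T} t" for t
    using B(1)[of t] by (cases "t \<in> {0..T}") (auto simp: max_def indicator_def)
  then show ?thesis using that[of "max 0 B" "max 0 T"] B by auto
qed

lemma kernel_integrable: "kernel K \<Longrightarrow> integrable lborel K"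
  by (erule kernelE) (rule integrable_bounded_support[where S="cball 0 1"]; auto)

lemma kernel_derivative_kernel:
  assumes "kernel_derivative K K'" shows "kernel (\<lambda>y. K' y v)"
proof -
  from assms obtain B where "\<And>y v. \<bar>K' y v\<bar> \<le> B * norm v * indicator (cball 0 1) y" "(\<lambda>y. K' y v) \<in> borel_measurable borel"
    unfolding kernel_derivative_def by blast
  then show ?thesis unfolding kernel_def by blast
qed

lemma admissible_smear:
  assumes "kernel K" shows "admissible lborel K (\<lambda>y. t *\<^sub>R y)"
proof -
  obtain B where B: "\<And>y. \<bar>K y\<bar> \<le> B * indicator (cball 0 1) y" using assms unfolding kernel_def by blast
  have "norm (t *\<^sub>R y) \<le> \<bar>t\<bar>" if "K y \<noteq> 0" for y
  proof -
    have "norm y \<le> 1" using B[of y] that by (cases "norm y \<le> 1") auto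
    from mult_left_mono[OF this, of "\<bar>t\<bar>"] show ?thesis by simp
  qed
  then show ?thesis
    unfolding admissible_def using kernel_integrable[OF assms] by auto
qed

lemma multismear_integrable:
  assumes "scale_weight b" "kernel K"
  shows "integrable (lborel :: (real \<times> complex) measure) (\<lambda>p. b (fst p) * K (snd p))"
proof -
  obtain B where B: "B \<ge> 0" "\<And>y. \<bar>K y\<bar> \<le> B * indicator (cball 0 1) y" and [measurable]: "K \<in> borel_measurable borel"
    using assms(2) by (auto elim: kernelE)
  obtain C T where C: "C \<ge> 0" "T \<ge> 0" "\<And>t. \<bar>b t\<bar> \<le> C * indicator {0..T} t" and [measurable]: "b \<in> borel_measurable borel"
    using assms(1) by (auto elim: scale_weightE)
  have [measurable]: "fst \<in> borel_measurable (borel :: (real \<times> complex) measure)"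
    "snd \<in> borel_measurable (borel :: (real \<times> complex) measure)"
    by (intro borel_measurable_continuous_onI continuous_intros)+
  show ?thesis
  proof (rule integrable_bounded_support[where S="{0..T} \<times> cball 0 1" and B="C * B"])
    fix p :: "real \<times> complex"
    have "\<bar>b (fst p)\<bar> * \<bar>K (snd p)\<bar> \<le> (C * indicator {0..T} (fst p)) * (B * indicator (cball 0 1) (snd p))"
      by (intro mult_mono B C) (use C in auto)
    then show "\<bar>b (fst p) * K (snd p)\<bar> \<le> C * B * indicator ({0..T} \<times> cball 0 1) p"
      by (cases p) (auto simp: abs_mult indicator_def split: if_splits)
  qed (auto intro!: bounded_Times borel_closed closed_Times)
qed

lemma admissible_multismear:
  assumes "scale_weight b" "kernel K"
  shows "admissible lborel (\<lambda>p. b (fst p) * K (snd p)) (\<lambda>p. fst p *\<^sub>R snd p)"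
proof -
  obtain B where B: "\<And>y. \<bar>K y\<bar> \<le> B * indicator (cball 0 1) y" using assms(2) unfolding kernel_def by blast
  obtain C T where C: "T \<ge> 0" "\<And>t. \<bar>b t\<bar> \<le> C * indicator {0..T} t" using assms(1) by (rule scale_weightE) blast
  have "norm (fst p *\<^sub>R snd p) \<le> T" if "b (fst p) * K (snd p) \<noteq> 0" for p
  proof -
    have "norm (snd p) \<le> 1" "0 \<le> fst p" "fst p \<le> T"
      using B[of "snd p"] C(2)[of "fst p"] that
      by (cases "norm (snd p) \<le> 1"; cases "fst p \<in> {0..T}"; auto)+
    then show ?thesis using mult_mono[of "fst p" T "norm (snd p)" 1] C(1) by simp
  qed
  moreover have "(\<lambda>p. fst p *\<^sub>R snd p) \<in> borel_measurable (borel :: (real \<times> complex) measure)"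
    by (intro borel_measurable_continuous_onI continuous_intros)
  ultimately show ?thesis
    unfolding admissible_def using multismear_integrable[OF assms] unfolding measurable_lborel2 by blast
qed

lemma multismear_Fubini:
  assumes b: "scale_weight b" "kernel K" and g: "locally_bounded g"
  shows "integrable lborel (\<lambda>t. b t * smear K t g z)"
    and "multismear b K g z = (LINT t|lborel. b t * smear K t g z)"
proof -
  let ?f = "\<lambda>p. b (fst p) * K (snd p) * g (z + fst p *\<^sub>R snd p)"
  have i: "integrable (lborel \<Otimes>\<^sub>M lborel) ?f"
    unfolding lborel_prod by (rule average_integrable[OF admissible_multismear[OF b] g])
  have eq: "(LINT y|lborel. ?f (t, y)) = b t * smear K t g z" for t
    by (simp add: average_def mult.assoc)
  show "integrable lborel (\<lambda>t. b t * smear K t g z)"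
    using lborel_pair.integrable_fst'[OF i] unfolding eq .
  show "multismear b K g z = (LINT t|lborel. b t * smear K t g z)"
    using lborel_pair.integral_fst'[OF i] unfolding eq lborel_prod average_def by simp
qed

section \<open>Rescaling, and derivatives that fall on the kernel\<close>

lemma lborel_integral_affine:
  fixes F :: "'a::euclidean_space \<Rightarrow> real"
  assumes [measurable]: "F \<in> borel_measurable borel" and c: "c \<noteq> 0"
  shows "(LINT y|lborel. F y) = \<bar>c\<bar> ^ DIM('a) * (LINT x|lborel. F (w + c *\<^sub>R x))"
proof -
  have "(LINT y|lborel. F y) = (LINT y|density (distr lborel borel (\<lambda>x. w + c *\<^sub>R x)) (\<lambda>_. ennreal (\<bar>c\<bar>^DIM('a))). F y)"
    using lborel_affine[OF c, of w] by simp
  also have "\<dots> = (LINT y|distr lborel borel (\<lambda>x. w + c *\<^sub>R x). \<bar>c\<bar>^DIM('a) *\<^sub>R F y)"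
    by (rule integral_density) auto
  also have "\<dots> = (LINT x|lborel. \<bar>c\<bar>^DIM('a) *\<^sub>R F (w + c *\<^sub>R x))"
    by (rule integral_distr) auto
  finally show ?thesis by simp
qed

text \<open>Substituting x = z + t y moves z from the function into the kernel; the Jacobian in the
  plane is t^2.\<close>

lemma smear_translated:
  assumes K: "kernel K" and g: "locally_bounded g" and t: "t \<noteq> 0"
  shows "smear K t g z = (1 / t\<^sup>2) * (LINT x|lborel. K ((1 / t) *\<^sub>R (x - z)) * g x)"
proof -
  have [measurable]: "K \<in> borel_measurable borel" "g \<in> borel_measurable borel"
    using K g by (auto elim: kernelE simp: locally_bounded_def)
  have "smear K t g z = \<bar>1/t\<bar>^2 * (LINT x|lborel. K (- (1/t) *\<^sub>R z + (1/t) *\<^sub>R x) * g (z + t *\<^sub>R (- (1/t) *\<^sub>R z + (1/t) *\<^sub>R x)))"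
    unfolding average_def
    by (subst lborel_integral_affine[where c="1/t" and w="- (1/t) *\<^sub>R z"]) (use t in auto)
  also have "(\<lambda>x. K (- (1/t) *\<^sub>R z + (1/t) *\<^sub>R x) * g (z + t *\<^sub>R (- (1/t) *\<^sub>R z + (1/t) *\<^sub>R x))) =
      (\<lambda>x. K ((1 / t) *\<^sub>R (x - z)) * g x)"
    using t by (auto simp: algebra_simps)
  finally show ?thesis by (simp add: power_divide)
qed

lemma smear_translated_integrable:
  assumes K: "kernel K" and g: "locally_bounded g" and t: "t \<noteq> 0"
  shows "integrable lborel (\<lambda>x. K ((1 / t) *\<^sub>R (x - z)) * g x)"
proof -
  obtain B where B: "B \<ge> 0" "\<And>y. \<bar>K y\<bar> \<le> B * indicator (cball 0 1) y" and [measurable]: "K \<in> borel_measurable borel"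
    using K by (auto elim: kernelE)
  have [measurable]: "g \<in> borel_measurable borel" using g by (auto simp: locally_bounded_def)
  obtain C where C: "C \<ge> 0" "\<And>x. norm x \<le> norm z + \<bar>t\<bar> \<Longrightarrow> \<bar>g x\<bar> \<le> C" using g by (rule locally_boundedE) blast
  show ?thesis
  proof (rule integrable_bounded_support[where B="B * C" and S="cball 0 (norm z + \<bar>t\<bar>)"])
    fix x
    show "\<bar>K ((1 / t) *\<^sub>R (x - z)) * g x\<bar> \<le> B * C * indicator (cball 0 (norm z + \<bar>t\<bar>)) x"
    proof (cases "norm (x - z) \<le> \<bar>t\<bar>")
      case True
      then have nx: "norm x \<le> norm z + \<bar>t\<bar>" using norm_triangle_ineq2[of x z] by linarith
      have "\<bar>K ((1 / t) *\<^sub>R (x - z))\<bar> * \<bar>g x\<bar> \<le> B * C"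
        by (intro mult_mono C(2)[OF nx] order_trans[OF B(2)]) (use B in \<open>auto simp: indicator_def\<close>)
      then show ?thesis using nx by (simp add: abs_mult)
    next
      case False
      then have "K ((1 / t) *\<^sub>R (x - z)) = 0"
        using B(2)[of "(1 / t) *\<^sub>R (x - z)"] t by (auto simp: indicator_def divide_simps split: if_splits)
      then show ?thesis using B C by simp
    qed
  qed auto
qed

text \<open>After translation the variable sits in the kernel, so the average of a merely locally
  bounded function is differentiable.\<close>

lemma has_derivative_smear_kernel:
  assumes K: "kernel K" "kernel_derivative K K'" and g: "locally_bounded g" and t: "t \<noteq> 0"
  shows "(smear K t g has_derivative (\<lambda>v. - (1 / t) * smear (\<lambda>y. K' y v) t g z0)) (at z0)"
proof -
  have [measurable]: "K \<in> borel_measurable borel" "g \<in> borel_measurable borel" "\<And>v. (\<lambda>y. K' y v) \<in> borel_measurable borel"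
    using K g by (auto elim: kernelE simp: locally_bounded_def kernel_derivative_def)
  from K(2) obtain B0 where B0: "\<And>y v. \<bar>K' y v\<bar> \<le> B0 * norm v * indicator (cball 0 1) y"
    unfolding kernel_derivative_def by blast
  define B where "B = \<bar>B0\<bar>"
  have B: "\<bar>K' y v\<bar> \<le> B * norm v * indicator (cball 0 1) y" for y v
    by (rule order_trans[OF B0]) (auto simp: B_def indicator_def intro!: mult_right_mono)
  have B_nonneg: "B \<ge> 0" by (simp add: B_def)
  let ?R = "norm z0 + 1 + \<bar>t\<bar>"
  obtain C where C: "C \<ge> 0" "\<And>x. norm x \<le> ?R \<Longrightarrow> \<bar>g x\<bar> \<le> C" using g by (rule locally_boundedE) blast
  have "((\<lambda>z. LINT x|lborel. K ((1 / t) *\<^sub>R (x - z)) * g x) has_derivative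
      (\<lambda>v. LINT x|lborel. K' ((1 / t) *\<^sub>R (x - z0)) (- (1 / t) *\<^sub>R v) * g x)) (at z0)"
  proof (rule has_derivative_integral_dominated[where r=1 and f'="\<lambda>z x v. K' ((1 / t) *\<^sub>R (x - z)) (- (1 / t) *\<^sub>R v) * g x"
        and w="\<lambda>x. B * \<bar>1/t\<bar> * C * indicator (cball 0 ?R) x"])
    fix x z :: complex assume z: "z \<in> ball z0 1"
    have "((\<lambda>z. K ((1 / t) *\<^sub>R (x - z))) has_derivative (\<lambda>v. K' ((1 / t) *\<^sub>R (x - z)) (- (1 / t) *\<^sub>R v))) (at z)"
      by (rule has_derivative_compose[where f="\<lambda>z. (1 / t) *\<^sub>R (x - z)" and g=K])
         (use K(2) in \<open>auto simp: kernel_derivative_def intro!: derivative_eq_intros\<close>)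
    then show "((\<lambda>z. K ((1 / t) *\<^sub>R (x - z)) * g x) has_derivative (\<lambda>v. K' ((1 / t) *\<^sub>R (x - z)) (- (1 / t) *\<^sub>R v) * g x)) (at z)"
      by (rule has_derivative_mult_left)
    fix v
    have "\<bar>K' ((1 / t) *\<^sub>R (x - z)) (- (1 / t) *\<^sub>R v)\<bar> * \<bar>g x\<bar> \<le> B * norm (- (1 / t) *\<^sub>R v) * (indicator (cball 0 ?R) x * C)"
    \<comment> \<open>If x is farther than |t| from z, the rescaled point leaves the unit disc and
      the kernel vanishes; otherwise x stays in a ball that serves all z near
      \<open>z0\<close>.\<close>
    proof (cases "norm (x - z) \<le> \<bar>t\<bar>")
      case True
      have "norm z \<le> norm z0 + 1" using z norm_triangle_ineq2[of z z0] by (simp add: dist_norm norm_minus_commute)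
      then have nx: "norm x \<le> ?R" using True norm_triangle_ineq2[of x z] by linarith
      then have "indicator (cball 0 ?R) x = (1::real)" by simp
      moreover have "\<bar>K' ((1 / t) *\<^sub>R (x - z)) (- (1 / t) *\<^sub>R v)\<bar> \<le> B * norm (- (1 / t) *\<^sub>R v)"
        by (rule order_trans[OF B]) (use B_nonneg in \<open>auto simp: indicator_def\<close>)
      ultimately show ?thesis using C(2)[OF nx] B_nonneg by (simp only: mult_1_left) (intro mult_mono; simp)
    next
      case False
      then have "K' ((1 / t) *\<^sub>R (x - z)) (- (1 / t) *\<^sub>R v) = 0"
        using B[of "(1 / t) *\<^sub>R (x - z)"  "- (1 / t) *\<^sub>R v"] t by (auto simp: indicator_def divide_simps split: if_splits)
      then show ?thesis using B_nonneg C by simp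
    qed
    then show "\<bar>K' ((1 / t) *\<^sub>R (x - z)) (- (1 / t) *\<^sub>R v) * g x\<bar> \<le> B * \<bar>1/t\<bar> * C * indicator (cball 0 ?R) x * norm v"
      by (simp add: abs_mult mult_ac)
  next
    show "integrable lborel (\<lambda>x. B * \<bar>1/t\<bar> * C * indicator (cball 0 ?R) (x::complex))"
      using emeasure_lborel_cball_finite[of "0::complex" ?R] by simp
    show "(\<lambda>x. K' ((1 / t) *\<^sub>R (x - z0)) (- (1 / t) *\<^sub>R v) * g x) \<in> borel_measurable lborel" for v
      using measurable_compose[of "\<lambda>x. (1 / t) *\<^sub>R (x - z0)" lborel borel "\<lambda>y. K' y (- (1 / t) *\<^sub>R v)"] by measurable
  qed (use smear_translated_integrable[OF K(1) g t] in auto)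
  from has_derivative_mult_right[OF this, of "1 / t\<^sup>2"]
  have "((\<lambda>z. smear K t g z) has_derivative (\<lambda>v. (1 / t\<^sup>2) *
      (LINT x|lborel. K' ((1 / t) *\<^sub>R (x - z0)) (- (1 / t) *\<^sub>R v) * g x))) (at z0)"
    unfolding smear_translated[OF K(1) g t] .
  moreover have "(1 / t\<^sup>2) * (LINT x|lborel. K' ((1 / t) *\<^sub>R (x - z0)) (- (1 / t) *\<^sub>R v) * g x) =
      - (1 / t) * smear (\<lambda>y. K' y v) t g z0" for v
  proof -
    have "K' y (- (1 / t) *\<^sub>R v) = - (1 / t) * K' y v" for y
      using K(2) has_derivative_bounded_linear[of K "K' y" "at y"]
      by (auto simp: kernel_derivative_def dest!: bounded_linear.linear intro: linear_cmul[of "K' y" "- (1 / t)" v, simplified])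
    then show ?thesis
      unfolding smear_translated[OF kernel_derivative_kernel[OF K(2)] g t]
      by (simp add: mult.assoc)
  qed
  ultimately show ?thesis by simp
qed

text \<open>The estimate is uniform in the scale up to \<open>T\<close>, which supplies the majorant
  for integrals over scales.\<close>

lemma smear_local_bound:
  assumes K: "K \<in> borel_measurable borel" "\<And>y. \<bar>K y\<bar> \<le> B * indicator (cball 0 1) y" and B: "B \<ge> 0"
    and g: "g \<in> borel_measurable borel" "\<And>w. norm w \<le> R + T \<Longrightarrow> \<bar>g w\<bar> \<le> C" "C \<ge> 0"
    and z: "norm z \<le> R" and t: "\<bar>t\<bar> \<le> T"
  shows "\<bar>smear K t g z\<bar> \<le> B * C * measure lborel (cball (0::complex) 1)"
  unfolding average_def
proof (rule integrable_bounded_support(2))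
  show "(\<lambda>y. K y * g (z + t *\<^sub>R y)) \<in> borel_measurable borel" using K g by measurable
  fix y
  show "\<bar>K y * g (z + t *\<^sub>R y)\<bar> \<le> B * C * indicator (cball 0 1) y"
  proof (cases "norm y \<le> 1")
    case True
    have "norm (z + t *\<^sub>R y) \<le> norm z + \<bar>t\<bar> * norm y" using norm_triangle_ineq[of z "t *\<^sub>R y"] by simp
    also have "\<dots> \<le> R + T" using z t mult_left_mono[OF True, of "\<bar>t\<bar>"] by simp
    finally have "\<bar>K y\<bar> * \<bar>g (z + t *\<^sub>R y)\<bar> \<le> B * C"
      by (intro mult_mono g(2) order_trans[OF K(2)]) (use B in \<open>auto simp: indicator_def\<close>)
    then show ?thesis using True by (simp add: abs_mult)
  next
    case False
    then have "K y = 0" using K(2)[of y] by simp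
    then show ?thesis using B g by simp
  qed
qed auto

lemma scale_weight_mult_t:
  assumes "scale_weight b" shows "scale_weight (\<lambda>t. t * b t)"
proof -
  obtain C T where C: "C \<ge> 0" "T \<ge> 0" "\<And>t. \<bar>b t\<bar> \<le> C * indicator {0..T} t" and [measurable]: "b \<in> borel_measurable borel"
    using assms by (auto elim: scale_weightE)
  have "\<bar>t * b t\<bar> \<le> T * C * indicator {0..T} t" for t
    using C(3)[of t] C(1,2) mult_mono[of "\<bar>t\<bar>" T "\<bar>b t\<bar>" C] by (auto simp: abs_mult indicator_def split: if_splits)
  then show ?thesis unfolding scale_weight_def by auto
qed

text \<open>Differentiating the kernel at scale t costs a factor 1/t. The factor t in the weight
  compensates it, so the superposition is differentiable for merely locally bounded functions
  although arbitrarily small scales take part. This is the source of the gain of one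
  derivative.\<close>

lemma has_derivative_multismear_kernel:
  assumes b: "scale_weight b" and K: "kernel K" "kernel_derivative K K'" and g: "locally_bounded g"
  shows "(multismear (\<lambda>t. t * b t) K g has_derivative (\<lambda>v. - multismear b (\<lambda>y. K' y v) g z0)) (at z0)"
proof -
  obtain Cb T where Cb: "Cb \<ge> 0" "T \<ge> 0" "\<And>t. \<bar>b t\<bar> \<le> Cb * indicator {0..T} t" and [measurable]: "b \<in> borel_measurable borel"
    using b by (auto elim: scale_weightE)
  from K(2) obtain B0 where B0: "\<And>y v. \<bar>K' y v\<bar> \<le> B0 * norm v * indicator (cball 0 1) y"
    unfolding kernel_derivative_def by blast
  define B where "B = \<bar>B0\<bar>"
  have B: "\<bar>K' y v\<bar> \<le> B * norm v * indicator (cball 0 1) y" for y v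
    by (rule order_trans[OF B0]) (auto simp: B_def indicator_def intro!: mult_right_mono)
  have B_nonneg: "B \<ge> 0" by (simp add: B_def)
  let ?R = "norm z0 + 1"
  obtain C where C: "C \<ge> 0" "\<And>x. norm x \<le> ?R + T \<Longrightarrow> \<bar>g x\<bar> \<le> C" using g by (rule locally_boundedE) blast
  note kd = kernel_derivative_kernel[OF K(2)]
  \<comment> \<open>At t = 0 the average is a multiple of \<open>g\<close> itself and need not be
    differentiable, but its weight vanishes there, so 0 is the correct derivative of the
    product.\<close>
  let ?D = "\<lambda>z t v. if t = 0 then 0 else - (b t * smear (\<lambda>y. K' y v) t g z)"
  have "((\<lambda>z. LINT t|lborel. t * b t * smear K t g z) has_derivative (\<lambda>v. LINT t|lborel. ?D z0 t v)) (at z0)"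
  proof (rule has_derivative_integral_dominated[where r=1 and f'="?D"
        and w="\<lambda>t. Cb * indicator {0..T} t * (B * C * measure lborel (cball (0::complex) 1))"])
    show "integrable lborel (\<lambda>t. t * b t * smear K t g z)" for z
      by (rule multismear_Fubini(1)[OF scale_weight_mult_t[OF b] K(1) g])
    fix t :: real and z :: complex assume z: "z \<in> ball z0 1"
    show "((\<lambda>z. t * b t * smear K t g z) has_derivative ?D z t) (at z)"
    proof (cases "t = 0")
      case False
      show ?thesis
        using has_derivative_mult_right[OF has_derivative_smear_kernel[OF K g False], of "t * b t" z] False
        by (simp add: mult_ac)
    qed simp
    fix v
    have zR: "norm z \<le> ?R" using z norm_triangle_ineq2[of z z0] by (simp add: dist_norm norm_minus_commute)
    have "\<bar>smear (\<lambda>y. K' y v) t g z\<bar> \<le> B * norm v * C * measure lborel (cball (0::complex) 1)" if "t \<in> {0..T}"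
      by (rule smear_local_bound[where R="?R" and T=T])
         (use that zR C B_nonneg B kd[of v] g in \<open>auto simp: kernel_def locally_bounded_def\<close>)
    then have "t \<in> {0..T} \<Longrightarrow> \<bar>b t\<bar> * \<bar>smear (\<lambda>y. K' y v) t g z\<bar> \<le> Cb * (B * norm v * C * measure lborel (cball (0::complex) 1))"
      using Cb(3)[of t] Cb(1) by (intro mult_mono) auto
    moreover have "t \<notin> {0..T} \<Longrightarrow> b t = 0" using Cb(3)[of t] by simp
    ultimately show "\<bar>?D z t v\<bar> \<le> Cb * indicator {0..T} t * (B * C * measure lborel (cball (0::complex) 1)) * norm v"
      using Cb C B_nonneg by (cases "t \<in> {0..T}") (auto simp: abs_mult mult_ac)
  next
    fix v
    have [measurable]: "(\<lambda>t. b t * smear (\<lambda>y. K' y v) t g z0) \<in> borel_measurable lborel"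
      using multismear_Fubini(1)[OF b kd g] by auto
    show "(\<lambda>t. ?D z0 t v) \<in> borel_measurable lborel" by simp
  next
    have "integrable lborel (indicator {0..T} :: real \<Rightarrow> real)"
      by (rule integrable_real_indicator) (auto simp: emeasure_lborel_Icc_eq)
    then show "integrable lborel (\<lambda>t. Cb * indicator {0..T} t * (B * C * measure lborel (cball (0::complex) 1)))"
      by (intro integrable_mult_left integrable_mult_right)
  qed auto
  moreover have "(LINT t|lborel. ?D z0 t v) = - multismear b (\<lambda>y. K' y v) g z0" for v
  proof -
    have i: "integrable lborel (\<lambda>t. b t * smear (\<lambda>y. K' y v) t g z0)" by (rule multismear_Fubini(1)[OF b kd g])
    have "(LINT t|lborel. ?D z0 t v) = (LINT t|lborel. - (b t * smear (\<lambda>y. K' y v) t g z0))"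
    proof (rule integral_cong_AE)
      \<comment> \<open>The special value at t = 0 affects a null set only.\<close>
      show "AE t in lborel. ?D z0 t v = - (b t * smear (\<lambda>y. K' y v) t g z0)"
        using AE_lborel_singleton[of "0::real"] by eventually_elim simp
    qed (use borel_measurable_integrable[OF i] in simp_all)
    then show ?thesis by (simp add: multismear_Fubini(2)[OF b kd g])
  qed
  moreover have "multismear (\<lambda>t. t * b t) K g = (\<lambda>z. LINT t|lborel. t * b t * smear K t g z)"
    using multismear_Fubini(2)[OF scale_weight_mult_t[OF b] K(1) g] by (intro ext)
  ultimately show ?thesis by (simp only:)
qed

text \<open>Both sides are the derivative of the average, computed on the function and on the kernel;
  this replaces integration by parts.\<close>

lemma smear_deriv_along:
  assumes K: "kernel K" "kernel_derivative K K'" and g: "C_order 1 g" and t: "t \<noteq> 0"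
  shows "smear K t (deriv_along v g) z = - (1 / t) * smear (\<lambda>y. K' y v) t g z"
  using has_derivative_unique[OF has_derivative_average[OF admissible_smear[OF K(1)] g]
      has_derivative_smear_kernel[OF K locally_bounded_cts[OF C_order_imp_continuous[OF g]] t]]
  by meson

lemma multismear_deriv_along:
  assumes b: "scale_weight b" and K: "kernel K" "kernel_derivative K K'" and g: "C_order 1 g"
  shows "multismear (\<lambda>t. t * b t) K (deriv_along v g) z = - multismear b (\<lambda>y. K' y v) g z"
  using has_derivative_unique[OF has_derivative_average[OF admissible_multismear[OF scale_weight_mult_t[OF b] K(1)] g]
      has_derivative_multismear_kernel[OF b K locally_bounded_cts[OF C_order_imp_continuous[OF g]]]]
  by meson


section \<open>The bump kernels and the representation formula\<close>

text \<open>The maximum cuts a polynomial off at the unit circle. Such limited smoothness is enough,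
  since kernels are differentiated at most twice.\<close>

definition bump :: "nat \<Rightarrow> complex \<Rightarrow> real" where
  "bump m y = max 0 (1 - (norm y)\<^sup>2) ^ m"

text \<open>For m > 0 this is, up to the factor -2 (m + 1), the derivative of
  \<open>bump (m + 1)\<close> in direction \<open>v\<close>.\<close>

definition dipole :: "nat \<Rightarrow> complex \<Rightarrow> complex \<Rightarrow> real" where
  "dipole m v y = (y \<bullet> v) * bump m y"

definition laplacian :: "(complex \<Rightarrow> real) \<Rightarrow> complex \<Rightarrow> real" where
  "laplacian u z = deriv_along 1 (deriv_along 1 u) z + deriv_along \<i> (deriv_along \<i> u) z"

text \<open>The factor t of the representation formula is kept outside, so that
  \<open>has_derivative_multismear_kernel\<close> can trade it for a derivative. With \<kappa> = 0
  the weight is the constant \<open>a\<close> on [0, T].\<close>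

definition gauss_weight :: "real \<Rightarrow> real \<Rightarrow> real \<Rightarrow> real \<Rightarrow> real" where
  "gauss_weight a \<kappa> T t = indicator {0..T} t * (a * exp (- (\<kappa> * t\<^sup>2)))"

lemma bump_nonneg[simp]: "bump m y \<ge> 0"
  by (simp add: bump_def)

lemma bump_antimono: "m \<le> n \<Longrightarrow> bump n y \<le> bump m y"
  unfolding bump_def by (rule power_decreasing) auto

lemma continuous_on_bump: "continuous_on A (bump m)"
  unfolding bump_def[abs_def] by (intro continuous_intros)

lemma bump_measurable[measurable]: "bump m \<in> borel_measurable borel"
  by (rule borel_measurable_continuous_onI) (rule continuous_on_bump)

lemma bump_outside: "\<not> norm y \<le> 1 \<Longrightarrow> m > 0 \<Longrightarrow> bump m y = 0"
  using one_less_power[of "norm y" 2] by (simp add: bump_def max_absorb1 power_0_left)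

lemma bump_le_indicator: "m > 0 \<Longrightarrow> bump m y \<le> indicator (cball 0 1) y"
proof (cases "norm y \<le> 1")
  case True
  then show ?thesis unfolding bump_def by (auto intro!: power_le_one)
next
  case False
  then show "m > 0 \<Longrightarrow> ?thesis" by (simp add: bump_outside)
qed

lemma kernel_bump: "m > 0 \<Longrightarrow> kernel (bump m)"
  unfolding kernel_def using bump_le_indicator[of m] by (auto intro!: exI[of _ 1])

lemma inner_bump_bound:
  assumes "m > 0" shows "\<bar>(y \<bullet> v) * bump m y\<bar> \<le> norm v * indicator (cball 0 1) y"
proof (cases "norm y \<le> 1")
  case True
  have "\<bar>y \<bullet> v\<bar> * bump m y \<le> (norm y * norm v) * 1"
    using bump_le_indicator[OF assms, of y] True by (intro mult_mono Cauchy_Schwarz_ineq2) auto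
  also have "\<dots> \<le> norm v" using True by (simp add: mult_left_le_one_le)
  finally show ?thesis using True by (simp add: abs_mult)
next
  case False
  then show ?thesis using assms by (simp add: bump_outside)
qed

lemma kernel_dipole: "m > 0 \<Longrightarrow> kernel (dipole m v)"
  unfolding kernel_def dipole_def[abs_def] using inner_bump_bound by (auto intro!: exI[of _ "norm v"])

text \<open>Only the corner s = 0 is delicate: there the difference quotient is
  \<open>max 0 h ^ m\<close> up to a factor 0 or 1, and it tends to 0 because m > 0.\<close>

lemma max0_power_derivative:
  fixes s :: real
  assumes "m > 0" shows "((\<lambda>s. max 0 s ^ Suc m) has_real_derivative of_nat (Suc m) * max 0 s ^ m) (at s)"
proof -
  consider "s > 0" | "s < 0" | "s = 0" by linarith
  then show ?thesis
  proof cases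
    case 1
    have "((\<lambda>s. s ^ Suc m) has_real_derivative of_nat (Suc m) * max 0 s ^ m) (at s)"
      using DERIV_pow[of "Suc m" s] 1 by simp
    then show ?thesis
      by (rule has_field_derivative_transform_within_open[where S="{0<..}"]) (use 1 in auto)
  next
    case 2
    have "((\<lambda>s. 0) has_real_derivative of_nat (Suc m) * max 0 s ^ m) (at s)"
      using 2 assms by (auto intro!: derivative_eq_intros)
    then show ?thesis
      by (rule has_field_derivative_transform_within_open[where S="{..<0}"]) (use 2 in auto)
  next
    case 3
    have "((\<lambda>h. max 0 h ^ m * (if h > 0 then 1 else 0)) \<longlongrightarrow> 0) (at (0::real))"
    proof (rule Lim_null_comparison[where g="\<lambda>h. max 0 h ^ m"])
      have "((\<lambda>h. max 0 h ^ m) \<longlongrightarrow> max 0 0 ^ m) (at (0::real))" by (intro tendsto_intros)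
      then show "((\<lambda>h. max 0 h ^ m) \<longlongrightarrow> 0) (at (0::real))" using assms by (simp only: max.idem power_0_left) simp
    qed (auto intro!: always_eventually)
    moreover have "max 0 h ^ m * (if h > 0 then 1 else 0) = (max 0 h ^ Suc m - max 0 0 ^ Suc m) / h" for h :: real
      by (auto simp: max_def)
    ultimately show ?thesis using 3 assms by (simp add: DERIV_def power_0_left)
  qed
qed

lemma has_derivative_bump:
  assumes "m > 0"
  shows "(bump (Suc m) has_derivative (\<lambda>v. - (2 * of_nat (Suc m)) * dipole m v y)) (at y)"
proof -
  have "((\<lambda>y. 1 - (norm y)\<^sup>2) has_derivative (\<lambda>v. - (2 * (y \<bullet> v)))) (at y)"
    unfolding power2_norm_eq_inner by (auto intro!: derivative_eq_intros simp: inner_commute)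
  moreover have "((\<lambda>s. max 0 s ^ Suc m) has_derivative (*) (of_nat (Suc m) * max 0 (1 - (norm y)\<^sup>2) ^ m)) (at (1 - (norm y)\<^sup>2))"
    using max0_power_derivative[OF assms] by (simp only: has_field_derivative_def)
  ultimately have "((\<lambda>y. max 0 (1 - (norm y)\<^sup>2) ^ Suc m) has_derivative
      (\<lambda>v. (of_nat (Suc m) * max 0 (1 - (norm y)\<^sup>2) ^ m) * - (2 * (y \<bullet> v)))) (at y)"
    by (rule has_derivative_compose)
  then show ?thesis unfolding bump_def[abs_def] dipole_def by (simp add: mult_ac bump_def del: of_nat_Suc power_Suc)
qed

lemma kernel_derivative_bump:
  assumes "m > 0" shows "kernel_derivative (bump (Suc m)) (\<lambda>y v. - (2 * of_nat (Suc m)) * dipole m v y)"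
  unfolding kernel_derivative_def
proof (intro conjI allI exI)
  fix y v
  show "\<bar>- (2 * of_nat (Suc m)) * dipole m v y\<bar> \<le> (2 * of_nat (Suc m)) * norm v * indicator (cball 0 1) y"
    using mult_left_mono[OF inner_bump_bound[OF assms, of y v], of "2 * of_nat (Suc m)"]
    unfolding dipole_def by (simp add: abs_mult mult.assoc del: of_nat_Suc)
qed (use has_derivative_bump[OF assms] in \<open>auto simp: dipole_def\<close>)

text \<open>Up to the factor -6 this is a second derivative of \<open>bump 3\<close>. The 4 is twice
  the exponent of \<open>bump 2\<close>; the 5 in the bound below is 1 + 4.\<close>

lemma kernel_derivative_dipole:
  "kernel_derivative (dipole 2 w) (\<lambda>y v. (v \<bullet> w) * bump 2 y - 4 * (y \<bullet> w) * dipole 1 v y)"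
  unfolding kernel_derivative_def
proof (intro conjI allI exI)
  fix y v
  have "((\<lambda>y. (y \<bullet> w) * bump 2 y) has_derivative (\<lambda>v. (y \<bullet> w) * (- (2 * of_nat (Suc 1)) * dipole 1 v y) + (v \<bullet> w) * bump 2 y)) (at y)"
    using has_derivative_bump[of 1 y]
    by (intro has_derivative_mult has_derivative_inner_left has_derivative_ident) (simp add: numeral_2_eq_2)
  then show "(dipole 2 w has_derivative (\<lambda>v. (v \<bullet> w) * bump 2 y - 4 * (y \<bullet> w) * dipole 1 v y)) (at y)"
    unfolding dipole_def[of 2, abs_def] by (simp add: algebra_simps)
  show "\<bar>(v \<bullet> w) * bump 2 y - 4 * (y \<bullet> w) * dipole 1 v y\<bar> \<le> (5 * norm w) * norm v * indicator (cball 0 1) y"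
  proof (cases "norm y \<le> 1")
    case True
    have "\<bar>v \<bullet> w\<bar> * bump 2 y \<le> (norm v * norm w) * 1"
      using bump_le_indicator[of 2 y] True by (intro mult_mono Cauchy_Schwarz_ineq2) auto
    moreover have "\<bar>y \<bullet> w\<bar> * \<bar>dipole 1 v y\<bar> \<le> norm w * norm v"
    proof (rule mult_mono)
      show "\<bar>y \<bullet> w\<bar> \<le> norm w"
        using Cauchy_Schwarz_ineq2[of y w] mult_left_le_one_le[of "norm w" "norm y"] True by simp
    qed (use inner_bump_bound[of 1 y v] True in \<open>auto simp: dipole_def\<close>)
    moreover have "\<bar>(v \<bullet> w) * bump 2 y - 4 * (y \<bullet> w) * dipole 1 v y\<bar>
      \<le> \<bar>v \<bullet> w\<bar> * bump 2 y + 4 * (\<bar>y \<bullet> w\<bar> * \<bar>dipole 1 v y\<bar>)"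
      using abs_triangle_ineq4[of "(v \<bullet> w) * bump 2 y" "4 * (y \<bullet> w) * dipole 1 v y"] by (simp add: abs_mult)
    ultimately show ?thesis using True by (simp add: mult_ac)
  next
    case False
    then show ?thesis by (simp add: dipole_def bump_outside)
  qed
qed (auto simp: dipole_def)

lemma average_scale_kernel: "average M (\<lambda>x. c * \<kappa> x) \<phi> g z = c * average M \<kappa> \<phi> g z"
  by (simp add: average_def mult.assoc)

lemma smear_bump_deriv_along:
  assumes "m > 0" "C_order 1 g" "t \<noteq> 0"
  shows "smear (bump (Suc m)) t (deriv_along v g) z = (2 * of_nat (Suc m) / t) * smear (dipole m v) t g z"
  using smear_deriv_along[OF kernel_bump kernel_derivative_bump[OF assms(1)] assms(2,3), of v z]
  unfolding average_scale_kernel by (simp del: of_nat_Suc)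

lemma multismear_scaleK: "multismear b (\<lambda>y. c * K y) g z = c * multismear b K g z"
  using average_scale_kernel[of lborel c "\<lambda>p. b (fst p) * K (snd p)"] by (simp only: mult.left_commute[of _ c])

lemma multismear_bump_deriv_along:
  assumes "m > 0" "C_order 1 g" "scale_weight b"
  shows "multismear (\<lambda>t. t * b t) (bump (Suc m)) (deriv_along v g) z =
    (2 * of_nat (Suc m)) * multismear b (dipole m v) g z"
  using multismear_deriv_along[OF assms(3) kernel_bump kernel_derivative_bump[OF assms(1)] assms(2), of v z]
  unfolding multismear_scaleK by (simp del: of_nat_Suc)

text \<open>The kernel is odd, and reflection preserves Lebesgue measure.\<close>

lemma integral_dipole: "(LINT y|lborel. dipole m v y) = 0"
proof -
  have "(LINT y|lborel. dipole m v y) = (LINT y|lborel. dipole m v (0 + (-1) *\<^sub>R y))"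
    by (subst lborel_integral_affine[where c="-1" and w=0]) (auto simp: dipole_def[abs_def])
  also have "\<dots> = (LINT y|lborel. - dipole m v y)"
    by (simp add: dipole_def bump_def)
  finally show ?thesis by simp
qed

section \<open>The scale derivative of averages and the Laplacian\<close>

text \<open>Each derivative along 1 and \<i> is moved onto \<open>bump 3\<close>, which gives a
  dipole and the factor 6/t. Multiplication by t/6 keeps the identity meaningful at t = 0, where the
  right-hand side vanishes because dipoles have integral zero.\<close>

lemma smear_laplacian:
  assumes u: "C_order 2 u"
  shows "t / 6 * smear (bump 3) t (laplacian u) z =
    smear (dipole 2 1) t (deriv_along 1 u) z + smear (dipole 2 \<i>) t (deriv_along \<i> u) z"
proof -
  have d: "C_order 1 (deriv_along v u)" for v using u by (simp add: numeral_2_eq_2)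
  have dd: "continuous_on UNIV (deriv_along v (deriv_along v u))" for v using d[of v] by simp
  show ?thesis
  proof (cases "t = 0")
    case True
    then show ?thesis by (simp add: average_def integral_dipole)
  next
    case False
    have "smear (bump 3) t (laplacian u) z = smear (bump 3) t (deriv_along 1 (deriv_along 1 u)) z
        + smear (bump 3) t (deriv_along \<i> (deriv_along \<i> u)) z"
      unfolding laplacian_def[abs_def]
      by (rule average_add) (auto intro!: admissible_smear kernel_bump locally_bounded_cts dd)
    then show ?thesis
      using smear_bump_deriv_along[OF _ d[of 1] False, of 2 1 z] smear_bump_deriv_along[OF _ d[of \<i>] False, of 2 \<i> z] False
      by (simp add: field_simps)
  qed
qed

text \<open>The chain rule gives the derivative of \<open>u\<close> at z + t y in the direction y;
  splitting y into coordinates turns each part into an average with a fixed direction.\<close>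

lemma smear_scale_derivative:
  assumes K: "kernel K" and u: "C_order 1 u"
  shows "((\<lambda>t. smear K t u z) has_real_derivative
    smear (\<lambda>y. (y \<bullet> 1) * K y) t0 (deriv_along 1 u) z + smear (\<lambda>y. (y \<bullet> \<i>) * K y) t0 (deriv_along \<i> u) z) (at t0)"
proof -
  obtain B where B: "B \<ge> 0" "\<And>y. \<bar>K y\<bar> \<le> B * indicator (cball 0 1) y" and [measurable]: "K \<in> borel_measurable borel"
    using K by (auto elim: kernelE)
  have cd: "continuous_on UNIV (deriv_along v u)" for v using u by simp
  have lu: "locally_bounded u" using C_order_imp_continuous[OF u] by (rule locally_bounded_cts)
  have ld: "locally_bounded (\<lambda>x. \<bar>deriv_along 1 u x\<bar> + \<bar>deriv_along \<i> u x\<bar>)"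
    by (intro locally_bounded_cts continuous_intros cd)
  obtain C where C: "C \<ge> 0" "\<And>w. norm w \<le> norm z + (\<bar>t0\<bar> + 1) \<Longrightarrow> \<bar>\<bar>deriv_along 1 u w\<bar> + \<bar>deriv_along \<i> u w\<bar>\<bar> \<le> C"
    using ld by (rule locally_boundedE) blast
  have [measurable]: "deriv_along v u \<in> borel_measurable borel" for v
    using cd by (rule borel_measurable_continuous_onI)
  have kv: "kernel (\<lambda>y. (y \<bullet> v) * K y)" for v
  proof -
    have "\<bar>(y \<bullet> v) * K y\<bar> \<le> norm v * B * indicator (cball 0 1) y" for y
    proof (cases "norm y \<le> 1")
      case True
      have "\<bar>y \<bullet> v\<bar> * \<bar>K y\<bar> \<le> norm v * B"
      proof (rule mult_mono)
        show "\<bar>y \<bullet> v\<bar> \<le> norm v"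
          using Cauchy_Schwarz_ineq2[of y v] mult_left_le_one_le[of "norm v" "norm y"] True by simp
      qed (use B(2)[of y] True in auto)
      then show ?thesis using True by (simp add: abs_mult)
    qed (use B(2)[of y] in simp)
    moreover have "(\<lambda>y. (y \<bullet> v) * K y) \<in> borel_measurable borel" by measurable
    ultimately show ?thesis unfolding kernel_def by blast
  qed
  define ux uy where u_def: "ux = deriv_along 1 u" "uy = deriv_along \<i> u"
  have [measurable]: "ux \<in> borel_measurable borel" "uy \<in> borel_measurable borel" by (simp_all add: u_def)
  have split: "deriv_along y u w = (y \<bullet> 1) * ux w + (y \<bullet> \<i>) * uy w" for y w
    unfolding u_def by (subst deriv_along_complex[OF u]) (simp add: inner_complex_def)
  have "((\<lambda>t. LINT y|lborel. K y * u (z + t *\<^sub>R y)) has_derivative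
      (\<lambda>s. LINT y|lborel. s * (K y * deriv_along y u (z + t0 *\<^sub>R y)))) (at t0)"
  proof (rule has_derivative_integral_dominated[where r=1 and f'="\<lambda>t y s. s * (K y * deriv_along y u (z + t *\<^sub>R y))"
        and w="\<lambda>y. B * C * indicator (cball 0 1) y"])
    show "integrable lborel (\<lambda>y. K y * u (z + t *\<^sub>R y))" for t
      using average_integrable[OF admissible_smear[OF K] lu] .
    fix t y assume t: "t \<in> ball t0 1"
    have "((\<lambda>t. u (z + t *\<^sub>R y)) has_derivative (\<lambda>s. deriv_along (s *\<^sub>R y) u (z + t *\<^sub>R y))) (at t)"
    proof (rule has_derivative_compose[where f="\<lambda>t. z + t *\<^sub>R y" and g=u])
      show "((\<lambda>t. z + t *\<^sub>R y) has_derivative (\<lambda>s. s *\<^sub>R y)) (at t)" by (auto intro!: derivative_eq_intros)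
      show "(u has_derivative (\<lambda>v. deriv_along v u (z + t *\<^sub>R y))) (at (z + t *\<^sub>R y))"
        using has_derivative_deriv_along[of 0 u] u by simp
    qed
    then have "((\<lambda>t. K y * u (z + t *\<^sub>R y)) has_derivative (\<lambda>s. K y * deriv_along (s *\<^sub>R y) u (z + t *\<^sub>R y))) (at t)"
      by (rule has_derivative_mult_right)
    then show "((\<lambda>t. K y * u (z + t *\<^sub>R y)) has_derivative (\<lambda>s. s * (K y * deriv_along y u (z + t *\<^sub>R y)))) (at t)"
      unfolding split by (simp add: algebra_simps)
    fix s
    show "\<bar>s * (K y * deriv_along y u (z + t *\<^sub>R y))\<bar> \<le> B * C * indicator (cball 0 1) y * norm s"
    proof (cases "norm y \<le> 1")
      case True
      have "\<bar>t\<bar> \<le> \<bar>t0\<bar> + 1" using t by (simp add: dist_real_def)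
      then have "norm (z + t *\<^sub>R y) \<le> norm z + (\<bar>t0\<bar> + 1)"
        using norm_triangle_ineq[of z "t *\<^sub>R y"] mult_left_le[OF True, of "\<bar>t\<bar>"] by simp
      from C(2)[OF this] have "\<bar>deriv_along y u (z + t *\<^sub>R y)\<bar> \<le> 1 * C"
        by (intro order_trans[OF deriv_along_bound[OF u]] mult_mono) (use True in auto)
      then have "\<bar>K y\<bar> * \<bar>deriv_along y u (z + t *\<^sub>R y)\<bar> \<le> B * C"
        using B(2)[of y] True B(1) by (intro mult_mono) auto
      then have "\<bar>s\<bar> * (\<bar>K y\<bar> * \<bar>deriv_along y u (z + t *\<^sub>R y)\<bar>) \<le> \<bar>s\<bar> * (B * C)"
        by (rule mult_left_mono) simp
      then show ?thesis using True by (simp add: abs_mult mult_ac)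
    qed (use B(2)[of y] in simp)
  next
    show "integrable lborel (\<lambda>y. B * C * indicator (cball 0 1) (y::complex))"
      using emeasure_lborel_cball_finite[of "0::complex" 1] by simp
    show "(\<lambda>y. s * (K y * deriv_along y u (z + t0 *\<^sub>R y))) \<in> borel_measurable lborel" for s
      unfolding split by measurable
  qed simp
  moreover have "(LINT y|lborel. K y * deriv_along y u (z + t0 *\<^sub>R y)) =
      smear (\<lambda>y. (y \<bullet> 1) * K y) t0 (deriv_along 1 u) z + smear (\<lambda>y. (y \<bullet> \<i>) * K y) t0 (deriv_along \<i> u) z"
  proof -
    have i: "integrable lborel (\<lambda>y. (y \<bullet> v) * K y * deriv_along v u (z + t0 *\<^sub>R y))" for v
      using average_integrable[OF admissible_smear[OF kv] locally_bounded_cts[OF cd]] .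
    have "(LINT y|lborel. K y * deriv_along y u (z + t0 *\<^sub>R y)) =
        (LINT y|lborel. (y \<bullet> 1) * K y * ux (z + t0 *\<^sub>R y) + (y \<bullet> \<i>) * K y * uy (z + t0 *\<^sub>R y))"
      unfolding split by (simp add: algebra_simps)
    then show ?thesis
      using i[of 1] i[of \<i>] unfolding average_def u_def by simp
  qed
  ultimately show ?thesis
    by (simp add: has_field_derivative_def average_def[of _ K] mult_commute_abs)
qed

lemma smear_bump_scale_derivative:
  assumes u: "C_order 2 u"
  shows "((\<lambda>t. smear (bump 2) t u z) has_real_derivative t / 6 * smear (bump 3) t (laplacian u) z) (at t)"
proof -
  have "C_order 1 u" using u by (rule C_order_le) simp
  from smear_scale_derivative[OF kernel_bump this, of 2] show ?thesis
    unfolding smear_laplacian[OF u] by (simp add: dipole_def[abs_def])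
qed

lemma scale_weight_indicator:
  assumes "continuous_on {0..T} b" shows "scale_weight (\<lambda>t. indicator {0..T} t * b t)"
proof -
  have "(\<lambda>t. indicator {0..T} t *\<^sub>R b t) \<in> borel_measurable borel"
    using assms by (intro borel_measurable_continuous_on_indicator) auto
  moreover have "bounded (b ` {0..T})"
    by (intro compact_imp_bounded compact_continuous_image assms) simp
  then obtain B where B: "\<And>t. t \<in> {0..T} \<Longrightarrow> \<bar>b t\<bar> \<le> B" unfolding bounded_iff by fastforce
  then have "\<bar>indicator {0..T} t * b t\<bar> \<le> B * indicator {0..T} t" for t
    by (auto simp: indicator_def)
  ultimately show ?thesis unfolding scale_weight_def by auto
qed

lemma scale_weight_gauss: "scale_weight (gauss_weight a \<kappa> T)"
  unfolding gauss_weight_def[abs_def] by (intro scale_weight_indicator continuous_intros)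

definition bump_mass :: real where "bump_mass = (LINT y|lborel. bump 2 y)"

lemma C_order_add: "C_order n f \<Longrightarrow> C_order n g \<Longrightarrow> C_order n (\<lambda>x. f x + g x)"
proof (induction n arbitrary: f g)
  case 0
  then show ?case by (auto intro: continuous_intros simp del: continuous_on_eq_continuous_within)
next
  case (Suc n)
  show ?case
  proof (rule C_order_SucI)
    show "((\<lambda>x. f x + g x) has_derivative (\<lambda>v. deriv_along v f x + deriv_along v g x)) (at x)" for x
      by (rule has_derivative_add has_derivative_deriv_along[OF Suc.prems(1)] has_derivative_deriv_along[OF Suc.prems(2)])+
    show "C_order n (\<lambda>x. deriv_along v f x + deriv_along v g x)" for v
      using Suc.prems by (intro Suc.IH) simp_all
  qed
qed

lemma C_order_laplacian:
  assumes "C_order (Suc (Suc n)) u" shows "C_order n (laplacian u)"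
  unfolding laplacian_def[abs_def] by (intro C_order_add) (use assms in simp_all)

text \<open>The fundamental theorem of calculus on [0, T] for exp (- \<kappa> t^2) times the average
  at scale t, whose value at t = 0 is \<open>bump_mass * u z\<close>. Two choices are used later: T
  = 1 with \<kappa> > 0 for the fixed point, and \<kappa> = 0 with T growing for the linear
  equation.\<close>

theorem representation_formula:
  assumes u: "C_order 3 u" and T: "T \<ge> 0"
  shows "bump_mass * u z = exp (- (\<kappa> * T\<^sup>2)) * smear (bump 2) T u z
    + multismear (\<lambda>t. t * gauss_weight (2 * \<kappa>) \<kappa> T t) (bump 2) u z
    - multismear (\<lambda>t. t * gauss_weight (1 / 6) \<kappa> T t) (bump 3) (laplacian u) z"
proof -
  let ?L = "laplacian u"
  have u2: "C_order 2 u" "C_order 1 u" by (rule C_order_le[OF u]; simp)+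
  \<comment> \<open>The third derivative of \<open>u\<close> makes its Laplacian differentiable,
    from which the continuity in t of the averages of the Laplacian is read off.\<close>
  have L1: "C_order 1 ?L" by (rule C_order_laplacian) (use u in \<open>simp add: numeral_3_eq_3\<close>)
  have lu: "locally_bounded u" "locally_bounded ?L"
    by (rule locally_bounded_cts C_order_imp_continuous[OF u] C_order_imp_continuous[OF L1])+
  have ct: "continuous_on A (\<lambda>t. smear K t g z)" if "kernel K" "C_order 1 g" for K g A
    using smear_scale_derivative[OF that, THEN DERIV_isCont] by (intro continuous_at_imp_continuous_on) auto
  have k: "kernel (bump 2)" "kernel (bump 3)" by (simp_all add: kernel_bump)
  have wt: "scale_weight (\<lambda>t. t * gauss_weight a \<kappa> T t)" for a
    by (rule scale_weight_mult_t[OF scale_weight_gauss])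
  let ?F = "\<lambda>t. exp (- (\<kappa> * t\<^sup>2)) * smear (bump 2) t u z"
  let ?f = "\<lambda>t. - (2 * \<kappa> * t * exp (- (\<kappa> * t\<^sup>2)) * smear (bump 2) t u z) + exp (- (\<kappa> * t\<^sup>2)) * (t / 6 * smear (bump 3) t ?L z)"
  have "(LINT t|lborel. indicator {0..T} t *\<^sub>R ?f t) = ?F T - ?F 0"
  proof (rule integral_FTC_atLeastAtMost[OF T])
    fix t
    have "((\<lambda>t. exp (- (\<kappa> * t\<^sup>2))) has_real_derivative - (2 * \<kappa> * t * exp (- (\<kappa> * t\<^sup>2)))) (at t)"
      by (auto intro!: derivative_eq_intros)
    from DERIV_mult[OF this smear_bump_scale_derivative[OF u2(1)]]
    have "(?F has_real_derivative ?f t) (at t)"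
      by (simp only: mult_minus_left mult.commute[of _ "exp (- (\<kappa> * t\<^sup>2))"])
    then show "(?F has_vector_derivative ?f t) (at t within {0..T})"
      by (rule has_vector_derivative_at_within[OF has_real_derivative_iff_has_vector_derivative[THEN iffD1]])
  next
    have "continuous_on {0..T} (\<lambda>t. smear (bump 2) t u z)" "continuous_on {0..T} (\<lambda>t. smear (bump 3) t ?L z)"
      by (rule ct[OF kernel_bump u2(2)] ct[OF kernel_bump L1], simp)+
    then show "continuous_on {0..T} ?f" by (intro continuous_intros; simp)
  qed
  also have "(LINT t|lborel. indicator {0..T} t *\<^sub>R ?f t) =
     (LINT t|lborel. t * gauss_weight (1/6) \<kappa> T t * smear (bump 3) t ?L z - t * gauss_weight (2 * \<kappa>) \<kappa> T t * smear (bump 2) t u z)"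
    by (rule Bochner_Integration.integral_cong) (simp_all add: gauss_weight_def right_diff_distrib distrib_left mult_ac)
  also have "\<dots> = multismear (\<lambda>t. t * gauss_weight (1 / 6) \<kappa> T t) (bump 3) ?L z
      - multismear (\<lambda>t. t * gauss_weight (2 * \<kappa>) \<kappa> T t) (bump 2) u z"
    unfolding multismear_Fubini(2)[OF wt k(1) lu(1)] multismear_Fubini(2)[OF wt k(2) lu(2)]
    by (rule Bochner_Integration.integral_diff[OF multismear_Fubini(1)[OF wt k(2) lu(2)] multismear_Fubini(1)[OF wt k(1) lu(1)]])
  also have "?F 0 = bump_mass * u z" by (simp add: average_def bump_mass_def)
  finally show ?thesis by linarith
qed


section \<open>Calculus of \<open>C_order\<close>\<close>

lemma deriv_along_const[simp]: "deriv_along v (\<lambda>_. c) x = 0"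
  by (simp add: frechet_derivative_const)

lemma C_order_const: "C_order n (\<lambda>_. c)"
proof (induction n arbitrary: c)
  case (Suc n)
  then show ?case by simp
qed simp

lemma C_order_mult:
  fixes f g :: "'a::real_normed_vector \<Rightarrow> real"
  shows "C_order n f \<Longrightarrow> C_order n g \<Longrightarrow> C_order n (\<lambda>x. f x * g x)"
proof (induction n arbitrary: f g)
  case 0
  then show ?case by (auto intro: continuous_intros simp del: continuous_on_eq_continuous_within)
next
  case (Suc n)
  show ?case
  proof (rule C_order_SucI)
    show "((\<lambda>x. f x * g x) has_derivative (\<lambda>v. f x * deriv_along v g x + deriv_along v f x * g x)) (at x)" for x
      by (rule has_derivative_mult has_derivative_deriv_along[OF Suc.prems(1)] has_derivative_deriv_along[OF Suc.prems(2)])+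
    show "C_order n (\<lambda>x. f x * deriv_along v g x + deriv_along v f x * g x)" for v
      using Suc.prems by (intro C_order_add Suc.IH C_order_SucD[OF Suc.prems(1)] C_order_SucD[OF Suc.prems(2)]) simp_all
  qed
qed

lemma C_order_cmult:
  fixes f :: "'a::real_normed_vector \<Rightarrow> real"
  shows "C_order n f \<Longrightarrow> C_order n (\<lambda>x. c * f x)"
  by (intro C_order_mult C_order_const)

lemma C_order_diff:
  fixes f g :: "'a::real_normed_vector \<Rightarrow> real"
  assumes "C_order n f" "C_order n g" shows "C_order n (\<lambda>x. f x - g x)"
  using C_order_add[OF assms(1) C_order_cmult[OF assms(2), of "-1"]] by simp

lemma C_order_exp:
  fixes f :: "'a::real_normed_vector \<Rightarrow> real"
  shows "C_order n f \<Longrightarrow> C_order n (\<lambda>x. exp (f x))"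
proof (induction n)
  case 0
  then show ?case by (auto intro: continuous_intros simp del: continuous_on_eq_continuous_within)
next
  case (Suc n)
  show ?case
  proof (rule C_order_SucI)
    show "((\<lambda>x. exp (f x)) has_derivative (\<lambda>v. exp (f x) * deriv_along v f x)) (at x)" for x
      using has_derivative_exp[OF has_derivative_deriv_along[OF Suc.prems]] by (simp add: mult.commute)
    show "C_order n (\<lambda>x. exp (f x) * deriv_along v f x)" for v
      using Suc.prems by (intro C_order_mult Suc.IH C_order_SucD[OF Suc.prems]) simp_all
  qed
qed

lemma C_order_inner: "C_order n (\<lambda>x. x \<bullet> v)"
proof (cases n)
  case (Suc m)
  show ?thesis unfolding Suc
    by (rule C_order_SucI[where f'="\<lambda>x w. w \<bullet> v"])
       (auto intro!: derivative_eq_intros C_order_const)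
qed (auto intro!: continuous_intros simp del: continuous_on_eq_continuous_within)

lemma one_plus_norm2_pos: "0 < 1 + (norm z)\<^sup>2"
  by (simp add: add_pos_nonneg)

lemma C_order_powr:
  "C_order n (\<lambda>z::'a::real_inner. (1 + (norm z)\<^sup>2) powr k)"
proof (induction n arbitrary: k)
  case 0
  have "1 + (norm z)\<^sup>2 \<noteq> 0" for z :: 'a using one_plus_norm2_pos[of z] by simp
  then show ?case by (auto intro!: continuous_intros simp del: continuous_on_eq_continuous_within)
next
  case (Suc n)
  show ?case
  proof (rule C_order_SucI)
    fix x :: 'a
    have "((\<lambda>z. 1 + (norm z)\<^sup>2) has_derivative (\<lambda>v. 2 * (x \<bullet> v))) (at x)"
      unfolding power2_norm_eq_inner by (auto intro!: derivative_eq_intros simp: inner_commute)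
    moreover have "((\<lambda>s. s powr k) has_derivative (*) (k * (1 + (norm x)\<^sup>2) powr (k - 1))) (at (1 + (norm x)\<^sup>2))"
      using has_real_derivative_powr[OF one_plus_norm2_pos[of x], of k] by (simp only: has_field_derivative_def)
    ultimately show "((\<lambda>z. (1 + (norm z)\<^sup>2) powr k) has_derivative
       (\<lambda>v. (k * (1 + (norm x)\<^sup>2) powr (k - 1)) * (2 * (x \<bullet> v)))) (at x)"
      by (rule has_derivative_compose)
  next
    show "C_order n (\<lambda>x::'a. (k * (1 + (norm x)\<^sup>2) powr (k - 1)) * (2 * (x \<bullet> v)))" for v
      by (intro C_order_mult C_order_const C_order_inner Suc.IH)
  qed
qed

lemma laplacian_cmult:
  assumes "C_order 2 u" shows "laplacian (\<lambda>z. c * u z) z = c * laplacian u z"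
proof -
  have d: "C_order (Suc 0) u" "\<And>v. C_order (Suc 0) (deriv_along v u)"
    using assms by (auto simp: numeral_2_eq_2 intro: C_order_SucD simp del: C_order.simps(2)) (simp add: numeral_2_eq_2)
  have eq: "deriv_along v (\<lambda>z. c * f z) = (\<lambda>z. c * deriv_along v f z)" if "C_order (Suc 0) f" for v and f :: "complex \<Rightarrow> real"
    by (intro ext deriv_along_eq has_derivative_mult_right has_derivative_deriv_along[OF that])
  show ?thesis unfolding laplacian_def eq[OF d(1)] fun_cong[OF eq[OF d(2)]] by (simp add: distrib_left)
qed

lemma laplacian_average:
  assumes "admissible M \<kappa> \<phi>" "C_order 2 u"
  shows "laplacian (average M \<kappa> \<phi> u) = average M \<kappa> \<phi> (laplacian u)"
proof -
  have u1: "C_order 1 u" using assms(2) by (rule C_order_le) simp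
  have d: "C_order 1 (deriv_along v u)" for v using assms(2) by (simp add: numeral_2_eq_2)
  have dd: "locally_bounded (deriv_along v (deriv_along v u))" for v
    using d[of v] by (intro locally_bounded_cts) simp
  show ?thesis
    unfolding laplacian_def[abs_def] deriv_along_average[OF assms(1) u1] fun_cong[OF deriv_along_average[OF assms(1) d]]
    by (intro ext average_add[symmetric] assms(1) dd)
qed

section \<open>The representation operator\<close>

lemma average_kernel_diff:
  assumes "admissible M \<kappa>1 \<phi>" "admissible M \<kappa>2 \<phi>" "locally_bounded g"
  shows "average M (\<lambda>x. \<kappa>1 x - \<kappa>2 x) \<phi> g z = average M \<kappa>1 \<phi> g z - average M \<kappa>2 \<phi> g z"
  using average_integrable[OF assms(1,3), of z] average_integrable[OF assms(2,3), of z]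
  by (simp add: average_def left_diff_distrib)

lemma average_kernel_mono:
  assumes "admissible M \<kappa>1 \<phi>" "admissible M \<kappa>2 \<phi>" "locally_bounded g"
    and "\<And>x. \<kappa>1 x \<le> \<kappa>2 x" "\<And>z. 0 \<le> g z"
  shows "average M \<kappa>1 \<phi> g z \<le> average M \<kappa>2 \<phi> g z"
  unfolding average_def
  by (intro integral_mono average_integrable assms mult_right_mono)

lemma gauss_weight_nonneg: "a \<ge> 0 \<Longrightarrow> t * gauss_weight a \<kappa> T t \<ge> 0"
  by (auto simp: gauss_weight_def indicator_def)

lemma gauss_weight_scale: "gauss_weight (c * a) \<kappa> T t = c * gauss_weight a \<kappa> T t"
  by (simp add: gauss_weight_def)

lemma scale_weight_gauss_t: "scale_weight (\<lambda>t. t * gauss_weight a \<kappa> T t)"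
  by (rule scale_weight_mult_t[OF scale_weight_gauss])

text \<open>The right-hand side of the representation formula at T = 1 with the Laplacian replaced
  by an independent \<open>g\<close>. Thus \<open>bump_mass * u z = represent \<kappa> u g z\<close>
  is a weak form of Laplace u = g that can be stated before \<open>u\<close> is known to be
  differentiable.\<close>

definition represent :: "real \<Rightarrow> (complex \<Rightarrow> real) \<Rightarrow> (complex \<Rightarrow> real) \<Rightarrow> complex \<Rightarrow> real" where
  "represent \<kappa> u g z = exp (- \<kappa>) * smear (bump 2) 1 u z
    + multismear (\<lambda>t. t * gauss_weight (2 * \<kappa>) \<kappa> 1 t) (bump 2) u z
    - multismear (\<lambda>t. t * gauss_weight (1 / 6) \<kappa> 1 t) (bump 3) g z"

text \<open>All derivatives fall on the kernels; 4 and 6 are twice the exponents of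
  \<open>bump 2\<close> and \<open>bump 3\<close>.\<close>

definition represent_deriv :: "real \<Rightarrow> complex \<Rightarrow> (complex \<Rightarrow> real) \<Rightarrow> (complex \<Rightarrow> real) \<Rightarrow> complex \<Rightarrow> real" where
  "represent_deriv \<kappa> v u g z = exp (- \<kappa>) * (4 * smear (dipole 1 v) 1 u z)
    + 4 * multismear (gauss_weight (2 * \<kappa>) \<kappa> 1) (dipole 1 v) u z
    - 6 * multismear (gauss_weight (1 / 6) \<kappa> 1) (dipole 2 v) g z"

lemma admissible_intros:
  "admissible lborel (bump 2) (\<lambda>y. t *\<^sub>R y)"
  "admissible lborel (bump 3) (\<lambda>y. t *\<^sub>R y)"
  "admissible lborel (dipole 1 v) (\<lambda>y. t *\<^sub>R y)"
  "admissible lborel (\<lambda>p. (fst p * gauss_weight a \<kappa> T (fst p)) * bump 2 (snd p)) (\<lambda>p. fst p *\<^sub>R snd p)"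
  "admissible lborel (\<lambda>p. (fst p * gauss_weight a \<kappa> T (fst p)) * bump 3 (snd p)) (\<lambda>p. fst p *\<^sub>R snd p)"
  "admissible lborel (\<lambda>p. gauss_weight a \<kappa> T (fst p) * dipole 1 v (snd p)) (\<lambda>p. fst p *\<^sub>R snd p)"
  "admissible lborel (\<lambda>p. gauss_weight a \<kappa> T (fst p) * dipole 2 v (snd p)) (\<lambda>p. fst p *\<^sub>R snd p)"
  by (intro admissible_smear kernel_bump kernel_dipole admissible_multismear scale_weight_gauss
      scale_weight_gauss_t[of a \<kappa> T]; simp)+

lemma represent_laplacian:
  "C_order 3 u \<Longrightarrow> bump_mass * u z = represent \<kappa> u (laplacian u) z"
  using representation_formula[of u 1 z \<kappa>] by (simp add: represent_def)

lemma has_derivative_represent: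
  assumes u: "locally_bounded u" and g: "locally_bounded g"
  shows "(represent \<kappa> u g has_derivative (\<lambda>v. represent_deriv \<kappa> v u g z)) (at z)"
proof -
  have kd: "kernel_derivative (bump 2) (\<lambda>y v. - 4 * dipole 1 v y)"
    using kernel_derivative_bump[of 1] by (simp add: numeral_2_eq_2)
  have kd3: "kernel_derivative (bump 3) (\<lambda>y v. - 6 * dipole 2 v y)"
    using kernel_derivative_bump[of 2] by (simp add: numeral_3_eq_3)
  have k: "kernel (bump 2)" "kernel (bump 3)" by (simp_all add: kernel_bump)
  have "(smear (bump 2) 1 u has_derivative (\<lambda>v. 4 * smear (dipole 1 v) 1 u z)) (at z)"
    using has_derivative_smear_kernel[OF k(1) kd u, of 1 z] unfolding average_scale_kernel by (simp del: scaleR_one One_nat_def)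
  moreover have "(multismear (\<lambda>t. t * gauss_weight (2 * \<kappa>) \<kappa> 1 t) (bump 2) u has_derivative
      (\<lambda>v. 4 * multismear (gauss_weight (2 * \<kappa>) \<kappa> 1) (dipole 1 v) u z)) (at z)"
    using has_derivative_multismear_kernel[OF scale_weight_gauss k(1) kd u] unfolding multismear_scaleK by (simp del: One_nat_def)
  moreover have "(multismear (\<lambda>t. t * gauss_weight (1/6) \<kappa> 1 t) (bump 3) g has_derivative
      (\<lambda>v. 6 * multismear (gauss_weight (1/6) \<kappa> 1) (dipole 2 v) g z)) (at z)"
    using has_derivative_multismear_kernel[OF scale_weight_gauss k(2) kd3 g] unfolding multismear_scaleK by (simp del: One_nat_def)
  ultimately show ?thesis
    unfolding represent_def[abs_def] represent_deriv_def
    by (intro has_derivative_add has_derivative_diff has_derivative_mult_right)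
qed

lemma continuous_on_represent:
  assumes "locally_bounded u" "locally_bounded g" shows "continuous_on UNIV (represent \<kappa> u g)"
  using has_derivative_continuous[OF has_derivative_represent[OF assms]]
  by (intro continuous_at_imp_continuous_on) auto

text \<open>The first derivative is put on the kernels and the remaining n on the functions, hence
  the gain of one order.\<close>

lemma C_order_represent:
  assumes "C_order n u" "C_order n g" shows "C_order (Suc n) (represent \<kappa> u g)"
proof (rule C_order_SucI)
  have "locally_bounded u" "locally_bounded g"
    by (rule locally_bounded_cts C_order_imp_continuous[OF assms(1)] C_order_imp_continuous[OF assms(2)])+
  then show "(represent \<kappa> u g has_derivative (\<lambda>v. represent_deriv \<kappa> v u g z)) (at z)" for z
    by (rule has_derivative_represent)
  show "C_order n (represent_deriv \<kappa> v u g)" for v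
    unfolding represent_deriv_def[abs_def]
    by (intro C_order_add C_order_diff C_order_cmult C_order_average assms admissible_intros)
qed

text \<open>For a bounded fixed point this amounts to a global gradient bound in terms of sup norms
  alone.\<close>

lemma represent_deriv_bounded:
  assumes "locally_bounded u" "locally_bounded g" "\<And>z. \<bar>u z\<bar> \<le> A" "\<And>z. \<bar>g z\<bar> \<le> B"
  shows "\<exists>C. \<forall>z. \<bar>represent_deriv \<kappa> v u g z\<bar> \<le> C"
proof -
  let ?a = "\<lambda>z. smear (dipole 1 v) 1 u z"
  let ?b = "\<lambda>z. multismear (gauss_weight (2 * \<kappa>) \<kappa> 1) (dipole 1 v) u z"
  let ?c = "\<lambda>z. multismear (gauss_weight (1 / 6) \<kappa> 1) (dipole 2 v) g z"
  obtain a b c where abc: "\<And>z. \<bar>?a z\<bar> \<le> a" "\<And>z. \<bar>?b z\<bar> \<le> b" "\<And>z. \<bar>?c z\<bar> \<le> c"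
    using average_bound[OF admissible_intros(3) assms(1,3)] average_bound[OF admissible_intros(6) assms(1,3)]
      average_bound[OF admissible_intros(7) assms(2,4)] by blast
  have "\<bar>represent_deriv \<kappa> v u g z\<bar> \<le> exp (- \<kappa>) * (4 * a) + 4 * b + 6 * c" for z
  proof -
    have "exp (- \<kappa>) * (4 * \<bar>?a z\<bar>) \<le> exp (- \<kappa>) * (4 * a)"
      by (intro mult_left_mono abc) auto
    moreover have "\<bar>represent_deriv \<kappa> v u g z\<bar> \<le> exp (- \<kappa>) * (4 * \<bar>?a z\<bar>) + 4 * \<bar>?b z\<bar> + 6 * \<bar>?c z\<bar>"
    proof -
      have "\<bar>exp (- \<kappa>) * (4 * ?a z)\<bar> = exp (- \<kappa>) * (4 * \<bar>?a z\<bar>)" by (simp add: abs_mult)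
      then show ?thesis unfolding represent_deriv_def by linarith
    qed
    ultimately show ?thesis using abc(2,3)[of z] by linarith
  qed
  then show ?thesis by blast
qed

section \<open>From fixed points of the representation operator to the differential equation\<close>

lemma integral_bump_pos:
  assumes "m > 0" shows "(LINT y|lborel. bump m y) > 0"
proof -
  have i: "integrable lborel (bump m)" using kernel_integrable[OF kernel_bump[OF assms]] .
  let ?B = "ball (0::complex) (1/2)"
  have "0 < (1/2)^m * measure lborel ?B" using content_ball_pos[of "1/2" "0::complex"] by simp
  also have "\<dots> = (LINT y|lborel. (1/2)^m * indicator ?B y)" by simp
  also have "\<dots> \<le> (LINT y|lborel. bump m y)"
  proof (rule integral_mono)
    show "integrable lborel (\<lambda>y. (1/2)^m * indicator ?B y :: real)"
      using emeasure_lborel_ball_finite[of "0::complex" "1/2"] by simp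
    fix y
    show "(1/2)^m * indicator ?B y \<le> bump m y"
    proof (cases "y \<in> ?B")
      case True
      then have "(norm y)\<^sup>2 \<le> (1/2)\<^sup>2" by (intro power_mono) auto
      then have "1/2 \<le> 1 - (norm y)\<^sup>2" by (simp add: power2_eq_square)
      then show ?thesis using True unfolding bump_def by (auto intro!: power_mono)
    qed simp
  qed (rule i)
  finally show ?thesis .
qed

lemma bump_mass_pos: "bump_mass > 0"
  unfolding bump_mass_def by (rule integral_bump_pos) simp

text \<open>If \<open>q\<close> has vanishing average against the second kernel, then so has its Laplacian, and the
  representation formula expresses \<open>q\<close> through averages of total mass less than one.\<close>

lemma null_average_bounded_imp_zero:
  assumes \<kappa>: "\<kappa> > 0" and q: "C_order 3 q" and bd: "\<And>z. \<bar>q z\<bar> \<le> C"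
    and null: "\<And>z. multismear (\<lambda>t. t * gauss_weight (1 / 6) \<kappa> 1 t) (bump 3) q z = 0"
  shows "q z = 0"
proof -
  let ?w = "\<lambda>t. t * gauss_weight (2 * \<kappa>) \<kappa> 1 t"
  let ?N = "multismear (\<lambda>t. t * gauss_weight (1 / 6) \<kappa> 1 t) (bump 3)"
  let ?c3 = "LINT y|lborel. bump 3 y"
  define I where "I = (LINT t|lborel. ?w t)"
  have q2: "C_order 2 q" using q by (rule C_order_le) simp
  have lq: "locally_bounded q" by (rule locally_bounded_cts[OF C_order_imp_continuous[OF q]])
  have l1: "locally_bounded (\<lambda>_. 1)" by (intro locally_bounded_cts continuous_intros)
  have w: "scale_weight ?w" by (rule scale_weight_gauss_t)
  have k: "kernel (bump 2)" "kernel (bump 3)" by (simp_all add: kernel_bump)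
  have Nq: "?N q = (\<lambda>z. 0)" using null by (intro ext)
  have "?N (laplacian q) = laplacian (?N q)"
    by (rule laplacian_average[symmetric]) (rule admissible_intros q2)+
  then have NL: "?N (laplacian q) z = 0" for z unfolding Nq by (simp add: laplacian_def)
  \<comment> \<open>The two scale weights are proportional with ratio 2 \<kappa> / (1/6) = 12
    \<kappa>, so the average of \<open>q\<close> vanishes for \<open>?w\<close> as well.\<close>
  have N3: "multismear ?w (bump 3) q z = 0" for z
  proof -
    have "?w t = (12 * \<kappa>) * (t * gauss_weight (1 / 6) \<kappa> 1 t)" for t
      using gauss_weight_scale[of "12 * \<kappa>" "1/6" \<kappa> 1 t] by simp
    then have "multismear ?w (bump 3) q z = (12 * \<kappa>) * ?N q z"
      by (simp only: mult.assoc average_scale_kernel)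
    then show ?thesis by (simp add: null)
  qed
  have mass: "multismear ?w K (\<lambda>_. 1) z = I * (LINT y|lborel. K y)" if "kernel K" for K z
    unfolding multismear_Fubini(2)[OF w that l1] I_def by (simp add: average_def)
  \<comment> \<open>The representation formula for the constant 1 evaluates the total weight
    \<open>I\<close> without computing an integral.\<close>
  have "bump_mass * 1 = exp (- \<kappa>) * (1 * bump_mass) + I * bump_mass"
    using represent_laplacian[OF C_order_const[of 3 1], where z=z and \<kappa>=\<kappa>]
    unfolding represent_def mass[OF k(1)] by (simp add: average_def bump_mass_def laplacian_def)
  then have "bump_mass * (1 - exp (- \<kappa>) - I) = 0" by (simp add: algebra_simps)
  then have I: "I = 1 - exp (- \<kappa>)" using bump_mass_pos by simp
  have Ipos: "I > 0" using \<kappa> by (simp add: I)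
  \<comment> \<open>Subtracting the vanishing \<open>bump 3\<close> term does not change the formula
    for \<open>q\<close>, but it lowers the mass of a kernel that stays nonnegative. Without it the
    masses would add up to exactly \<open>bump_mass\<close> and there would be no
    contraction.\<close>
  let ?K = "\<lambda>p. ?w (fst p) * bump 2 (snd p) - ?w (fst p) * bump 3 (snd p)"
  note ad = admissible_intros(4)[of "2 * \<kappa>" \<kappa> 1] admissible_intros(5)[of "2 * \<kappa>" \<kappa> 1]
  have adK: "admissible lborel ?K (\<lambda>p. fst p *\<^sub>R snd p)"
  proof -
    have "?K = (\<lambda>p. ?w (fst p) * (bump 2 (snd p) - bump 3 (snd p)))" by (simp add: right_diff_distrib)
    moreover have "kernel (\<lambda>y. bump 2 y - bump 3 y)"
    proof -
      have "\<bar>bump 2 y - bump 3 y\<bar> \<le> 1 * indicator (cball 0 1) y" for y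
        using bump_antimono[of 2 3 y] bump_le_indicator[of 2 y] bump_nonneg[of 3 y] by linarith
      then show ?thesis unfolding kernel_def by (intro conjI exI allI) (measurable, blast)
    qed
    ultimately show ?thesis using admissible_multismear[OF w] by simp
  qed
  have Kpos: "?K p \<ge> 0" for p
    using mult_left_mono[OF bump_antimono[of 2 3 "snd p"] gauss_weight_nonneg[of "2 * \<kappa>" "fst p" \<kappa> 1]] \<kappa> by simp
  have massK: "(LINT p|lborel. \<bar>?K p\<bar>) = I * (bump_mass - ?c3)"
  proof -
    have "(LINT p|lborel. \<bar>?K p\<bar>) = average lborel ?K (\<lambda>p. fst p *\<^sub>R snd p) (\<lambda>_. 1) z"
      using Kpos by (simp add: average_def)
    also have "\<dots> = I * (bump_mass - ?c3)"
      unfolding average_kernel_diff[OF ad l1] mass[OF k(1)] mass[OF k(2)] by (simp add: bump_mass_def right_diff_distrib)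
    finally show ?thesis .
  qed
  define S where "S = (SUP z. \<bar>q z\<bar>)"
  have bdd: "bdd_above (range (\<lambda>z. \<bar>q z\<bar>))" using bd by (intro bdd_aboveI2)
  have qS: "\<bar>q z\<bar> \<le> S" for z unfolding S_def by (rule cSUP_upper[OF _ bdd]) simp
  have step: "bump_mass * \<bar>q z\<bar> \<le> S * (bump_mass - I * ?c3)" for z
  proof -
    have "bump_mass * q z = exp (- \<kappa>) * smear (bump 2) 1 q z + average lborel ?K (\<lambda>p. fst p *\<^sub>R snd p) q z"
      unfolding represent_laplacian[OF q, of z \<kappa>] represent_def NL average_kernel_diff[OF ad lq] N3 by (simp del: scaleR_one)
    moreover have "\<bar>exp (- \<kappa>) * smear (bump 2) 1 q z\<bar> \<le> exp (- \<kappa>) * (S * bump_mass)"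
      using average_bound[OF admissible_intros(1) lq qS, of 1 z] by (simp add: abs_mult bump_mass_def)
    moreover have "\<bar>average lborel ?K (\<lambda>p. fst p *\<^sub>R snd p) q z\<bar> \<le> S * (I * (bump_mass - ?c3))"
      using average_bound[OF adK lq qS, of z] unfolding massK .
    moreover have "bump_mass * \<bar>q z\<bar> = \<bar>bump_mass * q z\<bar>" using bump_mass_pos by (simp add: abs_mult)
    ultimately have "bump_mass * \<bar>q z\<bar> \<le> exp (- \<kappa>) * (S * bump_mass) + S * (I * (bump_mass - ?c3))" by linarith
    also have "\<dots> = S * (bump_mass - I * ?c3)" by (simp add: I algebra_simps)
    finally show ?thesis .
  qed
  \<comment> \<open>The supremum over z gives S <= S (1 - \<theta>) with \<theta> > 0, which forces
    S <= 0.\<close>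
  have "S \<le> S * (bump_mass - I * ?c3) / bump_mass"
    unfolding S_def[symmetric]
    by (subst S_def, rule cSUP_least) (use step bump_mass_pos in \<open>auto simp: field_simps\<close>)
  then have "S * (I * ?c3) \<le> 0" using bump_mass_pos by (simp add: field_simps)
  then have "S \<le> 0" using Ipos integral_bump_pos[of 3] by (simp add: mult_le_0_iff)
  with qS[of z] show ?thesis by simp
qed

text \<open>The representation formula is applied to the difference of Laplacian and
  \<open>g\<close>, which must have order 3; the Laplacian costs two more, hence order 5. Most of
  the work is a global bound for this difference.\<close>

lemma fixed_point_laplacian:
  assumes \<kappa>: "\<kappa> > 0" and u: "C_order 5 u" and g: "C_order 3 g"
    and bu: "\<And>z. \<bar>u z\<bar> \<le> A" and bg: "\<And>z. \<bar>g z\<bar> \<le> B"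
    and fx: "\<And>z. bump_mass * u z = represent \<kappa> u g z"
  shows "laplacian u z = g z"
proof -
  let ?q = "\<lambda>z. laplacian u z - g z"
  let ?N = "multismear (\<lambda>t. t * gauss_weight (1 / 6) \<kappa> 1 t) (bump 3)"
  let ?w = "\<lambda>t. t * gauss_weight (2 * \<kappa>) \<kappa> 1 t"
  have Lu: "C_order 3 (laplacian u)" by (rule C_order_laplacian) (use u in \<open>simp add: eval_nat_numeral\<close>)
  have q: "C_order 3 ?q" by (rule C_order_diff[OF Lu g])
  have u3: "C_order 3 u" using u by (rule C_order_le) simp
  have d: "C_order 1 (deriv_along v u)" for v
    by (rule C_order_le[of 4]) (use u in \<open>simp_all add: eval_nat_numeral\<close>)
  have l: "locally_bounded u" "locally_bounded g" "locally_bounded (laplacian u)" "locally_bounded ?q"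
    by (rule locally_bounded_cts C_order_imp_continuous[OF u] C_order_imp_continuous[OF g]
        C_order_imp_continuous[OF q] C_order_imp_continuous[OF Lu])+
  have ld: "locally_bounded (deriv_along v u)" for v
    by (rule locally_bounded_cts C_order_imp_continuous[OF d])+
  have ldd: "locally_bounded (deriv_along v (deriv_along v u))" for v
    by (rule locally_bounded_cts) (use d[of v] in simp)
  \<comment> \<open>Subtracting the fixed point equation from the representation formula of
    \<open>u\<close> leaves only the term in which the Laplacian was exchanged for
    \<open>g\<close>.\<close>
  have null: "?N ?q z = 0" for z
    using represent_laplacian[OF u3, of z \<kappa>] fx[of z]
    unfolding average_diff[OF admissible_intros(5) l(3,2)] represent_def by simp
  \<comment> \<open>Differentiating the fixed point equation on the kernels bounds the first
    derivatives of \<open>u\<close>.\<close>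
  have bd: "\<exists>C. \<forall>z. \<bar>deriv_along v u z\<bar> \<le> C" for v
  proof -
    obtain C where C: "\<And>z. \<bar>represent_deriv \<kappa> v u g z\<bar> \<le> C"
      using represent_deriv_bounded[OF l(1,2) bu bg] by blast
    have eq: "u = (\<lambda>z. (1 / bump_mass) * represent \<kappa> u g z)"
      using fx bump_mass_pos by (intro ext) (simp add: field_simps flip: fx)
    have "(u has_derivative (\<lambda>v. (1 / bump_mass) * represent_deriv \<kappa> v u g z)) (at z)" for z
      using has_derivative_mult_right[OF has_derivative_represent[OF l(1,2)], of "1 / bump_mass" \<kappa> z]
      by (simp only: eq[symmetric])
    from deriv_along_eq[OF this] have "\<bar>deriv_along v u z\<bar> \<le> C / bump_mass" for z
      using C[of z] bump_mass_pos by (simp add: abs_mult divide_right_mono)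
    then show ?thesis by blast
  qed
  \<comment> \<open>One of the two derivatives is moved onto the kernel; the other stays on
    \<open>u\<close>, where \<open>bd\<close> controls it.\<close>
  have ex: "\<exists>C. \<forall>z. \<bar>smear (bump 2) 1 (deriv_along v (deriv_along v u)) z\<bar> \<le> C"
    "\<exists>C. \<forall>z. \<bar>multismear ?w (bump 2) (deriv_along v (deriv_along v u)) z\<bar> \<le> C" for v
  proof -
    obtain C where C: "\<And>z. \<bar>deriv_along v u z\<bar> \<le> C" using bd by blast
    have e: "smear (bump 2) 1 (deriv_along v (deriv_along v u)) z = 4 * smear (dipole 1 v) 1 (deriv_along v u) z" for z
      using smear_bump_deriv_along[OF _ d, of 1 1] by (simp add: numeral_2_eq_2 del: scaleR_one)
    show "\<exists>C. \<forall>z. \<bar>smear (bump 2) 1 (deriv_along v (deriv_along v u)) z\<bar> \<le> C"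
      unfolding e abs_mult by (intro exI allI) (rule mult_left_mono[OF average_bound[OF admissible_intros(3) ld C]], simp)
    have e: "multismear ?w (bump 2) (deriv_along v (deriv_along v u)) z =
        4 * multismear (gauss_weight (2 * \<kappa>) \<kappa> 1) (dipole 1 v) (deriv_along v u) z" for z
      using multismear_bump_deriv_along[OF _ d scale_weight_gauss, of 1] by (simp add: numeral_2_eq_2)
    show "\<exists>C. \<forall>z. \<bar>multismear ?w (bump 2) (deriv_along v (deriv_along v u)) z\<bar> \<le> C"
      unfolding e abs_mult by (intro exI allI) (rule mult_left_mono[OF average_bound[OF admissible_intros(6) ld C]], simp)
  qed
  obtain C1 where C1: "\<And>z. \<bar>smear (bump 2) 1 (deriv_along 1 (deriv_along 1 u)) z\<bar> \<le> C1"
    using ex(1)[of 1] by (elim exE) auto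
  obtain C2 where C2: "\<And>z. \<bar>smear (bump 2) 1 (deriv_along \<i> (deriv_along \<i> u)) z\<bar> \<le> C2"
    using ex(1)[of \<i>] by (elim exE) auto
  obtain C3 where C3: "\<And>z. \<bar>multismear ?w (bump 2) (deriv_along 1 (deriv_along 1 u)) z\<bar> \<le> C3"
    using ex(2)[of 1] by (elim exE) auto
  obtain C4 where C4: "\<And>z. \<bar>multismear ?w (bump 2) (deriv_along \<i> (deriv_along \<i> u)) z\<bar> \<le> C4"
    using ex(2)[of \<i>] by (elim exE) auto
  define C5 C6 where C56: "C5 = B * (LINT y|lborel. \<bar>bump 2 y\<bar>)"
    "C6 = B * (LINT p|lborel. \<bar>?w (fst p) * bump 2 (snd p)\<bar>)"
  have C5: "\<bar>smear (bump 2) 1 g z\<bar> \<le> C5" and C6: "\<bar>multismear ?w (bump 2) g z\<bar> \<le> C6" for z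
    unfolding C56 by (rule average_bound[OF admissible_intros(1) l(2) bg] average_bound[OF admissible_intros(4) l(2) bg])+
  \<comment> \<open>In the representation formula of \<open>?q\<close> the Laplacian term vanishes
    together with the averages of \<open>?q\<close>. What remains are averages of second derivatives
    of \<open>u\<close> and of \<open>g\<close>, all bounded above.\<close>
  have bq: "\<bar>?q z\<bar> \<le> (C1 + C2 + C5 + C3 + C4 + C6) / bump_mass" for z
  proof -
    have "?N (laplacian ?q) = laplacian (?N ?q)"
      by (rule laplacian_average[symmetric]) (rule admissible_intros, rule C_order_le[OF q], simp)
    moreover have "?N ?q = (\<lambda>z. 0)" using null by (intro ext)
    ultimately have NL: "?N (laplacian ?q) z = 0" by (simp add: laplacian_def)
    have "bump_mass * ?q z = exp (- \<kappa>) * smear (bump 2) 1 ?q z + multismear ?w (bump 2) ?q z"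
      unfolding represent_laplacian[OF q, of z \<kappa>] represent_def NL by (simp del: scaleR_one)
    also have "smear (bump 2) 1 ?q z = smear (bump 2) 1 (deriv_along 1 (deriv_along 1 u)) z +
        smear (bump 2) 1 (deriv_along \<i> (deriv_along \<i> u)) z - smear (bump 2) 1 g z"
      unfolding average_diff[OF admissible_intros(1) l(3,2)]
      unfolding laplacian_def[abs_def] average_add[OF admissible_intros(1) ldd ldd] ..
    also have "multismear ?w (bump 2) ?q z = multismear ?w (bump 2) (deriv_along 1 (deriv_along 1 u)) z +
        multismear ?w (bump 2) (deriv_along \<i> (deriv_along \<i> u)) z - multismear ?w (bump 2) g z"
      unfolding average_diff[OF admissible_intros(4) l(3,2)]
      unfolding laplacian_def[abs_def] average_add[OF admissible_intros(4) ldd ldd] ..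
    finally have eq: "bump_mass * ?q z = exp (- \<kappa>) * (smear (bump 2) 1 (deriv_along 1 (deriv_along 1 u)) z +
        smear (bump 2) 1 (deriv_along \<i> (deriv_along \<i> u)) z - smear (bump 2) 1 g z) + \<dots>" .
    have "\<bar>exp (- \<kappa>) * X\<bar> \<le> \<bar>X\<bar>" for X
      using \<kappa> by (simp add: abs_mult mult_left_le_one_le)
    then have "\<bar>bump_mass * ?q z\<bar> \<le> C1 + C2 + C5 + C3 + C4 + C6"
      using C1[of z] C2[of z] C3[of z] C4[of z] C5[of z] C6[of z]
      unfolding eq abs_le_iff by (smt (verit))
    then show ?thesis
      unfolding abs_mult pos_le_divide_eq[OF bump_mass_pos] using bump_mass_pos by (simp only: abs_of_pos mult.commute)
  qed
  from null_average_bounded_imp_zero[OF \<kappa> q bq null, of z] show ?thesis by simp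
qed

text \<open>Bootstrapping: each pass through the fixed point equation raises the order by one.
  Regularity of \<open>g\<close> is assumed conditionally on that of \<open>u\<close> because
  \<open>g\<close> will be F + H e^u.\<close>

lemma fixed_point_smooth:
  assumes u: "u \<in> borel_measurable borel" "\<And>z. \<bar>u z\<bar> \<le> A"
    and g: "\<And>n. C_order n u \<Longrightarrow> C_order n g" "locally_bounded g"
    and fx: "\<And>z. bump_mass * u z = represent \<kappa> u g z"
  shows "smooth u"
proof -
  have eq: "u = (\<lambda>z. (1 / bump_mass) * represent \<kappa> u g z)"
    using fx bump_mass_pos by (intro ext) (simp add: field_simps flip: fx)
  have "C_order n u" for n
  proof (induction n)
    case 0
    have "continuous_on UNIV (\<lambda>z. (1 / bump_mass) * represent \<kappa> u g z)"
      by (intro continuous_intros continuous_on_represent g locally_bounded_bdd[OF u])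
    then show ?case by (simp only: eq[symmetric] C_order.simps)
  next
    case (Suc n)
    have "C_order (Suc n) (\<lambda>z. (1 / bump_mass) * represent \<kappa> u g z)"
      by (intro C_order_cmult C_order_represent Suc g)
    then show ?case by (simp only: eq[symmetric])
  qed
  then show ?thesis by (simp add: smooth_def)
qed


section \<open>Monotone iteration between barriers\<close>

lemma locally_bounded_cmult:
  assumes "locally_bounded f" shows "locally_bounded (\<lambda>z. c * f z)"
  unfolding locally_bounded_def
proof (intro conjI allI)
  fix R
  obtain A where A: "\<And>z. norm z \<le> R \<Longrightarrow> \<bar>f z\<bar> \<le> A" using assms by (rule locally_boundedE) blast
  then have "\<bar>c * f z\<bar> \<le> \<bar>c\<bar> * A" if "norm z \<le> R" for z
    unfolding abs_mult using that by (intro mult_left_mono) auto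
  then show "\<exists>B. \<forall>z. norm z \<le> R \<longrightarrow> \<bar>c * f z\<bar> \<le> B" by blast
qed (use assms in \<open>auto simp: locally_bounded_def\<close>)

lemma locally_bounded_diff:
  assumes "locally_bounded f" "locally_bounded g" shows "locally_bounded (\<lambda>z. f z - g z)"
  unfolding locally_bounded_def
proof (intro conjI allI)
  fix R
  obtain A where A: "\<And>z. norm z \<le> R \<Longrightarrow> \<bar>f z\<bar> \<le> A" using assms(1) by (rule locally_boundedE) blast
  obtain B where B: "\<And>z. norm z \<le> R \<Longrightarrow> \<bar>g z\<bar> \<le> B" using assms(2) by (rule locally_boundedE) blast
  have "\<bar>f z - g z\<bar> \<le> A + B" if "norm z \<le> R" for z
    using A[OF that] B[OF that] abs_triangle_ineq4[of "f z" "g z"] by linarith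
  then show "\<exists>B. \<forall>z. norm z \<le> R \<longrightarrow> \<bar>f z - g z\<bar> \<le> B" by blast
qed (use assms in \<open>auto simp: locally_bounded_def\<close>)

text \<open>Raising \<open>u\<close> increases the averages of \<open>u\<close>, but also the
  subtracted average of H e^u. Convexity of exp bounds the latter increase by 12 \<kappa> times that
  of \<open>u\<close>; as 12 \<kappa> is the ratio of the weights 2 \<kappa> and 1/6, what is left
  to compare is \<open>bump 3\<close> with \<open>bump 2\<close>.\<close>

lemma represent_mono:
  assumes \<kappa>: "\<kappa> > 0" and F: "locally_bounded F"
    and H: "locally_bounded H" "\<And>z. 0 \<le> H z"
    and u: "locally_bounded u1" "locally_bounded u2" "\<And>z. u1 z \<le> u2 z"
    and k: "\<And>z. H z * exp (u2 z) \<le> 12 * \<kappa>"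
    and g: "locally_bounded (\<lambda>z. F z + H z * exp (u1 z))" "locally_bounded (\<lambda>z. F z + H z * exp (u2 z))"
  shows "represent \<kappa> u1 (\<lambda>z. F z + H z * exp (u1 z)) z \<le> represent \<kappa> u2 (\<lambda>z. F z + H z * exp (u2 z)) z"
proof -
  let ?g1 = "\<lambda>z. F z + H z * exp (u1 z)" and ?g2 = "\<lambda>z. F z + H z * exp (u2 z)"
  let ?N = "multismear (\<lambda>t. t * gauss_weight (1 / 6) \<kappa> 1 t) (bump 3)"
  let ?M = "\<lambda>m. multismear (\<lambda>t. t * gauss_weight (2 * \<kappa>) \<kappa> 1 t) (bump m)"
  have ld: "locally_bounded (\<lambda>z. u2 z - u1 z)"
    by (rule locally_bounded_diff[OF u(2,1)])
  have lipschitz: "H z * exp (u2 z) - H z * exp (u1 z) \<le> (12 * \<kappa>) * (u2 z - u1 z)" for z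
  proof -
    \<comment> \<open>The graph of exp lies above its tangent at \<open>u2 z\<close>.\<close>
    have "exp (u2 z) * (1 + (u1 z - u2 z)) \<le> exp (u2 z) * exp (u1 z - u2 z)"
      by (intro mult_left_mono exp_ge_add_one_self) auto
    also have "\<dots> = exp (u1 z)" by (simp flip: exp_add)
    finally have "exp (u2 z) - exp (u1 z) \<le> exp (u2 z) * (u2 z - u1 z)" by (simp add: algebra_simps)
    then have "H z * (exp (u2 z) - exp (u1 z)) \<le> H z * (exp (u2 z) * (u2 z - u1 z))"
      by (rule mult_left_mono) (rule H)
    also have "\<dots> = (H z * exp (u2 z)) * (u2 z - u1 z)" by simp
    also have "\<dots> \<le> (12 * \<kappa>) * (u2 z - u1 z)" using u(3)[of z] by (intro mult_right_mono k) simp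
    finally show ?thesis by (simp add: right_diff_distrib)
  qed
  have "?N ?g2 z - ?N ?g1 z = ?N (\<lambda>z. ?g2 z - ?g1 z) z"
    by (rule average_diff[symmetric]) (rule admissible_intros g)+
  also have "\<dots> \<le> ?N (\<lambda>z. (12 * \<kappa>) * (u2 z - u1 z)) z"
  proof (rule average_mono)
    show "0 \<le> (fst p * gauss_weight (1 / 6) \<kappa> 1 (fst p)) * bump 3 (snd p)" for p
      by (intro mult_nonneg_nonneg[OF gauss_weight_nonneg]) auto
    show "locally_bounded (\<lambda>z. ?g2 z - ?g1 z)" by (rule locally_bounded_diff[OF g(2,1)])
    show "locally_bounded (\<lambda>z. (12 * \<kappa>) * (u2 z - u1 z))" by (rule locally_bounded_cmult[OF ld])
  qed (use lipschitz in \<open>auto intro: admissible_intros\<close>)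
  also have "\<dots> = ?M 3 (\<lambda>z. u2 z - u1 z) z"
  proof -
    have "t * gauss_weight (2 * \<kappa>) \<kappa> 1 t = (12 * \<kappa>) * (t * gauss_weight (1 / 6) \<kappa> 1 t)" for t
      using gauss_weight_scale[of "12 * \<kappa>" "1/6" \<kappa> 1 t] by simp
    then show ?thesis by (simp only: mult.assoc average_scale_kernel average_cmult)
  qed
  also have "\<dots> \<le> ?M 2 (\<lambda>z. u2 z - u1 z) z"
  proof (rule average_kernel_mono)
    show "fst p * gauss_weight (2 * \<kappa>) \<kappa> 1 (fst p) * bump 3 (snd p) \<le> fst p * gauss_weight (2 * \<kappa>) \<kappa> 1 (fst p) * bump 2 (snd p)" for p
      using \<kappa> by (intro mult_left_mono bump_antimono gauss_weight_nonneg) auto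
  qed (use u(3) ld in \<open>auto intro: admissible_intros\<close>)
  also have "\<dots> = ?M 2 u2 z - ?M 2 u1 z"
    by (rule average_diff) (rule admissible_intros u)+
  finally have "?N ?g2 z - ?N ?g1 z \<le> ?M 2 u2 z - ?M 2 u1 z" .
  moreover have "exp (- \<kappa>) * smear (bump 2) 1 u1 z \<le> exp (- \<kappa>) * smear (bump 2) 1 u2 z"
    by (intro mult_left_mono average_mono admissible_intros u) auto
  ultimately show ?thesis unfolding represent_def by linarith
qed

lemma represent_tendsto:
  assumes "\<And>n. locally_bounded (u n)" "\<And>n z. \<bar>u n z\<bar> \<le> A" "\<And>z. (\<lambda>n. u n z) \<longlonglongrightarrow> U z"
    and "\<And>n. locally_bounded (g n)" "\<And>n z. \<bar>g n z\<bar> \<le> B" "\<And>z. (\<lambda>n. g n z) \<longlonglongrightarrow> G z"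
  shows "(\<lambda>n. represent \<kappa> (u n) (g n) z) \<longlonglongrightarrow> represent \<kappa> U G z"
  unfolding represent_def
  by (intro tendsto_intros average_tendsto[OF admissible_intros(1) assms(1-3)]
      average_tendsto[OF admissible_intros(4) assms(1-3)] average_tendsto[OF admissible_intros(5) assms(4-6)])

text \<open>The iteration starts at the upper barrier and decreases, while the lower barrier bounds
  it from below. Barriers are compared through \<open>represent\<close> and not through their
  Laplacian, so they need only be bounded and measurable, and the same is all that is claimed of the
  limit.\<close>

lemma fixed_point_between_barriers:
  assumes \<kappa>: "\<kappa> > 0" and F: "F \<in> borel_measurable borel" "\<And>z. \<bar>F z\<bar> \<le> B"
    and H: "H \<in> borel_measurable borel" "\<And>z. 0 \<le> H z" "\<And>z. H z \<le> B"
    and up: "up \<in> borel_measurable borel" "\<And>z. \<bar>up z\<bar> \<le> A"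
    and lo: "lo \<in> borel_measurable borel" "\<And>z. \<bar>lo z\<bar> \<le> A"
    and le: "\<And>z. lo z \<le> up z" and k: "\<And>z. H z * exp (up z) \<le> 12 * \<kappa>"
    and super: "\<And>z. represent \<kappa> up (\<lambda>z. F z + H z * exp (up z)) z \<le> bump_mass * up z"
    and sub: "\<And>z. bump_mass * lo z \<le> represent \<kappa> lo (\<lambda>z. F z + H z * exp (lo z)) z"
  obtains u where "u \<in> borel_measurable borel" "\<And>z. lo z \<le> u z" "\<And>z. u z \<le> up z"
    "\<And>z. bump_mass * u z = represent \<kappa> u (\<lambda>z. F z + H z * exp (u z)) z"
proof -
  let ?g = "\<lambda>u z. F z + H z * exp (u z)"
  define \<Phi> where "\<Phi> u z = represent \<kappa> u (?g u) z / bump_mass" for u z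
  \<comment> \<open>The order interval between the barriers. The bound \<open>k\<close> at the upper
    barrier is inherited by all its members, so \<open>represent_mono\<close> applies throughout the
    interval.\<close>
  define adm where "adm u \<longleftrightarrow> u \<in> borel_measurable borel \<and> (\<forall>z. lo z \<le> u z \<and> u z \<le> up z)" for u
  have bu: "\<bar>u z\<bar> \<le> A" if "adm u" for u z
    using that up(2)[of z] lo(2)[of z] unfolding adm_def by (smt (verit, best))
  have lu: "locally_bounded u" if "adm u" for u
    using bu[OF that] that by (intro locally_bounded_bdd) (auto simp: adm_def)
  have B0: "B \<ge> 0" using order_trans[OF H(2,3)] .
  have bg: "\<bar>?g u z\<bar> \<le> B + B * exp A" if "adm u" for u z
  proof -
    have "\<bar>H z * exp (u z)\<bar> \<le> B * exp A"
      unfolding abs_mult by (intro mult_mono) (use H bu[OF that, of z] B0 in auto)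
    then show ?thesis using F(2)[of z] by linarith
  qed
  have lg: "locally_bounded (?g u)" if "adm u" for u
  proof (rule locally_bounded_bdd[OF _ bg[OF that]])
    have [measurable]: "u \<in> borel_measurable borel" using that by (simp add: adm_def)
    note [measurable] = F(1) H(1)
    show "?g u \<in> borel_measurable borel" by measurable
  qed
  have lF: "locally_bounded F" "locally_bounded H"
    using F H by (auto intro!: locally_bounded_bdd)
  have adm0: "adm up" "adm lo" using up lo le by (auto simp: adm_def)
  have mono: "\<Phi> u1 z \<le> \<Phi> u2 z" if "adm u1" "adm u2" "\<And>z. u1 z \<le> u2 z" for u1 u2 z
  proof -
    have "H z * exp (u2 z) \<le> 12 * \<kappa>" for z
    proof -
      have "H z * exp (u2 z) \<le> H z * exp (up z)" using that(2) H(2) by (intro mult_left_mono) (auto simp: adm_def)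
      then show ?thesis using k[of z] by linarith
    qed
    then show ?thesis unfolding \<Phi>_def
      using bump_mass_pos that by (intro divide_right_mono represent_mono lu lF lg \<kappa> H) auto
  qed
  have super': "\<Phi> up z \<le> up z" and sub': "lo z \<le> \<Phi> lo z" for z
    using super[of z] sub[of z] bump_mass_pos by (simp_all add: \<Phi>_def field_simps)
  have adm\<Phi>: "adm (\<Phi> u)" if "adm u" for u
    unfolding adm_def
  proof (intro conjI allI)
    have "continuous_on UNIV (\<Phi> u)"
      unfolding \<Phi>_def[abs_def] using bump_mass_pos
      by (intro continuous_intros continuous_on_represent lu lg that) auto
    then show "\<Phi> u \<in> borel_measurable borel" by (rule borel_measurable_continuous_onI)
    fix z
    show "lo z \<le> \<Phi> u z" by (rule order_trans[OF sub' mono]) (use adm0 that in \<open>auto simp: adm_def\<close>)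
    show "\<Phi> u z \<le> up z" by (rule order_trans[OF mono super']) (use adm0 that in \<open>auto simp: adm_def\<close>)
  qed
  define u where "u n = (\<Phi> ^^ n) up" for n
  have u_simps: "u 0 = up" "u (Suc n) = \<Phi> (u n)" for n by (simp_all add: u_def)
  have admu: "adm (u n)" for n by (induction n) (use adm0 adm\<Phi> in \<open>auto simp: u_simps\<close>)
  have dec: "u (Suc n) z \<le> u n z" for n z
  proof (induction n arbitrary: z)
    case 0
    then show ?case using super' by (simp add: u_simps)
  next
    case (Suc n)
    have "\<Phi> (u (Suc n)) z \<le> \<Phi> (u n) z" by (rule mono[OF admu admu Suc])
    then show ?case by (simp add: u_simps)
  qed
  have "convergent (\<lambda>n. u n z)" for z
  proof -
    have "decseq (\<lambda>n. u n z)" by (rule decseq_SucI) (rule dec)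
    moreover have "\<forall>n. \<bar>u n z\<bar> \<le> A" using bu[OF admu] by blast
    ultimately show ?thesis
      by (intro Bseq_monoseq_convergent) (auto intro!: BseqI' simp: decseq_imp_monoseq)
  qed
  then obtain U where U: "\<And>z. (\<lambda>n. u n z) \<longlonglongrightarrow> U z" unfolding convergent_def by metis
  have Ub: "lo z \<le> U z" "U z \<le> up z" for z
    using admu by (auto intro!: LIMSEQ_le_const[OF U] LIMSEQ_le_const2[OF U] simp: adm_def)
  have Um: "U \<in> borel_measurable borel"
    by (rule borel_measurable_LIMSEQ_real[OF U]) (use admu in \<open>auto simp: adm_def\<close>)
  \<comment> \<open>The recursion passes to the limit by bounded pointwise convergence, because all
    kernels are integrable.\<close>
  have "bump_mass * U z = represent \<kappa> U (?g U) z" for z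
  proof (rule LIMSEQ_unique)
    show "(\<lambda>n. represent \<kappa> (u n) (?g (u n)) z) \<longlonglongrightarrow> represent \<kappa> U (?g U) z"
      by (rule represent_tendsto[OF lu[OF admu] bu[OF admu] U lg[OF admu] bg[OF admu]]) (intro tendsto_intros U)
    have "(\<lambda>n. bump_mass * u (Suc n) z) \<longlonglongrightarrow> bump_mass * U z"
      by (intro tendsto_intros LIMSEQ_Suc U)
    then show "(\<lambda>n. represent \<kappa> (u n) (?g (u n)) z) \<longlonglongrightarrow> bump_mass * U z"
      using bump_mass_pos by (simp add: u_simps \<Phi>_def)
  qed
  with Um Ub show ?thesis using that by blast
qed


section \<open>The linear equation with a datum of mean zero\<close>

lemma bump_lipschitz:
  assumes "m > 1" shows "\<bar>bump m a - bump m b\<bar> \<le> 2 * of_nat m * norm (a - b)"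
proof -
  obtain k where k: "m = Suc k" "k > 0" using assms by (cases m) auto
  have "norm (bump (Suc k) a - bump (Suc k) b) \<le> (2 * of_nat (Suc k)) * norm (a - b)"
  proof (rule differentiable_bound[where S=UNIV and f'="\<lambda>y v. - (2 * of_nat (Suc k)) * dipole k v y"])
    fix y
    show "onorm (\<lambda>v. - (2 * of_nat (Suc k)) * dipole k v y) \<le> 2 * of_nat (Suc k)"
    proof (rule onorm_bound)
      fix v
      have "\<bar>dipole k v y\<bar> \<le> norm v"
        using order_trans[OF inner_bump_bound[OF k(2), of y v] mult_left_le[of "indicator (cball 0 1) y" "norm v"]]
        by (simp add: dipole_def indicator_le_1)
      then show "norm (- (2 * of_nat (Suc k)) * dipole k v y) \<le> 2 * of_nat (Suc k) * norm v"
        unfolding real_norm_def abs_mult abs_minus_cancel by (intro mult_mono) auto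
    qed simp
  qed (use has_derivative_bump[OF k(2)] in auto)
  then show ?thesis by (simp add: k)
qed

text \<open>Nearby points use the Lipschitz bound, distant ones the trivial bound 1. The exponent is
  matched to the datum of the linear equation, which has a finite moment of order \<beta> but in
  general no first moment.\<close>

lemma bump_hoelder:
  assumes m: "m > 1" and \<beta>: "0 < \<beta>" "\<beta> \<le> 1"
  shows "\<bar>bump m a - bump m b\<bar> \<le> 2 * of_nat m * norm (a - b) powr \<beta>"
proof (cases "norm (a - b) \<le> 1")
  case True
  have "norm (a - b) powr 1 \<le> norm (a - b) powr \<beta>"
    using True \<beta> by (intro powr_mono') auto
  then have "2 * of_nat m * norm (a - b) \<le> 2 * of_nat m * norm (a - b) powr \<beta>"
    by (intro mult_left_mono) auto
  then show ?thesis using bump_lipschitz[OF m, of a b] by linarith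
next
  case False
  have "bump m c \<le> 1" for c
    using order_trans[OF bump_le_indicator indicator_le_1] m by simp
  then have "\<bar>bump m a - bump m b\<bar> \<le> 1" using bump_nonneg[of m a] bump_nonneg[of m b] by (smt (verit))
  also have "1 \<le> 2 * real m * 1" using m by simp
  also have "\<dots> \<le> 2 * of_nat m * norm (a - b) powr \<beta>"
    using False \<beta> by (intro mult_left_mono ge_one_powr_ge_zero) auto
  finally show ?thesis .
qed

text \<open>Since G has mean zero, the kernel may be diminished by its value at x = 0. The Hoelder
  bound for the difference yields t^(-\<beta>), the Jacobian yields t^(-2), and the result is
  uniform in z.\<close>

lemma smear_bump_decay:
  assumes m: "m > 1" and \<beta>: "0 < \<beta>" "\<beta> \<le> 1" and G: "locally_bounded G"
    and int: "integrable lborel G" "integrable lborel (\<lambda>x. norm x powr \<beta> * \<bar>G x\<bar>)"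
    and zero: "(LINT x|lborel. G x) = 0" and t: "t > 0"
  shows "\<bar>smear (bump m) t G z\<bar> \<le> 2 * of_nat m * (LINT x|lborel. norm x powr \<beta> * \<bar>G x\<bar>) * t powr (- 2 - \<beta>)"
proof -
  let ?K = "\<lambda>x. bump m ((1 / t) *\<^sub>R (x - z))"
  have k: "kernel (bump m)" using m by (intro kernel_bump) simp
  have "(LINT x|lborel. ?K x * G x) = (LINT x|lborel. (?K x - ?K 0) * G x)"
    using smear_translated_integrable[OF k G, of t z] t int(1) zero by (simp add: left_diff_distrib)
  also have "\<bar>\<dots>\<bar> \<le> (LINT x|lborel. (2 * of_nat m * t powr (- \<beta>)) * (norm x powr \<beta> * \<bar>G x\<bar>))"
  proof (rule abs_integral_le)
    show "(\<lambda>x. (?K x - ?K 0) * G x) \<in> borel_measurable lborel"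
      using int(1) by measurable
    fix x
    have "\<bar>?K x - ?K 0\<bar> \<le> 2 * of_nat m * norm ((1 / t) *\<^sub>R (x - z) - (1 / t) *\<^sub>R (0 - z)) powr \<beta>"
      by (rule bump_hoelder[OF m \<beta>])
    also have "(1 / t) *\<^sub>R (x - z) - (1 / t) *\<^sub>R (0 - z) = (1 / t) *\<^sub>R x" by (simp add: scaleR_diff_right)
    also have "norm ((1 / t) *\<^sub>R x) powr \<beta> = t powr (- \<beta>) * norm x powr \<beta>"
      using t by (simp add: powr_divide powr_minus divide_simps)
    finally have "\<bar>?K x - ?K 0\<bar> * \<bar>G x\<bar> \<le> 2 * of_nat m * (t powr (- \<beta>) * norm x powr \<beta>) * \<bar>G x\<bar>"
      by (rule mult_right_mono) simp
    then show "\<bar>(?K x - ?K 0) * G x\<bar> \<le> (2 * of_nat m * t powr (- \<beta>)) * (norm x powr \<beta> * \<bar>G x\<bar>)"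
      by (simp add: abs_mult mult_ac)
  qed (use int in auto)
  finally have "\<bar>LINT x|lborel. ?K x * G x\<bar> \<le> 2 * of_nat m * t powr (- \<beta>) * (LINT x|lborel. norm x powr \<beta> * \<bar>G x\<bar>)"
    by simp
  then have "(1 / t\<^sup>2) * \<bar>LINT x|lborel. ?K x * G x\<bar> \<le> (1 / t\<^sup>2) * (2 * of_nat m * t powr (- \<beta>) * (LINT x|lborel. norm x powr \<beta> * \<bar>G x\<bar>))"
    by (rule mult_left_mono) simp
  moreover have "t powr (- 2 - \<beta>) = (1 / t\<^sup>2) * t powr (- \<beta>)"
    using t by (simp add: powr_diff powr_minus divide_simps)
  moreover have "\<bar>smear (bump m) t G z\<bar> = (1 / t\<^sup>2) * \<bar>LINT x|lborel. ?K x * G x\<bar>"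
    using t by (subst smear_translated[OF k G]) (simp_all add: abs_mult)
  ultimately show ?thesis by (simp add: mult_ac)
qed

text \<open>The weight is dominated by a step function on dyadic balls.\<close>

lemma integrable_powr_plane:
  assumes \<delta>: "\<delta> > 0"
  shows "integrable lborel (\<lambda>z::complex. (1 + (norm z)\<^sup>2) powr (- 1 - \<delta>))"
proof (rule integrableI_nonneg)
  let ?f = "\<lambda>z::complex. (1 + (norm z)\<^sup>2) powr (- 1 - \<delta>)"
  let ?B = "\<lambda>n::nat. ball (0::complex) (2 ^ n)"
  \<comment> \<open>If n is the least index with |z| < 2^n, then 1 + |z|^2 >= 4^(n-1), so
    \<open>a n\<close> bounds the weight at z. The subtraction is real: n = 0 gives 1/4, which is
    still below 1 + |z|^2.\<close>
  define a :: "nat \<Rightarrow> real" where "a n = (4 powr (real n - 1)) powr (- 1 - \<delta>)" for n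
  have "continuous_on UNIV ?f" using C_order_imp_continuous[OF C_order_powr[of 0]] .
  then show "?f \<in> borel_measurable lborel" using borel_measurable_continuous_onI by simp
  have pt: "ennreal (?f z) \<le> (\<Sum>n. ennreal (a n) * indicator (?B n) z)" for z
  proof -
    obtain n0 where "norm z < 2 ^ n0" using real_arch_pow[of 2 "norm z"] by auto
    then have ex: "\<exists>n. norm z < 2 ^ n" ..
    define n where "n = (LEAST n. norm z < 2 ^ n)"
    have n: "norm z < 2 ^ n" unfolding n_def using ex by (rule LeastI_ex)
    have "4 powr (real n - 1) \<le> 1 + (norm z)\<^sup>2"
    proof (cases n)
      case 0
      then show ?thesis by (simp add: powr_minus)
    next
      case (Suc k)
      then have "\<not> norm z < 2 ^ k" using not_less_Least[of k "\<lambda>n. norm z < 2 ^ n"] by (simp add: n_def)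
      then have "(2 ^ k)\<^sup>2 \<le> (norm z)\<^sup>2" by (intro power_mono) auto
      moreover have "(2 ^ k)\<^sup>2 = (4::real) ^ k" by (simp add: power_mult[symmetric] power2_eq_square flip: power_mult_distrib)
      ultimately show ?thesis using Suc by (simp add: powr_realpow)
    qed
    then have "?f z \<le> a n" unfolding a_def using \<delta> by (intro powr_mono2') auto
    then have "ennreal (?f z) \<le> ennreal (a n) * indicator (?B n) z" using n by (simp add: ennreal_leI)
    also have "\<dots> = (\<Sum>m\<in>{n}. ennreal (a m) * indicator (?B m) z)"
      by (simp only: sum.insert finite.emptyI empty_iff sum.empty add_0_right not_False_eq_True)
    also have "\<dots> \<le> (\<Sum>n. ennreal (a n) * indicator (?B n) z)" by (rule sum_le_suminf) auto
    finally show ?thesis .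
  qed
  have meas: "(\<lambda>z. ennreal (a n) * indicator (?B n) z) \<in> borel_measurable borel" for n
  proof -
    have [measurable]: "?B n \<in> sets borel" by simp
    show ?thesis by measurable
  qed
  have "(\<integral>\<^sup>+z. ennreal (?f z) \<partial>lborel) \<le> (\<integral>\<^sup>+z. (\<Sum>n. ennreal (a n) * indicator (?B n) z) \<partial>lborel)"
    by (intro nn_integral_mono pt)
  also have "\<dots> = (\<Sum>n. ennreal (a n) * emeasure lborel (?B n))"
    by (subst nn_integral_suminf) (simp_all add: meas nn_integral_cmult_indicator)
  \<comment> \<open>The area of the ball grows like 4^n and \<open>a n\<close> decays like
    4^(-(1+\<delta>)n), which leaves a geometric series of ratio 4^(-\<delta>).\<close>
  also have "\<dots> = (\<Sum>n. ennreal ((4 powr (1 + \<delta>) * measure lborel (ball (0::complex) 1)) * (4 powr (- \<delta>)) ^ n))"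
  proof (intro arg_cong[where f=suminf] ext)
    fix n
    have "emeasure lborel (?B n) = ennreal (measure lborel (?B n))"
      using emeasure_lborel_ball_finite[of "0::complex" "2^n"] by (intro emeasure_eq_ennreal_measure) auto
    also have "measure lborel (?B n) = 4 ^ n * measure lborel (ball (0::complex) 1)"
      by (subst content_ball_conv_unit_ball) (auto simp: power2_eq_square simp flip: power_mult_distrib)
    finally have "ennreal (a n) * emeasure lborel (?B n) = ennreal (a n * (4 ^ n * measure lborel (ball (0::complex) 1)))"
      by (simp add: ennreal_mult' a_def)
    moreover have "a n * 4 ^ n = 4 powr (1 + \<delta>) * (4 powr (- \<delta>)) ^ n"
    proof -
      have "a n * 4 ^ n = 4 powr ((real n - 1) * (- 1 - \<delta>) + real n)"
        by (simp add: a_def powr_powr powr_add powr_realpow)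
      also have "(real n - 1) * (- 1 - \<delta>) + real n = (1 + \<delta>) + (- \<delta>) * real n" by (simp add: algebra_simps)
      finally have "a n * 4 ^ n = 4 powr ((1 + \<delta>) + (- \<delta>) * real n)" .
      also have "\<dots> = 4 powr (1 + \<delta>) * ((4 powr (- \<delta>)) powr real n)" by (simp only: powr_add powr_powr)
      also have "(4 powr (- \<delta>)) powr real n = (4 powr (- \<delta>)) ^ n" by (rule powr_realpow) simp
      finally show ?thesis .
    qed
    then have "a n * (4 ^ n * measure lborel (ball (0::complex) 1)) =
      (4 powr (1 + \<delta>) * measure lborel (ball (0::complex) 1)) * (4 powr (- \<delta>)) ^ n"
      by (simp add: mult_ac)
    ultimately show "ennreal (a n) * emeasure lborel (?B n) =
      ennreal ((4 powr (1 + \<delta>) * measure lborel (ball (0::complex) 1)) * (4 powr (- \<delta>)) ^ n)" by simp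
  qed
  also have "\<dots> < \<infinity>"
  proof -
    have "(4::real) powr (- \<delta>) < 4 powr 0" using \<delta> by (intro powr_less_mono) auto
    then have "summable (\<lambda>n. (4 powr (1 + \<delta>) * measure lborel (ball (0::complex) 1)) * (4 powr (- \<delta>)) ^ n)"
      by (intro summable_mult summable_geometric) simp
    then show ?thesis by (subst suminf_ennreal2) auto
  qed
  finally show "(\<integral>\<^sup>+z. ennreal (?f z) \<partial>lborel) < \<infinity>" .
qed auto

text \<open>The improper integral is available in the gauge sense; nonnegativity makes it absolute,
  and measurability allows the passage from the completed measure back to
  \<open>lborel\<close>.\<close>

lemma integrable_powr_at_infinity:
  fixes a :: real
  assumes "a < - 1" shows "integrable lborel (\<lambda>t. indicator {1..} t * t powr a)"
proof -
  have "((\<lambda>t. t powr a) has_integral -(1 powr (a + 1)) / (a + 1)) {1..}"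
    using has_integral_powr_to_inf[OF assms, of 1] by simp
  then have "(\<lambda>t. t powr a) absolutely_integrable_on {1..}"
    by (intro nonnegative_absolutely_integrable_1) (auto simp: integrable_on_def)
  then have "set_integrable lebesgue {1..} (\<lambda>t. t powr a)" .
  then have "integrable lebesgue (\<lambda>t. indicator {1..} t * t powr a)"
    by (simp add: set_integrable_def)
  then show ?thesis by (subst (asm) integrable_completion) auto
qed

text \<open>Cutting the integral over scales at t = n gives a function whose Laplacian is G minus a
  normalised average of G at scale n, by the representation formula for G itself with \<kappa> = 0.
  The conclusion is the weak form of the equation, which survives the limit. It is stated for every
  \<kappa>, because \<kappa> can be fixed only after the bound \<open>A\<close> is known.\<close>

theorem linear_solution:
  fixes G :: "complex \<Rightarrow> real"
  assumes \<beta>: "0 < \<beta>" "\<beta> \<le> 1" and G: "C_order 3 G" and bG: "\<And>z. \<bar>G z\<bar> \<le> C * (1 + (norm z)\<^sup>2) powr (- 1 - \<beta>)"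
    and zero: "(LINT z|lborel. G z) = 0"
  obtains v A where "v \<in> borel_measurable borel" "\<And>z. \<bar>v z\<bar> \<le> A" "\<And>\<kappa> z. bump_mass * v z = represent \<kappa> v G z"
proof -
  let ?\<rho> = "\<lambda>z::complex. 1 + (norm z)\<^sup>2"
  have lG: "locally_bounded G" by (rule locally_bounded_cts[OF C_order_imp_continuous[OF G]])
  have Gm[measurable]: "G \<in> borel_measurable borel" using lG by (simp add: locally_bounded_def)
  have C: "C \<ge> 0" using bG[of 0] abs_ge_zero[of "G 0"] by simp
  have bG': "\<bar>G z\<bar> \<le> C" for z :: complex
  proof -
    have "?\<rho> z powr (- 1 - \<beta>) \<le> ?\<rho> z powr 0" using \<beta> by (intro powr_mono) auto
    then have "C * ?\<rho> z powr (- 1 - \<beta>) \<le> C * 1" using one_plus_norm2_pos[of z] C by (intro mult_left_mono) auto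
    then show ?thesis using bG[of z] by simp
  qed
  have i1: "integrable lborel G"
  proof (rule Bochner_Integration.integrable_bound)
    show "integrable lborel (\<lambda>z. C * ?\<rho> z powr (- 1 - \<beta>))"
      by (intro integrable_mult_right integrable_powr_plane \<beta>)
    show "AE z in lborel. norm (G z) \<le> norm (C * ?\<rho> z powr (- 1 - \<beta>))"
      using bG by (intro AE_I2) (auto intro: order_trans[OF _ abs_ge_self])
  qed simp
  \<comment> \<open>The factor |z|^\<beta> costs at most (1 + |z|^2)^(\<beta>/2), half of the decay
    in excess of the exponent -1.\<close>
  have i2: "integrable lborel (\<lambda>z. norm z powr \<beta> * \<bar>G z\<bar>)"
  proof (rule Bochner_Integration.integrable_bound)
    show "integrable lborel (\<lambda>z. C * ?\<rho> z powr (- 1 - \<beta> / 2))"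
      by (intro integrable_mult_right integrable_powr_plane) (use \<beta> in simp)
    show "AE z in lborel. norm (norm z powr \<beta> * \<bar>G z\<bar>) \<le> norm (C * ?\<rho> z powr (- 1 - \<beta> / 2))"
    proof (rule AE_I2)
      fix z :: complex
      have "norm z powr \<beta> = ((norm z)\<^sup>2) powr (\<beta> / 2)"
        by (cases "z = 0") (use \<beta> in \<open>auto simp: powr_powr simp flip: powr_numeral\<close>)
      also have "\<dots> \<le> ?\<rho> z powr (\<beta> / 2)" using \<beta> by (intro powr_mono2) auto
      finally have "norm z powr \<beta> * \<bar>G z\<bar> \<le> ?\<rho> z powr (\<beta> / 2) * (C * ?\<rho> z powr (- 1 - \<beta>))"
        by (intro mult_mono bG) auto
      also have "\<dots> = C * ?\<rho> z powr (\<beta> / 2 + (- 1 - \<beta>))" by (simp only: powr_add mult_ac)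
      also have "\<beta> / 2 + (- 1 - \<beta>) = - 1 - \<beta> / 2" by simp
      finally show "norm (norm z powr \<beta> * \<bar>G z\<bar>) \<le> norm (C * ?\<rho> z powr (- 1 - \<beta> / 2))"
        using C by (simp add: abs_mult)
    qed
  qed simp
  define J where "J = (LINT x|lborel. norm x powr \<beta> * \<bar>G x\<bar>)"
  have J: "J \<ge> 0" unfolding J_def by (rule Bochner_Integration.integral_nonneg) simp
  have decay: "\<bar>smear (bump m) t G z\<bar> \<le> (2 * real m * J) * t powr (- 2 - \<beta>)" if "m > 1" "t > 0" for m t z
    using smear_bump_decay[OF that(1) \<beta> lG i1 i2 zero that(2)] unfolding J_def .
  define b3 where "b3 = (LINT y|lborel. \<bar>bump 3 y\<bar>)"
  have b3: "b3 \<ge> 0" unfolding b3_def by (rule Bochner_Integration.integral_nonneg) simp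
  \<comment> \<open>A majorant over all scales, uniform in z: the sup bound of G for t <= 1, the
    decay estimate for t >= 1. There the factor t/6 meets the 2 * 3 of the estimate, so
    \<open>J\<close> appears with coefficient 1.\<close>
  define \<psi> where "\<psi> t = C * b3 * indicator {0..1} t + J * (indicator {1..} t * t powr (- 1 - \<beta>))" for t :: real
  have int\<psi>: "integrable lborel \<psi>"
    unfolding \<psi>_def[abs_def] using integrable_powr_at_infinity[of "- 1 - \<beta>"] \<beta>
    by (intro Bochner_Integration.integrable_add integrable_mult_right) (auto intro!: integrable_real_indicator simp: emeasure_lborel_Icc_eq)
  have bound: "\<bar>indicator {0..real n} t * (t / 6 * smear (bump 3) t G z)\<bar> \<le> \<psi> t" for n t z
  proof -
    consider "t < 0" | "0 \<le> t" "t \<le> 1" | "t > 1" by linarith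
    then show ?thesis
    proof cases
      case 1
      then show ?thesis using C b3 J by (auto simp: \<psi>_def)
    next
      case 2
      have "\<bar>smear (bump 3) t G z\<bar> \<le> C * b3"
        unfolding b3_def by (rule average_bound[OF admissible_intros(2) lG bG'])
      then have "\<bar>t / 6\<bar> * \<bar>smear (bump 3) t G z\<bar> \<le> 1 * (C * b3)"
        using 2 by (intro mult_mono) auto
      moreover have "0 \<le> J * (indicator {1..} t * t powr (- 1 - \<beta>))" using J by simp
      ultimately show ?thesis using 2 C b3 by (auto simp: \<psi>_def abs_mult indicator_def)
    next
      case 3
      have "\<bar>t / 6\<bar> * \<bar>smear (bump 3) t G z\<bar> \<le> t / 6 * ((2 * real 3 * J) * t powr (- 2 - \<beta>))"
        using 3 decay[of 3 t z] by (intro mult_mono) auto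
      also have "\<dots> = J * t powr (- 1 - \<beta>)"
        using 3 powr_add[of t 1 "- 2 - \<beta>"] by simp
      finally show ?thesis using 3 J by (auto simp: \<psi>_def abs_mult indicator_def)
    qed
  qed
  define \<phi> where "\<phi> n z = (LINT t|lborel. indicator {0..real n} t * (t / 6 * smear (bump 3) t G z))" for n z
  define v where "v n z = (- 1 / bump_mass) * multismear (\<lambda>t. t * gauss_weight (1 / 6) 0 (real n) t) (bump 3) G z" for n z
  have k: "kernel (bump 3)" by (simp add: kernel_bump)
  have v\<phi>: "v n z = (- 1 / bump_mass) * \<phi> n z" for n z
    unfolding v_def \<phi>_def multismear_Fubini(2)[OF scale_weight_gauss_t k lG]
    by (intro arg_cong[where f="(*) _"] Bochner_Integration.integral_cong) (auto simp: gauss_weight_def)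
  have intn: "integrable lborel (\<lambda>t. indicator {0..real n} t * (t / 6 * smear (bump 3) t G z))" for n z
    using multismear_Fubini(1)[OF scale_weight_gauss_t[of "1/6" 0 "real n"] k lG, of z]
    by (rule Bochner_Integration.integrable_cong[THEN iffD1, rotated 2]) (auto simp: gauss_weight_def)
  let ?h = "\<lambda>z t. indicator {0..} t * (t / 6 * smear (bump 3) t G z)"
  have lim_ind: "(\<lambda>n. indicator {0..real n} t * (t / 6 * smear (bump 3) t G z)) \<longlonglongrightarrow> ?h z t" for t z
  proof (rule tendsto_eventually)
    obtain N where "t \<le> real N" using real_arch_simple by blast
    then show "\<forall>\<^sub>F n in sequentially. indicator {0..real n} t * (t / 6 * smear (bump 3) t G z) = ?h z t"
      unfolding eventually_sequentially by (intro exI[of _ N]) (auto simp: indicator_def)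
  qed
  define V where "V z = (- 1 / bump_mass) * (LINT t|lborel. ?h z t)" for z
  have lim: "(\<lambda>n. v n z) \<longlonglongrightarrow> V z" for z
    unfolding v\<phi> V_def
  proof (intro tendsto_mult tendsto_const)
    show "(\<lambda>n. \<phi> n z) \<longlonglongrightarrow> (LINT t|lborel. ?h z t)"
      unfolding \<phi>_def
    proof (rule integral_dominated_convergence[where w=\<psi>])
      show "?h z \<in> borel_measurable lborel"
        by (rule borel_measurable_LIMSEQ_real[OF lim_ind]) (use intn in auto)
    qed (use intn int\<psi> bound lim_ind in auto)
  qed
  have bv: "\<bar>v n z\<bar> \<le> (1 / bump_mass) * (LINT t|lborel. \<psi> t)" for n z
  proof -
    have "\<bar>\<phi> n z\<bar> \<le> (LINT t|lborel. \<psi> t)"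
      unfolding \<phi>_def by (rule abs_integral_le) (use intn int\<psi> bound in auto)
    then show ?thesis unfolding v\<phi> abs_mult using bump_mass_pos by (intro mult_mono) auto
  qed
  have Cv: "C_order 3 (v n)" for n
    unfolding v_def[abs_def] by (intro C_order_cmult C_order_average admissible_intros G)
  have lv: "locally_bounded (v n)" for n by (rule locally_bounded_cts[OF C_order_imp_continuous[OF Cv]])
  let ?g = "\<lambda>n z. G z - (1 / bump_mass) * smear (bump 2) (real n) G z"
  have lap: "laplacian (v n) = ?g n" for n
  proof
    fix z
    let ?M = "multismear (\<lambda>t. t * gauss_weight (1 / 6) 0 (real n) t) (bump 3)"
    have G2: "C_order 2 G" using G by (rule C_order_le) simp
    have "laplacian (v n) z = (- 1 / bump_mass) * laplacian (?M G) z"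
      unfolding v_def[abs_def] by (intro laplacian_cmult C_order_average admissible_intros G2)
    also have "laplacian (?M G) z = ?M (laplacian G) z"
      using laplacian_average[OF admissible_intros(5) G2] by metis
    also have "?M (laplacian G) z = smear (bump 2) (real n) G z - bump_mass * G z"
      using representation_formula[OF G, of "real n" z 0] by (simp add: average_def gauss_weight_def)
    finally show "laplacian (v n) z = ?g n z" using bump_mass_pos by (simp add: field_simps)
  qed
  have lg: "locally_bounded (?g n)" for n
    by (intro locally_bounded_cts continuous_intros continuous_on_average admissible_intros C_order_imp_continuous[OF G])
  have bg: "\<bar>?g n z\<bar> \<le> C + (1 / bump_mass) * (C * (LINT y|lborel. \<bar>bump 2 y\<bar>))" for n z
  proof -
    have "(1 / bump_mass) * \<bar>smear (bump 2) (real n) G z\<bar> \<le> (1 / bump_mass) * (C * (LINT y|lborel. \<bar>bump 2 y\<bar>))"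
      using bump_mass_pos by (intro mult_left_mono average_bound[OF admissible_intros(1) lG bG']) auto
    then have "\<bar>(1 / bump_mass) * smear (bump 2) (real n) G z\<bar> \<le> (1 / bump_mass) * (C * (LINT y|lborel. \<bar>bump 2 y\<bar>))"
      using bump_mass_pos by (simp add: abs_mult)
    then show ?thesis using bG'[of z] by linarith
  qed
  \<comment> \<open>The decay estimate serves a second time, now for \<open>bump 2\<close>: the
    average at scale n is the error made by the truncation.\<close>
  have limg: "(\<lambda>n. ?g n z) \<longlonglongrightarrow> G z" for z
  proof -
    have "(\<lambda>n. smear (bump 2) (real n) G z) \<longlonglongrightarrow> 0"
    proof (rule Lim_null_comparison)
      show "\<forall>\<^sub>F n in sequentially. norm (smear (bump 2) (real n) G z) \<le> (2 * real 2 * J) * real n powr (- 2 - \<beta>)"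
        unfolding eventually_sequentially by (intro exI[of _ 1]) (use decay[of 2] in auto)
      have "(\<lambda>n. real n powr (- 2 - \<beta>)) \<longlonglongrightarrow> 0"
        by (rule tendsto_neg_powr[OF _ filterlim_real_sequentially]) (use \<beta> in simp)
      from tendsto_mult_right_zero[OF this] show "(\<lambda>n. (2 * real 2 * J) * real n powr (- 2 - \<beta>)) \<longlonglongrightarrow> 0" .
    qed
    from tendsto_diff[OF tendsto_const tendsto_mult_right_zero[OF this, of "1 / bump_mass"]] show ?thesis by simp
  qed
  \<comment> \<open>The formula is exact for each truncation and any \<kappa>, and both sides
    converge, so \<open>V\<close> is never differentiated.\<close>
  have "bump_mass * V z = represent \<kappa> V G z" for \<kappa> z
  proof (rule LIMSEQ_unique)
    show "(\<lambda>n. represent \<kappa> (v n) (?g n) z) \<longlonglongrightarrow> represent \<kappa> V G z"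
      by (rule represent_tendsto[OF lv bv lim lg bg limg])
    show "(\<lambda>n. represent \<kappa> (v n) (?g n) z) \<longlonglongrightarrow> bump_mass * V z"
      unfolding lap[symmetric] represent_laplacian[OF Cv, symmetric] by (intro tendsto_intros lim)
  qed
  moreover have "V \<in> borel_measurable borel"
    by (rule borel_measurable_LIMSEQ_real[OF lim]) (use lv in \<open>auto simp: locally_bounded_def\<close>)
  moreover have "\<bar>V z\<bar> \<le> (1 / bump_mass) * (LINT t|lborel. \<psi> t)" for z
    by (rule LIMSEQ_le_const2[OF tendsto_rabs[OF lim]]) (use bv in auto)
  ultimately show ?thesis using that by blast
qed


section \<open>Symmetry of mixed derivatives and the complex Laplacian\<close>

text \<open>Recovers pointwise values from averages at small scales, so that continuous functions
  with equal averages at all nonzero scales can be identified.\<close>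

lemma smear_tendsto_at_0:
  assumes K: "kernel K" and g: "continuous_on UNIV g"
  shows "((\<lambda>t. smear K t g z) \<longlongrightarrow> g z * (LINT y|lborel. K y)) (at 0)"
proof -
  obtain B where B: "B \<ge> 0" "\<And>y. \<bar>K y\<bar> \<le> B * indicator (cball 0 1) y" and [measurable]: "K \<in> borel_measurable borel"
    using K by (auto elim: kernelE)
  have lg: "locally_bounded g" by (rule locally_bounded_cts[OF g])
  obtain C where C: "C \<ge> 0" "\<And>w. norm w \<le> norm z + 1 \<Longrightarrow> \<bar>g w\<bar> \<le> C" using lg by (rule locally_boundedE) blast
  have "((\<lambda>t. LINT y|lborel. K y * g (z + t *\<^sub>R y)) \<longlongrightarrow> (LINT y|lborel. K y * g z)) (at 0)"
  proof (rule tendsto_integral_dominated[where r=1 and w="\<lambda>y. B * C * indicator (cball 0 1) y"])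
    show "(\<lambda>y. K y * g (z + t *\<^sub>R y)) \<in> borel_measurable lborel" for t
      using average_integrable[OF admissible_smear[OF K] lg] by auto
    show "integrable lborel (\<lambda>y. B * C * indicator (cball 0 1) (y::complex))"
      using emeasure_lborel_cball_finite[of "0::complex" 1] by simp
    fix y
    have "continuous_on UNIV (\<lambda>t. g (z + t *\<^sub>R y))"
      by (rule continuous_on_compose2[OF g]) (intro continuous_intros subset_UNIV)+
    then have "isCont (\<lambda>t. g (z + t *\<^sub>R y)) 0" by (simp add: continuous_on_eq_continuous_at)
    then have "((\<lambda>t. g (z + t *\<^sub>R y)) \<longlongrightarrow> g z) (at 0)" by (simp add: isCont_def)
    then show "((\<lambda>t. K y * g (z + t *\<^sub>R y)) \<longlongrightarrow> K y * g z) (at 0)" by (intro tendsto_intros)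
    fix t :: real assume t: "t \<in> ball 0 1"
    show "\<bar>K y * g (z + t *\<^sub>R y)\<bar> \<le> B * C * indicator (cball 0 1) y"
    proof (cases "norm y \<le> 1")
      case True
      have "norm (z + t *\<^sub>R y) \<le> norm z + 1"
        using norm_triangle_ineq[of z "t *\<^sub>R y"] mult_mono[of "\<bar>t\<bar>" 1 "norm y" 1] t True by simp
      from C(2)[OF this] have "\<bar>K y\<bar> * \<bar>g (z + t *\<^sub>R y)\<bar> \<le> B * C"
        using B(2)[of y] True B(1) by (intro mult_mono) auto
      then show ?thesis using True by (simp add: abs_mult)
    qed (use B(2)[of y] in simp)
  qed auto
  then show ?thesis by (simp add: average_def mult.commute)
qed

text \<open>Both derivatives are moved onto the kernel, where they visibly commute.\<close>

lemma deriv_along_commute: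
  fixes u :: "complex \<Rightarrow> real"
  assumes u: "C_order 2 u"
  shows "deriv_along w (deriv_along v u) z = deriv_along v (deriv_along w u) z"
proof -
  have u1: "C_order 1 u" using u by (rule C_order_le) simp
  have d: "C_order 1 (deriv_along v u)" for v using u by (simp add: numeral_2_eq_2)
  have dd: "continuous_on UNIV (deriv_along w (deriv_along v u))" for v w using d[of v] by simp
  have e: "smear (bump 3) t (deriv_along w (deriv_along v u)) z = (6 / t) * (- (1 / t) *
      smear (\<lambda>y. (v \<bullet> w) * bump 2 y - 4 * (y \<bullet> w) * dipole 1 v y) t u z)" if t: "t \<noteq> 0" for t v w
    using smear_bump_deriv_along[OF _ d[of v] t, where m=2 and v=w and z=z]
      smear_deriv_along[OF kernel_dipole kernel_derivative_dipole[of w] u1 t, where v=v and z=z]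
    by (simp add: numeral_3_eq_3)
  \<comment> \<open>Unfolding the dipole leaves (y . v)(y . w) times \<open>bump 1\<close>, which is
    symmetric in \<open>v\<close> and \<open>w\<close>, as is the first term.\<close>
  have sym: "(v \<bullet> w) * bump 2 y - 4 * (y \<bullet> w) * dipole 1 v y = (w \<bullet> v) * bump 2 y - 4 * (y \<bullet> v) * dipole 1 w y" for y
    unfolding dipole_def inner_commute[of w v] by simp
  have eq: "smear (bump 3) t (deriv_along w (deriv_along v u)) z = smear (bump 3) t (deriv_along v (deriv_along w u)) z"
    if "t \<noteq> 0" for t
    unfolding e[OF that] sym ..
  have k: "kernel (bump 3)" by (simp add: kernel_bump)
  have "((\<lambda>t. smear (bump 3) t (deriv_along v (deriv_along w u)) z) \<longlongrightarrow> deriv_along w (deriv_along v u) z * (LINT y|lborel. bump 3 y)) (at 0)"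
    by (rule Lim_transform_eventually[OF smear_tendsto_at_0[OF k dd[of v w]]]) (auto simp: eventually_at_filter eq)
  from tendsto_unique[OF _ this smear_tendsto_at_0[OF k dd[of w v]]] integral_bump_pos[of 3]
  show ?thesis by simp
qed

text \<open>The imaginary part is a difference of mixed derivatives and cancels by
  \<open>deriv_along_commute\<close>; the 4 collects the two halves in \<open>d_z\<close> and
  \<open>d_zbar\<close>.\<close>

lemma d_z_d_zbar_laplacian:
  assumes u: "C_order 2 u"
  shows "d_z (d_zbar (\<lambda>w. of_real (u w))) z = of_real (laplacian u z) / 4"
proof -
  have u1: "C_order (Suc 0) u" using u by (rule C_order_le) simp
  have d: "C_order (Suc 0) (deriv_along v u)" for v using u by (simp add: numeral_2_eq_2)
  have "deriv_along v (\<lambda>w. complex_of_real (u w)) z = of_real (deriv_along v u z)" for v z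
    by (rule deriv_along_eq) (rule has_derivative_of_real[OF has_derivative_deriv_along[OF u1]])
  then have zbar: "d_zbar (\<lambda>w. of_real (u w)) = (\<lambda>z. (of_real (deriv_along 1 u z) + \<i> * of_real (deriv_along \<i> u z)) / 2)"
    by (intro ext) (simp add: d_zbar_def)
  have D: "deriv_along v (\<lambda>z. (complex_of_real (deriv_along 1 u z) + \<i> * of_real (deriv_along \<i> u z)) / 2) z
     = (of_real (deriv_along v (deriv_along 1 u) z) + \<i> * of_real (deriv_along v (deriv_along \<i> u) z)) / 2" for v
    by (rule deriv_along_eq)
       (intro bounded_linear.has_derivative[OF bounded_linear_divide] has_derivative_add has_derivative_mult_right has_derivative_of_real has_derivative_deriv_along[OF d])
  have "d_z (d_zbar (\<lambda>w. of_real (u w))) z =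
     ((of_real (deriv_along 1 (deriv_along 1 u) z) + \<i> * of_real (deriv_along 1 (deriv_along \<i> u) z)) / 2
     - \<i> * ((of_real (deriv_along \<i> (deriv_along 1 u) z) + \<i> * of_real (deriv_along \<i> (deriv_along \<i> u) z)) / 2)) / 2"
    unfolding zbar d_z_def D ..
  also have "\<dots> = of_real (laplacian u z) / 4"
    unfolding deriv_along_commute[OF u, where w=1 and v=\<i>] laplacian_def by (simp add: complex_eq_iff)
  finally show ?thesis .
qed

section \<open>The semilinear equation\<close>

text \<open>\<open>represent\<close> is linear and reproduces constants up to
  \<open>bump_mass\<close>. When v solves the weak equation with datum G, the last term is the only
  defect; its kernel is nonnegative, so the sign of g - G decides whether v + c is an upper or a
  lower barrier.\<close>

lemma represent_shift:
  assumes v: "locally_bounded v" and g: "locally_bounded g" and G: "locally_bounded G"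
  shows "represent \<kappa> (\<lambda>z. v z + c) g z = represent \<kappa> v G z + bump_mass * c
    - multismear (\<lambda>t. t * gauss_weight (1 / 6) \<kappa> 1 t) (bump 3) (\<lambda>z. g z - G z) z"
proof -
  have lc: "locally_bounded (\<lambda>_. c)" by (intro locally_bounded_cts continuous_intros)
  have "average M k p (\<lambda>_. 0) z = 0" for M :: "'a measure" and k p by (simp add: average_def)
  then have "bump_mass * c = exp (- \<kappa>) * smear (bump 2) 1 (\<lambda>_. c) z
    + multismear (\<lambda>t. t * gauss_weight (2 * \<kappa>) \<kappa> 1 t) (bump 2) (\<lambda>_. c) z"
    using represent_laplacian[OF C_order_const[of 3 c], where z=z and \<kappa>=\<kappa>]
    by (simp add: represent_def laplacian_def average_def)
  then show ?thesis
    unfolding represent_def average_add[OF admissible_intros(1) v lc] average_add[OF admissible_intros(4) v lc]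
      average_diff[OF admissible_intros(5) g G]
    by (simp only: distrib_left)
qed

text \<open>Turns the hypothesis that h is not identically zero into a positive total mass of H, by
  which \<mu> is obtained as a quotient.\<close>

lemma integral_pos_of_continuous:
  fixes H :: "'a::euclidean_space \<Rightarrow> real"
  assumes H: "continuous_on UNIV H" "integrable lborel H" "\<And>z. 0 \<le> H z" and z: "H z0 \<noteq> 0"
  shows "0 < (LINT z|lborel. H z)"
proof -
  have pos: "H z0 > 0" using H(3)[of z0] z by linarith
  have "isCont H z0" using H(1) by (simp add: continuous_on_eq_continuous_at)
  then obtain e where e: "e > 0" "\<And>z. dist z z0 < e \<Longrightarrow> dist (H z) (H z0) < H z0 / 2"
    unfolding continuous_at_eps_delta using pos by (metis half_gt_zero)
  have "0 < H z0 / 2 * measure lborel (ball z0 e)" using pos content_ball_pos[OF e(1)] by simp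
  also have "\<dots> = (LINT z|lborel. H z0 / 2 * indicator (ball z0 e) z)" by simp
  also have "\<dots> \<le> (LINT z|lborel. H z)"
  proof (rule integral_mono)
    show "integrable lborel (\<lambda>z. H z0 / 2 * indicator (ball z0 e) z)"
      using emeasure_lborel_ball_finite[of z0 e] by simp
    show "H z0 / 2 * indicator (ball z0 e) z \<le> H z" for z
      using e(2)[of z] H(3)[of z] by (cases "z \<in> ball z0 e") (auto simp: dist_real_def dist_commute abs_if split: if_splits)
  qed (rule H(2))
  finally show ?thesis .
qed

theorem semilinear_solution:
  fixes F H :: "complex \<Rightarrow> real"
  assumes \<beta>: "0 < \<beta>" "\<beta> \<le> 1" and F: "smooth F" and H: "smooth H" "\<And>z. 0 \<le> H z" "H z0 \<noteq> 0"
    and bF: "\<And>z. \<bar>F z\<bar> \<le> C * (1 + (norm z)\<^sup>2) powr (- 1 - \<beta>)"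
    and bH: "\<And>z. H z \<le> C * (1 + (norm z)\<^sup>2) powr (- 1 - \<beta>)"
    and neg: "(LINT z|lborel. F z) < 0"
  obtains u where "smooth u" "bounded (range u)" "\<And>z. laplacian u z = F z + H z * exp (u z)"
proof -
  let ?w = "\<lambda>z::complex. (1 + (norm z)\<^sup>2) powr (- 1 - \<beta>)"
  have sF: "C_order n F" and sH: "C_order n H" for n using F H by (simp_all add: smooth_def)
  have cF: "continuous_on UNIV F" and cH: "continuous_on UNIV H"
    using C_order_imp_continuous[OF sF] C_order_imp_continuous[OF sH] by blast+
  have [measurable]: "F \<in> borel_measurable borel" "H \<in> borel_measurable borel"
    using cF cH by (auto intro: borel_measurable_continuous_onI)
  have C: "C \<ge> 0" using order_trans[OF H(2)[of 0] bH[of 0]] by simp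
  have w1: "?w z \<le> 1" for z
  proof -
    have "?w z \<le> (1 + (norm z)\<^sup>2) powr 0" using \<beta> by (intro powr_mono) auto
    then show ?thesis using one_plus_norm2_pos[of z] by simp
  qed
  have Cw: "C * ?w z \<le> C" for z using mult_left_mono[OF w1 C] by simp
  have bF': "\<bar>F z\<bar> \<le> C" and bH': "H z \<le> C" for z
    using order_trans[OF bF Cw] order_trans[OF bH Cw] by blast+
  have iw: "integrable lborel (\<lambda>z. C * ?w z)" by (intro integrable_mult_right integrable_powr_plane \<beta>)
  have iF: "integrable lborel F"
    by (rule Bochner_Integration.integrable_bound[OF iw])
       (use bF in \<open>auto intro!: AE_I2 intro: order_trans[OF _ abs_ge_self]\<close>)
  have iH: "integrable lborel H"
    by (rule Bochner_Integration.integrable_bound[OF iw])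
       (use bH H(2) in \<open>auto intro!: AE_I2 intro: order_trans[OF _ abs_ge_self]\<close>)
  have posH: "(LINT z|lborel. H z) > 0" by (rule integral_pos_of_continuous[OF cH iH H(2,3)])
  \<comment> \<open>The negative mean of F is what makes \<mu> positive, so that e^u can be compared
    with it through ln \<mu>.\<close>
  define \<mu> where "\<mu> = - (LINT z|lborel. F z) / (LINT z|lborel. H z)"
  have \<mu>: "\<mu> > 0" using neg posH by (simp add: \<mu>_def divide_neg_pos)
  let ?G = "\<lambda>z. F z + \<mu> * H z"
  have sG: "C_order n ?G" for n by (intro C_order_add C_order_cmult sF sH)
  have "\<bar>?G z\<bar> \<le> (C + \<mu> * C) * ?w z" for z
  proof -
    have "\<mu> * H z \<le> \<mu> * (C * ?w z)" using \<mu> by (intro mult_left_mono bH) simp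
    moreover have "0 \<le> \<mu> * H z" using \<mu> H(2) by simp
    ultimately have "\<bar>?G z\<bar> \<le> C * ?w z + \<mu> * (C * ?w z)" using bF[of z] by linarith
    then show ?thesis by (simp add: algebra_simps)
  qed
  moreover have "(LINT z|lborel. ?G z) = 0" using iF iH posH by (simp add: \<mu>_def)
  ultimately obtain v A where v: "v \<in> borel_measurable borel" "\<And>z. \<bar>v z\<bar> \<le> A" "\<And>\<kappa> z. bump_mass * v z = represent \<kappa> v ?G z"
    using linear_solution[OF \<beta> sG] by blast
  have A: "A \<ge> 0" using order_trans[OF abs_ge_zero v(2)] .
  note [measurable] = v(1)
  \<comment> \<open>With |v| <= A this choice gives v - c <= ln \<mu> <= v + c everywhere.\<close>
  define c where "c = A + \<bar>ln \<mu>\<bar>"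
  have c: "c \<ge> 0" using A by (simp add: c_def)
  let ?up = "\<lambda>z. v z + c" and ?lo = "\<lambda>z. v z + - c"
  have up: "\<mu> \<le> exp (?up z)" and lo: "exp (?lo z) \<le> \<mu>" for z
  proof -
    have "ln \<mu> \<le> ?up z" "?lo z \<le> ln \<mu>" using v(2)[of z] by (auto simp: c_def)
    then show "\<mu> \<le> exp (?up z)" "exp (?lo z) \<le> \<mu>" using \<mu> by (metis exp_le_cancel_iff exp_ln)+
  qed
  have bup: "\<bar>?up z\<bar> \<le> A + c" and blo: "\<bar>?lo z\<bar> \<le> A + c" for z using v(2)[of z] c by auto
  \<comment> \<open>C exp (A + c) bounds H e^u for every u below the upper barrier; the summand 1
    ensures \<kappa> > 0.\<close>
  define \<kappa> where "\<kappa> = 1 + C * exp (A + c)"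
  have \<kappa>: "\<kappa> > 0" using C by (simp add: \<kappa>_def add_pos_nonneg)
  have lv: "locally_bounded v" by (rule locally_bounded_bdd[OF v(1,2)])
  have lG: "locally_bounded ?G" by (rule locally_bounded_cts[OF C_order_imp_continuous[OF sG]])
  let ?g = "\<lambda>u z. F z + H z * exp (u z)"
  have bg: "\<bar>?g u z\<bar> \<le> C + C * exp (A + c)" if "\<And>z. \<bar>u z\<bar> \<le> A + c" for u :: "complex \<Rightarrow> real" and z
  proof -
    have "\<bar>H z * exp (u z)\<bar> \<le> C * exp (A + c)"
      unfolding abs_mult by (intro mult_mono) (use H(2) bH' that[of z] C in auto)
    then show ?thesis using bF'[of z] by linarith
  qed
  have lg: "locally_bounded (?g u)" if [measurable]: "u \<in> borel_measurable borel" and "\<And>z. \<bar>u z\<bar> \<le> A + c" for u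
    by (rule locally_bounded_bdd[OF _ bg[OF that(2)]]) measurable
  let ?N = "multismear (\<lambda>t. t * gauss_weight (1 / 6) \<kappa> 1 t) (bump 3)"
  have Npos: "0 \<le> (fst p * gauss_weight (1 / 6) \<kappa> 1 (fst p)) * bump 3 (snd p)" for p
    by (intro mult_nonneg_nonneg[OF gauss_weight_nonneg]) auto
  have l0: "locally_bounded (\<lambda>_. 0)" by (intro locally_bounded_cts continuous_intros)
  have N0: "?N (\<lambda>_. 0) z = 0" for z by (simp add: average_def)
  have lup: "locally_bounded (?g ?up)" and llo: "locally_bounded (?g ?lo)" by (rule lg[OF _ bup] lg[OF _ blo], measurable)+
  \<comment> \<open>At the upper barrier H e^(v + c) >= \<mu> H, so the defect in
    \<open>represent_shift\<close> is subtracted with a nonnegative sign; the lower barrier is the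
    mirror image.\<close>
  have super: "represent \<kappa> ?up (?g ?up) z \<le> bump_mass * ?up z" for z
  proof -
    have "?N (\<lambda>_. 0) z \<le> ?N (\<lambda>z. ?g ?up z - ?G z) z"
    proof (rule average_mono[OF admissible_intros(5) l0 locally_bounded_diff[OF lup lG] Npos])
      show "0 \<le> ?g ?up z - ?G z" for z using mult_left_mono[OF up[of z] H(2)[of z]] by (simp add: mult.commute)
    qed
    then show ?thesis unfolding represent_shift[OF lv lup lG] v(3)[symmetric] N0 by (simp add: distrib_left)
  qed
  have sub: "bump_mass * ?lo z \<le> represent \<kappa> ?lo (?g ?lo) z" for z
  proof -
    have "?N (\<lambda>z. ?g ?lo z - ?G z) z \<le> ?N (\<lambda>_. 0) z"
    proof (rule average_mono[OF admissible_intros(5) locally_bounded_diff[OF llo lG] l0 Npos])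
      show "?g ?lo z - ?G z \<le> 0" for z using mult_left_mono[OF lo[of z] H(2)[of z]] by (simp add: mult.commute)
    qed
    then show ?thesis unfolding represent_shift[OF lv llo lG] v(3)[symmetric] N0 by (simp add: right_diff_distrib)
  qed
  have k: "H z * exp (?up z) \<le> 12 * \<kappa>" for z
  proof -
    have "H z * exp (?up z) \<le> C * exp (A + c)" by (intro mult_mono) (use H(2) bH' bup[of z] C in auto)
    moreover have "0 \<le> C * exp (A + c)" using C by simp
    ultimately show ?thesis unfolding \<kappa>_def by (simp add: distrib_left)
  qed
  have m: "?up \<in> borel_measurable borel" "?lo \<in> borel_measurable borel" by measurable
  have Hm: "F \<in> borel_measurable borel" "H \<in> borel_measurable borel" by measurable
  obtain u where u: "u \<in> borel_measurable borel" "\<And>z. ?lo z \<le> u z" "\<And>z. u z \<le> ?up z"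
      "\<And>z. bump_mass * u z = represent \<kappa> u (?g u) z"
    using fixed_point_between_barriers[OF \<kappa> Hm(1) bF' Hm(2) H(2) bH' m(1) bup m(2) blo _ k super sub] c by auto
  have bu: "\<bar>u z\<bar> \<le> A + c" for z using u(2,3)[of z] bup[of z] blo[of z] by linarith
  have su: "smooth u"
    by (rule fixed_point_smooth[OF u(1) bu _ lg[OF u(1) bu] u(4)])
       (intro C_order_add C_order_mult C_order_exp sF sH)
  then have Cu: "C_order n u" for n by (simp add: smooth_def)
  have bgu: "\<bar>?g u z\<bar> \<le> C + C * exp (A + c)" for z by (rule bg[OF bu])
  have "C_order 3 (?g u)" by (intro C_order_add C_order_mult C_order_exp sF sH Cu)
  then have "laplacian u z = ?g u z" for z
    by (rule fixed_point_laplacian[OF \<kappa> Cu _ bu bgu u(4)])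
  moreover have "bounded (range u)" using bu by (auto simp: bounded_iff)
  ultimately show ?thesis using that su by blast
qed

theorem proposition4p1:
  fixes l k \<Lambda> :: real and f h :: "complex \<Rightarrow> real"
  assumes "l > 0" and "k \<in> {l - 2..<l - 1}"
    and "smooth f" and "smooth h"
    and "\<exists>z. f z \<noteq> 0" and "\<exists>z. h z \<noteq> 0"
    and "Re (form2_integral (\<lambda>z v w. of_real (f z) * omega k z v w)) < 0"
    and "\<forall>z. \<bar>f z\<bar> \<le> \<Lambda> * (1 + (cmod z)\<^sup>2) powr (- l)"
    and "\<forall>z. - \<Lambda> * (1 + (cmod z)\<^sup>2) powr (- l) \<le> h z \<and> h z \<le> 0"
  shows "\<exists>u :: complex \<Rightarrow> real. smooth u \<and> bounded (range u) \<and>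
     (\<forall>z. \<i> * Lambda_op (omega k) (del_delbar (\<lambda>w. of_real (u w))) z
          + of_real (h z * exp (u z)) = of_real (f z))"
proof -
  let ?\<rho> = "\<lambda>z::complex. 1 + (cmod z)\<^sup>2"
  \<comment> \<open>\<beta> is the decay of \<rho>^k \<rho>^(-l) in excess of \<rho>^(-1); the range
    of k places it in (0, 1].\<close>
  define \<beta> where "\<beta> = l - 1 - k"
  have \<beta>: "0 < \<beta>" "\<beta> \<le> 1" using assms(2) by (auto simp: \<beta>_def)
  \<comment> \<open>The operator is half of \<rho>^(-k) times the flat Laplacian, hence
    multiplication by 2 \<rho>^k; carrying the h term to the other side brings the minus
    sign.\<close>
  let ?F = "\<lambda>z. 2 * (?\<rho> z powr k * f z)" and ?H = "\<lambda>z. (-2) * (?\<rho> z powr k * h z)"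
  have sF: "smooth ?F" and sH: "smooth ?H"
    unfolding smooth_def
    by (intro allI C_order_cmult C_order_mult C_order_powr; use assms(3,4) in \<open>simp add: smooth_def\<close>)+
  have pw: "?\<rho> z powr k * (\<Lambda> * ?\<rho> z powr (- l)) = \<Lambda> * ?\<rho> z powr (- 1 - \<beta>)" for z
    by (simp add: \<beta>_def mult.left_commute flip: powr_add)
  have bF: "\<bar>?F z\<bar> \<le> (2 * \<Lambda>) * ?\<rho> z powr (- 1 - \<beta>)" for z
    using mult_left_mono[OF assms(8)[rule_format, of z], of "?\<rho> z powr k"] unfolding pw by (simp add: abs_mult)
  have bH: "?H z \<le> (2 * \<Lambda>) * ?\<rho> z powr (- 1 - \<beta>)" for z
  proof -
    have "- h z \<le> \<Lambda> * ?\<rho> z powr (- l)"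
      using assms(9)[rule_format, of z] unfolding mult_minus_left by linarith
    then have "?\<rho> z powr k * - h z \<le> ?\<rho> z powr k * (\<Lambda> * ?\<rho> z powr (- l))"
      by (rule mult_left_mono) simp
    then show ?thesis unfolding pw mult_minus_right mult_minus_left mult.assoc by linarith
  qed
  have H0: "0 \<le> ?H z" for z using mult_nonneg_nonpos[OF powr_ge_zero[of "?\<rho> z" k] conjunct2[OF assms(9)[rule_format, of z]]] by linarith
  obtain z0 where "h z0 \<noteq> 0" using assms(6) ..
  then have z0: "?H z0 \<noteq> 0" using one_plus_norm2_pos[of z0] by simp
  \<comment> \<open>The integral of f against \<open>omega k\<close> is that of \<rho>^k f over the
    plane, half the integral of \<open>?F\<close>.\<close>
  have neg: "(LINT z|lborel. ?F z) < 0"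
    using assms(7) unfolding form2_integral_omega by (simp add: mult.commute)
  obtain u where u: "smooth u" "bounded (range u)" "\<And>z. laplacian u z = ?F z + ?H z * exp (u z)"
    using semilinear_solution[OF \<beta> sF sH H0 z0 bF bH neg] by blast
  have "\<i> * Lambda_op (omega k) (del_delbar (\<lambda>w. of_real (u w))) z + of_real (h z * exp (u z)) = of_real (f z)" for z
  proof -
    have "C_order 2 u" using u(1) by (simp add: smooth_def)
    then have "\<i> * Lambda_op (omega k) (del_delbar (\<lambda>w. of_real (u w))) z =
        of_real (2 * ?\<rho> z powr (- k) * (laplacian u z / 4))"
      unfolding i_Lambda_op_del_delbar by (simp add: d_z_d_zbar_laplacian)
    also have "2 * ?\<rho> z powr (- k) * (laplacian u z / 4) = (?\<rho> z powr (- k) * ?\<rho> z powr k) * (f z - h z * exp (u z))"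
      unfolding u(3) by (simp add: field_simps)
    also have "?\<rho> z powr (- k) * ?\<rho> z powr k = 1"
      using one_plus_norm2_pos[of z] by (simp flip: powr_add)
    finally show ?thesis by simp
  qed
  with u show ?thesis by blast
qed

end
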